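(* Let $\mathfrak g$ be the Lie algebra defined by generators $x_1,\dots,x_n$ and a single relation $f=0$, where $f$ is a linear combination of standard nonassociative words, and suppose that the quantum universal enveloping algebra $U_P(\mathfrak g)$ is defined (i.e. $f^*$ is a quantum operation). Then the set of all super-letters that are hard in $U_P(\mathfrak g)$ coincides with the Hall--Shirshov basis of $\mathfrak g$ with the skew commutator in place of the Lie operation; that is, for a standard word $u$, the super-letter $[u]$ is hard in $U_P(\mathfrak g)$ if and only if the standard nonassociative word on $u$ belongs to the Hall--Shirshov basis of $\mathfrak g$.
   Context: $\mathbf k$ is a field, $G$ an abelian group; to each variable $x_i$ ($1\le i\le n$) are associated $g_i\in G$ and a character $\chi^i:G\to\mathbf k^*$ ("quantum variables"), $p_{ij}=\chi^i(g_j)$, $P=\|p_{ij}\|$. For words $u,v$: $g_u,\chi^u$ are obtained by replacing each $x_i$ by $g_i$, resp. $\chi^i$; $p(u,v)=\chi^u(g_v)$. Skew commutator of homogeneous polynomials (for the $G\times G^*$-grading): $[u,v]=uv-p(u,v)vu$. A noncommutative polynomial in quantum variables is a quantum operation if, in every Hopf algebra, all its values are skew primitive whenever each variable $x_i$ takes a value $a_i$ with $\Delta(a_i)=a_i\otimes1+g_i\otimes a_i$ and $g^{-1}a_ig=\chi^i(g)a_i$ for $g\in G$. For the Lie relation $f$, $f^*$ denotes the polynomial obtained from $f$ by replacing the Lie bracket with the skew commutator. When $f^*$ is a quantum operation, $U_P(\mathfrak g)$ is the Hopf algebra generated by $G$ and $x_1,\dots,x_n$ with the relations of $G$, $g^{-1}x_ig=\chi^i(g)x_i$,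 and $f^*=0$, with $\Delta(x_i)=x_i\otimes1+g_i\otimes x_i$, $\Delta(g)=g\otimes g$. Words are ordered lexicographically with $x_1>\dots>x_n$, a proper prefix of a word being greater than that word. A nonempty word $u$ is standard if $vw>wv$ for each decomposition $u=vw$ with $v,w$ nonempty. The standard nonassociative word on a standard word $u$ is given recursively: $x_i$ if $u=x_i$, and otherwise $[[v][w]]$ where $u=vw$, $v,w$ standard and $v$ of minimal length; every standard word carries exactly one. The super-letter $[u]$ is the polynomial obtained by interpreting the brackets as the skew commutator. $[u]>[v]$ iff $u>v$; a super-word is a product of super-letters, a $G$-super-word is $g$ times a super-word, $g\in G$. Positive degrees $D(x_i)$ in a linearly ordered abelian group are fixed and extended additively. A super-letter $[u]$ is hard in $H=U_P(\mathfrak g)$ if its value in $H$ is not a linear combination of values of super-words of the same degree in super-letters less than $[u]$ and of $G$-super-words of lesser degree. The Hall--Shirshov basis of $\mathfrak g$ is the set of those standard nonassociative words $[u]$ (brackets interpreted as the Lie operation) whose value in $\mathfrak g$ is not a linear combination of values of standard nonassociative words $[v]$ with $D(v)<D(u)$, or $D(v)=D(u)$ and $v<u$.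
   Formalization: Added hypothesis: f* is homogeneous for the G×G*-grading. Without it the claim fails: if g_1=g_2, χ^1≠χ^2, D(x_1)=D(x_2), f=x_1−x_2, then x_1=x_2=0 in U_P(g), so nothing is hard, but the Hall–Shirshov basis is {x_2}. *)

theory Defs
  imports Complex_Main "HOL-Library.Poly_Mapping"
begin

subsection \<open>Vector spaces of finitely supported functions\<close>

definition scale :: "'k \<Rightarrow> ('b \<Rightarrow>\<^sub>0 'k) \<Rightarrow> ('b \<Rightarrow>\<^sub>0 'k::field)" where
  "scale c a = Poly_Mapping.map (\<lambda>x. c * x) a"

lemma lookup_scale [simp]: "Poly_Mapping.lookup (scale c a) b = c * Poly_Mapping.lookup a b"
  unfolding scale_def by (simp add: Poly_Mapping.map.rep_eq when_def)

lemma vector_space_scale: "vector_space (scale :: 'k::field \<Rightarrow> ('b \<Rightarrow>\<^sub>0 'k) \<Rightarrow> _)"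
  by unfold_locales (auto intro!: poly_mapping_eqI simp: Poly_Mapping.lookup_add algebra_simps)

abbreviation lin_span :: "('b \<Rightarrow>\<^sub>0 'k::field) set \<Rightarrow> ('b \<Rightarrow>\<^sub>0 'k) set" where
  "lin_span \<equiv> module.span scale"

abbreviation basis_vec :: "'b \<Rightarrow> ('b \<Rightarrow>\<^sub>0 'k::field)" where
  "basis_vec b \<equiv> Poly_Mapping.single b 1"

text \<open>The linear map with prescribed values on the basis vectors.\<close>

definition lin_ext :: "('b \<Rightarrow> ('c \<Rightarrow>\<^sub>0 'k)) \<Rightarrow> ('b \<Rightarrow>\<^sub>0 'k) \<Rightarrow> ('c \<Rightarrow>\<^sub>0 'k::field)" where
  "lin_ext F a = (\<Sum>b\<in>Poly_Mapping.keys a. scale (Poly_Mapping.lookup a b) (F b))"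

definition lin_form :: "('b \<Rightarrow> 'k) \<Rightarrow> ('b \<Rightarrow>\<^sub>0 'k) \<Rightarrow> 'k::field" where
  "lin_form F a = (\<Sum>b\<in>Poly_Mapping.keys a. Poly_Mapping.lookup a b * F b)"

definition bilin_ext ::
  "('a \<Rightarrow> 'b \<Rightarrow> ('c \<Rightarrow>\<^sub>0 'k)) \<Rightarrow> ('a \<Rightarrow>\<^sub>0 'k) \<Rightarrow> ('b \<Rightarrow>\<^sub>0 'k) \<Rightarrow> ('c \<Rightarrow>\<^sub>0 'k::field)" where
  "bilin_ext F s t = lin_ext (\<lambda>x. lin_ext (\<lambda>y. F x y) t) s"

text \<open>The tensor product of the spaces with bases \<open>A\<close> and \<open>B\<close> is the space with basis \<open>A \<times> B\<close>.\<close>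

definition tensor :: "('a \<Rightarrow>\<^sub>0 'k) \<Rightarrow> ('b \<Rightarrow>\<^sub>0 'k) \<Rightarrow> ('a \<times> 'b \<Rightarrow>\<^sub>0 'k::field)" where
  "tensor = bilin_ext (\<lambda>x y. basis_vec (x, y))"

subsection \<open>Hopf algebras\<close>

text \<open>
  Every vector space over a field has a basis, so up to isomorphism a Hopf algebra is a Hopf algebra
  structure on the finitely supported functions on a set \<open>hbasis H\<close>. The structure maps are
  given by their values on basis vectors and extended linearly.
\<close>

record (overloaded) ('b, 'k) hopf =
  hbasis :: "'b set"
  hmult :: "'b \<Rightarrow> 'b \<Rightarrow> ('b \<Rightarrow>\<^sub>0 'k)"
  hunit :: "'b \<Rightarrow>\<^sub>0 'k"
  hcomult :: "'b \<Rightarrow> ('b \<times> 'b \<Rightarrow>\<^sub>0 'k)"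
  hcounit :: "'b \<Rightarrow> 'k"
  hantipode :: "'b \<Rightarrow> ('b \<Rightarrow>\<^sub>0 'k)"

definition hcarrier :: "('b, 'k::field) hopf \<Rightarrow> ('b \<Rightarrow>\<^sub>0 'k) set" where
  "hcarrier H = {a. Poly_Mapping.keys a \<subseteq> hbasis H}"

definition hprod :: "('b, 'k::field) hopf \<Rightarrow> ('b \<Rightarrow>\<^sub>0 'k) \<Rightarrow> ('b \<Rightarrow>\<^sub>0 'k) \<Rightarrow> ('b \<Rightarrow>\<^sub>0 'k)" where
  "hprod H = bilin_ext (hmult H)"

definition hDelta :: "('b, 'k::field) hopf \<Rightarrow> ('b \<Rightarrow>\<^sub>0 'k) \<Rightarrow> ('b \<times> 'b \<Rightarrow>\<^sub>0 'k)" where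
  "hDelta H = lin_ext (hcomult H)"

definition heps :: "('b, 'k::field) hopf \<Rightarrow> ('b \<Rightarrow>\<^sub>0 'k) \<Rightarrow> 'k" where
  "heps H = lin_form (hcounit H)"

text \<open>Multiplication of \<open>H \<otimes> H\<close>.\<close>

definition hprod2 ::
  "('b, 'k::field) hopf \<Rightarrow> ('b \<times> 'b \<Rightarrow>\<^sub>0 'k) \<Rightarrow> ('b \<times> 'b \<Rightarrow>\<^sub>0 'k) \<Rightarrow> ('b \<times> 'b \<Rightarrow>\<^sub>0 'k)" where
  "hprod2 H = bilin_ext (\<lambda>(x, y) (x', y'). tensor (hmult H x x') (hmult H y y'))"

definition is_algebra :: "('b, 'k::field) hopf \<Rightarrow> bool" where
  "is_algebra H \<longleftrightarrow>
     (\<forall>x\<in>hbasis H. \<forall>y\<in>hbasis H. hmult H x y \<in> hcarrier H) \<and>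
     hunit H \<in> hcarrier H \<and>
     (\<forall>a\<in>hcarrier H. \<forall>b\<in>hcarrier H. \<forall>c\<in>hcarrier H.
        hprod H (hprod H a b) c = hprod H a (hprod H b c)) \<and>
     (\<forall>a\<in>hcarrier H. hprod H (hunit H) a = a \<and> hprod H a (hunit H) = a)"

text \<open>
  The triple tensor power has basis consisting of triples \<open>(x, (y, z))\<close>; coassociativity is
  \<open>(\<Delta> \<otimes> id) \<circ> \<Delta> = (id \<otimes> \<Delta>) \<circ> \<Delta>\<close> with the left-hand side reassociated.
\<close>

definition is_coalgebra :: "('b, 'k::field) hopf \<Rightarrow> bool" where
  "is_coalgebra H \<longleftrightarrow>
     (\<forall>x\<in>hbasis H. Poly_Mapping.keys (hcomult H x) \<subseteq> hbasis H \<times> hbasis H) \<and>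
     (\<forall>a\<in>hcarrier H.
        lin_ext (\<lambda>((x, y), z). basis_vec (x, (y, z)))
          (lin_ext (\<lambda>(x, y). tensor (hcomult H x) (basis_vec y)) (hDelta H a))
        = lin_ext (\<lambda>(x, y). tensor (basis_vec x) (hcomult H y)) (hDelta H a)) \<and>
     (\<forall>a\<in>hcarrier H.
        lin_ext (\<lambda>(x, y). scale (hcounit H x) (basis_vec y)) (hDelta H a) = a \<and>
        lin_ext (\<lambda>(x, y). scale (hcounit H y) (basis_vec x)) (hDelta H a) = a)"

definition is_hopf_algebra :: "('b, 'k::field) hopf \<Rightarrow> bool" where
  "is_hopf_algebra H \<longleftrightarrow>
     is_algebra H \<and> is_coalgebra H \<and>
     (\<forall>a\<in>hcarrier H. \<forall>b\<in>hcarrier H.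
        hDelta H (hprod H a b) = hprod2 H (hDelta H a) (hDelta H b) \<and>
        heps H (hprod H a b) = heps H a * heps H b) \<and>
     hDelta H (hunit H) = tensor (hunit H) (hunit H) \<and> heps H (hunit H) = 1 \<and>
     (\<forall>x\<in>hbasis H. hantipode H x \<in> hcarrier H) \<and>
     (\<forall>a\<in>hcarrier H.
        lin_ext (\<lambda>(x, y). hprod H (hantipode H x) (basis_vec y)) (hDelta H a)
          = scale (heps H a) (hunit H) \<and>
        lin_ext (\<lambda>(x, y). hprod H (basis_vec x) (hantipode H y)) (hDelta H a)
          = scale (heps H a) (hunit H))"

definition group_like :: "('b, 'k::field) hopf \<Rightarrow> ('b \<Rightarrow>\<^sub>0 'k) \<Rightarrow> bool" where
  "group_like H a \<longleftrightarrow> a \<in> hcarrier H \<and> hDelta H a = tensor a a \<and> heps H a = 1"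

definition skew_primitive :: "('b, 'k::field) hopf \<Rightarrow> ('b \<Rightarrow>\<^sub>0 'k) \<Rightarrow> bool" where
  "skew_primitive H a \<longleftrightarrow> a \<in> hcarrier H \<and>
     (\<exists>g h. group_like H g \<and> group_like H h \<and> hDelta H a = tensor a h + tensor g a)"

subsection \<open>Words in quantum variables\<close>

text \<open>
  The abelian group \<open>G\<close> is written additively. The variables \<open>x\<^sub>i\<close> are represented by their indices
  \<open>i\<close>, which range over a finite linearly ordered type; \<open>\<gamma> i\<close> is the element \<open>g\<^sub>i\<close> and \<open>\<chi> i\<close> the
  character attached to \<open>x\<^sub>i\<close>.
\<close>

definition character :: "('g::ab_group_add \<Rightarrow> 'k::field) \<Rightarrow> bool" where
  "character \<psi> \<longleftrightarrow> (\<forall>g. \<psi> g \<noteq> 0) \<and> (\<forall>g h. \<psi> (g + h) = \<psi> g * \<psi> h)"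

definition word_grp :: "('x \<Rightarrow> 'g::ab_group_add) \<Rightarrow> 'x list \<Rightarrow> 'g" where
  "word_grp \<gamma> u = sum_list (map \<gamma> u)"

definition word_char :: "('x \<Rightarrow> 'g \<Rightarrow> 'k::field) \<Rightarrow> 'x list \<Rightarrow> 'g \<Rightarrow> 'k" where
  "word_char \<chi> u g = prod_list (map (\<lambda>i. \<chi> i g) u)"

definition pp ::
  "('x \<Rightarrow> 'g::ab_group_add \<Rightarrow> 'k::field) \<Rightarrow> ('x \<Rightarrow> 'g) \<Rightarrow> 'x list \<Rightarrow> 'x list \<Rightarrow> 'k" where
  "pp \<chi> \<gamma> u v = word_char \<chi> u (word_grp \<gamma> v)"

definition word_deg :: "('x \<Rightarrow> 'd::linordered_ab_group_add) \<Rightarrow> 'x list \<Rightarrow> 'd" where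
  "word_deg D u = sum_list (map D u)"

text \<open>
  \<open>x\<^sub>1 > x\<^sub>2 > \<dots>\<close> and a proper prefix of a word is greater than the word. This is the reverse of the
  lexicographic order on the lists of indices in which proper prefixes are smaller.
\<close>

definition word_less :: "'x::linorder list \<Rightarrow> 'x list \<Rightarrow> bool" where
  "word_less u v \<longleftrightarrow> ord_class.lexordp v u"

definition standard_word :: "'x::linorder list \<Rightarrow> bool" where
  "standard_word u \<longleftrightarrow> u \<noteq> [] \<and>
     (\<forall>v w. u = v @ w \<and> v \<noteq> [] \<and> w \<noteq> [] \<longrightarrow> word_less (w @ v) (v @ w))"

datatype 'x nword = NVar 'x | NBr "'x nword" "'x nword"

fun foliage :: "'x nword \<Rightarrow> 'x list" where
  "foliage (NVar x) = [x]"
| "foliage (NBr s t) = foliage s @ foliage t"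

definition standard_split :: "'x::linorder list \<Rightarrow> nat \<Rightarrow> bool" where
  "standard_split u k \<longleftrightarrow> 0 < k \<and> k < length u \<and>
     standard_word (take k u) \<and> standard_word (drop k u)"

text \<open>
  Only the values at standard words matter; a standard word of length at least 2 always has a
  standard splitting, so the last branch is then reached exactly for words of length 1.
\<close>

function std_nword :: "'x::linorder list \<Rightarrow> 'x nword" where
  "std_nword u =
     (if \<exists>k. standard_split u k
      then (let k = (LEAST k. standard_split u k)
            in NBr (std_nword (take k u)) (std_nword (drop k u)))
      else NVar (hd u))"
  by auto
termination
proof (relation "measure length")
  fix u :: "'x::linorder list" and k
  assume "\<exists>k. standard_split u k" and k: "k = (LEAST k. standard_split u k)"
  then have "standard_split u k"
    by (metis LeastI_ex)
  then show "(take k u, u) \<in> measure length" "(drop k u, u) \<in> measure length"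
    by (auto simp: standard_split_def)
qed simp

declare std_nword.simps [simp del]

definition standard_nwords :: "'x::linorder nword set" where
  "standard_nwords = std_nword ` {u. standard_word u}"

subsection \<open>The free associative algebra and skew commutators\<close>

text \<open>
  With concatenation as addition of words, the convolution product makes \<open>'x list \<Rightarrow>\<^sub>0 'k\<close> the free
  associative algebra on \<open>'x\<close>.
\<close>

instantiation list :: (type) monoid_add
begin

definition zero_list :: "'a list" where "zero_list = []"

definition plus_list :: "'a list \<Rightarrow> 'a list \<Rightarrow> 'a list" where "plus_list = (@)"

instance
  by standard (simp_all add: zero_list_def plus_list_def)

end

text \<open>
  The polynomial obtained from a nonassociative word by reading the brackets as skew commutators
  \<open>[a, b] = ab - p(u, v) ba\<close>, where \<open>u\<close>, \<open>v\<close> are words of the same degrees as \<open>a\<close>, \<open>b\<close>.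
\<close>

fun skew_value ::
  "('x \<Rightarrow> 'g::ab_group_add \<Rightarrow> 'k::field) \<Rightarrow> ('x \<Rightarrow> 'g) \<Rightarrow> 'x nword \<Rightarrow> ('x list \<Rightarrow>\<^sub>0 'k)" where
  "skew_value \<chi> \<gamma> (NVar i) = basis_vec [i]"
| "skew_value \<chi> \<gamma> (NBr s t) =
     skew_value \<chi> \<gamma> s * skew_value \<chi> \<gamma> t
     - scale (pp \<chi> \<gamma> (foliage s) (foliage t)) (skew_value \<chi> \<gamma> t * skew_value \<chi> \<gamma> s)"

definition super_letter ::
  "('x::linorder \<Rightarrow> 'g::ab_group_add \<Rightarrow> 'k::field) \<Rightarrow> ('x \<Rightarrow> 'g) \<Rightarrow> 'x list \<Rightarrow> ('x list \<Rightarrow>\<^sub>0 'k)" where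
  "super_letter \<chi> \<gamma> u = skew_value \<chi> \<gamma> (std_nword u)"

text \<open>The polynomial \<open>f\<^sup>*\<close>.\<close>

definition star ::
  "('x \<Rightarrow> 'g::ab_group_add \<Rightarrow> 'k::field) \<Rightarrow> ('x \<Rightarrow> 'g) \<Rightarrow> ('x nword \<Rightarrow>\<^sub>0 'k) \<Rightarrow> ('x list \<Rightarrow>\<^sub>0 'k)" where
  "star \<chi> \<gamma> = lin_ext (skew_value \<chi> \<gamma>)"

text \<open>
  Homogeneity for the grading of the free algebra by \<open>G \<times> G\<^sup>*\<close>. A quantum operation, as defined
  below, need not have it: if \<open>g\<^sub>1 = g\<^sub>2\<close> and \<open>\<chi> 1 \<noteq> \<chi> 2\<close>, then the values of \<open>x\<^sub>1 - x\<^sub>2\<close> are skew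
  primitive, but imposing \<open>x\<^sub>1 = x\<^sub>2\<close> forces \<open>x\<^sub>1 = x\<^sub>2 = 0\<close> in the enveloping algebra.
\<close>

definition gg_homogeneous ::
  "('x \<Rightarrow> 'g::ab_group_add \<Rightarrow> 'k::field) \<Rightarrow> ('x \<Rightarrow> 'g) \<Rightarrow> ('x list \<Rightarrow>\<^sub>0 'k) \<Rightarrow> bool" where
  "gg_homogeneous \<chi> \<gamma> F \<longleftrightarrow>
     (\<forall>u\<in>Poly_Mapping.keys F. \<forall>v\<in>Poly_Mapping.keys F.
        word_grp \<gamma> u = word_grp \<gamma> v \<and> word_char \<chi> u = word_char \<chi> v)"

subsection \<open>Quantum operations\<close>

definition hpoly_value ::
  "('b, 'k::field) hopf \<Rightarrow> ('x \<Rightarrow> ('b \<Rightarrow>\<^sub>0 'k)) \<Rightarrow> ('x list \<Rightarrow>\<^sub>0 'k) \<Rightarrow> ('b \<Rightarrow>\<^sub>0 'k)" where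
  "hpoly_value H a = lin_ext (\<lambda>w. foldr (\<lambda>i. hprod H (a i)) w (hunit H))"

text \<open>\<open>G\<close> is a group of group-like elements of \<open>H\<close>, via the embedding \<open>e\<close>.\<close>

definition group_in_hopf ::
  "('b, 'k::field) hopf \<Rightarrow> ('g::ab_group_add \<Rightarrow> ('b \<Rightarrow>\<^sub>0 'k)) \<Rightarrow> bool" where
  "group_in_hopf H e \<longleftrightarrow> inj e \<and> (\<forall>g. group_like H (e g)) \<and>
     e 0 = hunit H \<and> (\<forall>g h. e (g + h) = hprod H (e g) (e h))"

definition admissible_values ::
  "('x \<Rightarrow> 'g::ab_group_add \<Rightarrow> 'k::field) \<Rightarrow> ('x \<Rightarrow> 'g) \<Rightarrow>
   ('b, 'k) hopf \<Rightarrow> ('g \<Rightarrow> ('b \<Rightarrow>\<^sub>0 'k)) \<Rightarrow> ('x \<Rightarrow> ('b \<Rightarrow>\<^sub>0 'k)) \<Rightarrow> bool" where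
  "admissible_values \<chi> \<gamma> H e a \<longleftrightarrow>
     (\<forall>i. a i \<in> hcarrier H \<and>
          hDelta H (a i) = tensor (a i) (hunit H) + tensor (e (\<gamma> i)) (a i) \<and>
          (\<forall>g. hprod H (hprod H (e (- g)) (a i)) (e g) = scale (\<chi> i g) (a i)))"

text \<open>
  HOL cannot quantify over all types inside a definition, so \<open>H\<close> ranges over the Hopf algebras
  whose basis is a subset of the type \<open>'g \<times> 'x list\<close>. This is no restriction: admissible values
  \<open>a i\<close> in an arbitrary Hopf algebra lie in the Hopf subalgebra generated by \<open>G\<close> and the \<open>a i\<close>,
  which is spanned by the products of elements of \<open>G\<close> and words in the \<open>a i\<close>.
\<close>

definition quantum_operation ::
  "('x \<Rightarrow> 'g::ab_group_add \<Rightarrow> 'k::field) \<Rightarrow> ('x \<Rightarrow> 'g) \<Rightarrow> ('x list \<Rightarrow>\<^sub>0 'k) \<Rightarrow> bool" where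
  "quantum_operation \<chi> \<gamma> F \<longleftrightarrow>
     (\<forall>(H :: ('g \<times> 'x list, 'k) hopf) e a.
        is_hopf_algebra H \<and> group_in_hopf H e \<and> admissible_values \<chi> \<gamma> H e a
        \<longrightarrow> skew_primitive H (hpoly_value H a F))"

subsection \<open>The quantum enveloping algebra and hard super-letters\<close>

inductive_set ideal_gen :: "'r::ring_1 set \<Rightarrow> 'r set" for R where
  zero: "0 \<in> ideal_gen R"
| gen: "r \<in> R \<Longrightarrow> r \<in> ideal_gen R"
| add: "a \<in> ideal_gen R \<Longrightarrow> b \<in> ideal_gen R \<Longrightarrow> a + b \<in> ideal_gen R"
| mult_left: "a \<in> ideal_gen R \<Longrightarrow> c * a \<in> ideal_gen R"
| mult_right: "a \<in> ideal_gen R \<Longrightarrow> a * c \<in> ideal_gen R"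

text \<open>
  The algebra \<open>U\<^sub>P(\<gg>)\<close> is the free algebra on the letters \<open>Inl g\<close> (\<open>g \<in> G\<close>) and \<open>Inr i\<close>
  (for \<open>x\<^sub>i\<close>) modulo the ideal \<open>UP_ideal\<close>. The notion of a hard super-letter only involves the
  algebra structure, not the coproduct.
\<close>

abbreviation grp_gen :: "'g \<Rightarrow> (('g + 'x) list \<Rightarrow>\<^sub>0 'k::field)" where
  "grp_gen g \<equiv> basis_vec [Inl g]"

abbreviation var_gen :: "'x \<Rightarrow> (('g + 'x) list \<Rightarrow>\<^sub>0 'k::field)" where
  "var_gen i \<equiv> basis_vec [Inr i]"

definition poly_emb :: "('x list \<Rightarrow>\<^sub>0 'k) \<Rightarrow> (('g + 'x) list \<Rightarrow>\<^sub>0 'k::field)" where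
  "poly_emb = lin_ext (\<lambda>w. basis_vec (map Inr w))"

definition UP_ideal ::
  "('x \<Rightarrow> 'g::ab_group_add \<Rightarrow> 'k::field) \<Rightarrow> ('x \<Rightarrow> 'g) \<Rightarrow> ('x nword \<Rightarrow>\<^sub>0 'k)
   \<Rightarrow> (('g + 'x) list \<Rightarrow>\<^sub>0 'k) set" where
  "UP_ideal \<chi> \<gamma> f = ideal_gen (
     {grp_gen 0 - 1} \<union>
     {grp_gen g * grp_gen h - grp_gen (g + h) | g h. True} \<union>
     {grp_gen (- g) * var_gen i * grp_gen g - scale (\<chi> i g) (var_gen i) | g i. True} \<union>
     {poly_emb (star \<chi> \<gamma> f)})"

definition super_word ::
  "('x::linorder \<Rightarrow> 'g::ab_group_add \<Rightarrow> 'k::field) \<Rightarrow> ('x \<Rightarrow> 'g) \<Rightarrow> 'x list list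
   \<Rightarrow> (('g + 'x) list \<Rightarrow>\<^sub>0 'k)" where
  "super_word \<chi> \<gamma> us = prod_list (map (\<lambda>u. poly_emb (super_letter \<chi> \<gamma> u)) us)"

definition UP_hard ::
  "('x::linorder \<Rightarrow> 'g::ab_group_add \<Rightarrow> 'k::field) \<Rightarrow> ('x \<Rightarrow> 'g) \<Rightarrow>
   ('x \<Rightarrow> 'd::linordered_ab_group_add) \<Rightarrow> ('x nword \<Rightarrow>\<^sub>0 'k) \<Rightarrow> 'x list \<Rightarrow> bool" where
  "UP_hard \<chi> \<gamma> D f u \<longleftrightarrow>
     \<not> (\<exists>c \<in> lin_span (
            {super_word \<chi> \<gamma> us | us.
               (\<forall>v\<in>set us. standard_word v \<and> word_less v u) \<and>
               word_deg D (concat us) = word_deg D u} \<union>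
            {grp_gen g * super_word \<chi> \<gamma> us | g us.
               (\<forall>v\<in>set us. standard_word v) \<and>
               word_deg D (concat us) < word_deg D u}).
          poly_emb (super_letter \<chi> \<gamma> u) - c \<in> UP_ideal \<chi> \<gamma> f)"

subsection \<open>The one-relator Lie algebra and its Hall--Shirshov basis\<close>

text \<open>
  \<open>'x nword \<Rightarrow>\<^sub>0 'k\<close> with \<open>nbr\<close> is the free nonassociative algebra. The Lie algebra \<open>\<gg>\<close> is its quotient
  by the smallest ideal containing \<open>f\<close> and all instances of the Lie algebra identities.
\<close>

definition nbr ::
  "('x nword \<Rightarrow>\<^sub>0 'k) \<Rightarrow> ('x nword \<Rightarrow>\<^sub>0 'k) \<Rightarrow> ('x nword \<Rightarrow>\<^sub>0 'k::field)" where
  "nbr = bilin_ext (\<lambda>s t. basis_vec (NBr s t))"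

inductive_set lie_ideal :: "('x nword \<Rightarrow>\<^sub>0 'k::field) \<Rightarrow> ('x nword \<Rightarrow>\<^sub>0 'k) set" for f where
  relation: "f \<in> lie_ideal f"
| alternating: "nbr a a \<in> lie_ideal f"
| jacobi: "nbr (nbr a b) c + nbr (nbr b c) a + nbr (nbr c a) b \<in> lie_ideal f"
| add: "a \<in> lie_ideal f \<Longrightarrow> b \<in> lie_ideal f \<Longrightarrow> a + b \<in> lie_ideal f"
| scale: "a \<in> lie_ideal f \<Longrightarrow> scale r a \<in> lie_ideal f"
| bracket_left: "a \<in> lie_ideal f \<Longrightarrow> nbr c a \<in> lie_ideal f"
| bracket_right: "a \<in> lie_ideal f \<Longrightarrow> nbr a c \<in> lie_ideal f"

definition hall_shirshov_basis ::
  "('x::linorder \<Rightarrow> 'd::linordered_ab_group_add) \<Rightarrow> ('x nword \<Rightarrow>\<^sub>0 'k::field) \<Rightarrow> 'x nword set" where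
  "hall_shirshov_basis D f =
     {std_nword u | u. standard_word u \<and>
        \<not> (\<exists>c \<in> lin_span {basis_vec (std_nword v) | v. standard_word v \<and>
                 (word_deg D v < word_deg D u \<or> word_deg D v = word_deg D u \<and> word_less v u)}.
             basis_vec (std_nword u) - c \<in> lie_ideal f)}"

end

theory Submission
  imports Defs "HOL-Library.Multiset"
begin

text \<open>
  Both sets are described by the leading word \<open>w\<close> of \<open>f \<noteq> 0\<close> (of greatest degree, then greatest
  lexicographically): for a standard word \<open>u\<close>, either condition holds iff \<open>w\<close> is not a subword
  of \<open>u\<close>. A standard word has no border, hence \<open>f\<^sup>*\<close> alone is a Groebner basis of the ideal it
  generates in the free algebra; since \<open>[u]\<close> has leading word \<open>u\<close>, this shows that \<open>[u]\<close> is hard,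
  and with trivial characters that \<open>[u]\<close> is in the Hall--Shirshov basis, if \<open>w\<close> is not a subword.
  Conversely, a standard word properly containing \<open>w\<close> is a product \<open>u = a b\<close> of standard words
  \<open>a > b\<close> one of which contains \<open>w\<close>, and \<open>[[a], [b]]\<close> is \<open>[u]\<close> plus products of super-letters
  less than \<open>[u]\<close>; so induction with the skew Jacobi and Leibniz identities, starting from the
  relation itself, rewrites \<open>[u]\<close>. The group elements act diagonally because \<open>f\<^sup>*\<close> is homogeneous, so
  \<open>U\<^sub>P(\<gg>)\<close> adds nothing to the ideal of \<open>f\<^sup>*\<close>.

  Below, \<open>u \<prec> v\<close> is the opposite of the order on words used in the statement, so that standard
  words are the Lyndon words for \<open>\<prec>\<close>.
\<close>

subsection \<open>Standard words\<close>

text \<open>Two asymmetries shape the proof. To refute hardness it is not enough to reach lower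
  words: every single factor of a super-word must be less than [u], so the rewriting tracks the set
  of admissible factors, while irreducibility only compares concatenated words. Moreover, the skew
  Jacobi identity leaves two products whose coefficients p(b,c) and p(a,b) combine into a multiple
  of one skew bracket only if p(b,c) p(c,b) = 1, so products are kept; in the Lie algebra there are
  no products, the two terms are a bracket [[a,c],b] that is no shorter, and termination needs
  another measure. Hence the two rewriting results \<open>super_letter_bracket\<close> and
  \<open>std_vec_bracket\<close>. Replacing a term inside a skew bracket also requires that the
  coefficient p stay the same; f* need not be homogeneous in each variable, so degree, group element
  and character are carried along. Finally, in an arbitrary ordered group infinitely many words may
  lie below a given degree, and the induction on leading words rests on Dickson's lemma.\<close>

abbreviation lexless :: "'x::linorder list \<Rightarrow> 'x list \<Rightarrow> bool" (infix "\<prec>" 50) where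
  "u \<prec> v \<equiv> ord_class.lexordp u v"

abbreviation lexle :: "'x::linorder list \<Rightarrow> 'x list \<Rightarrow> bool" (infix "\<preceq>" 50) where
  "u \<preceq> v \<equiv> u \<prec> v \<or> u = v"

text \<open>The words differ at a common position. Unlike \<prec>, which also holds between a proper
  prefix and its extensions, this survives arbitrary extension of both words to the right; it is
  usually obtained from a bound on length or degree.\<close>

definition strictly_before :: "'x::linorder list \<Rightarrow> 'x list \<Rightarrow> bool" where
  "strictly_before u v \<longleftrightarrow> (\<exists>p a b u' v'. a < b \<and> u = p @ a # u' \<and> v = p @ b # v')"

lemma lexless_trans: "u \<prec> v \<Longrightarrow> v \<prec> w \<Longrightarrow> u \<prec> (w :: 'x::linorder list)"
  by (rule lexordp_trans)

lemma lexless_irrefl [simp]: "\<not> u \<prec> (u :: 'x::linorder list)"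
  by (rule lexordp_irreflexive')

lemma lexless_asym: "u \<prec> v \<Longrightarrow> \<not> v \<prec> (u :: 'x::linorder list)"
  using lexless_trans lexless_irrefl by blast

lemma lexless_linear: "u \<prec> v \<or> u = v \<or> v \<prec> (u :: 'x::linorder list)"
  by (rule lexordp_linear)

lemma lexless_append_same [simp]: "p @ u \<prec> p @ v \<longleftrightarrow> u \<prec> (v :: 'x::linorder list)"
  by (induction p) auto

lemma lexless_append: "v \<noteq> [] \<Longrightarrow> u \<prec> u @ (v :: 'x::linorder list)"
  by (rule lexordp_append_rightI)

lemma strictly_before_append: "strictly_before u v \<Longrightarrow> u @ x \<prec> v @ (y :: 'x::linorder list)"
  unfolding strictly_before_def by (metis append_Cons append_assoc lexordp_append_left_rightI)

lemma lexless_cases: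
  assumes "u \<prec> (v :: 'x::linorder list)"
  obtains (strict) "strictly_before u v" | (prefix) c where "c \<noteq> []" "v = u @ c"
  using assms unfolding lexordp_iff strictly_before_def by blast

lemma lexless_strict:
  assumes "u \<prec> (v :: 'x::linorder list)" and "\<And>c. c \<noteq> [] \<Longrightarrow> v \<noteq> u @ c"
  shows "strictly_before u v"
  using assms by (metis lexless_cases)

lemma lexless_strict_length:
  "u \<prec> v \<Longrightarrow> length v \<le> length u \<Longrightarrow> strictly_before u (v :: 'x::linorder list)"
  by (rule lexless_strict) auto

lemma standard_word_nonempty: "standard_word u \<Longrightarrow> u \<noteq> []"
  by (simp add: standard_word_def)

lemma standard_word_rotation:
  "standard_word u \<Longrightarrow> u = v @ w \<Longrightarrow> v \<noteq> [] \<Longrightarrow> w \<noteq> [] \<Longrightarrow> v @ w \<prec> w @ v"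
  by (auto simp: standard_word_def word_less_def)

text \<open>Suppose w \<prec> u. A difference at a letter would carry over to the rotation
  \<open>w @ v\<close>. Otherwise w is also a prefix, \<open>u = w @ t\<close>; cancelling w in the
  rotation inequality gives t \<prec> v, and since the lengths agree, \<open>t @ w\<close> \<prec>
  u, against the rotation inequality for \<open>w @ t\<close>.\<close>

lemma standard_word_suffix:
  assumes u: "standard_word u" "u = v @ w" "v \<noteq> []" "w \<noteq> []"
  shows "u \<prec> w"
proof (rule ccontr)
  assume "\<not> u \<prec> w"
  then have w: "w \<prec> u"
    using lexless_linear[of u w] u by auto
  show False
    using w
  proof (cases rule: lexless_cases)
    case strict
    then have "w @ v \<prec> u"
      using strictly_before_append[of w u v "[]"] by simp
    with standard_word_rotation[OF u] u show False
      using lexless_asym by blast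
  next
    case (prefix t)
    then have t: "length t = length v"
      using u by (metis add_diff_cancel_left' add_diff_cancel_right' length_append)
    have "t \<prec> v"
      using standard_word_rotation[OF u] prefix u by simp
    then have "strictly_before t v"
      using t by (simp add: lexless_strict_length)
    then have "t @ w \<prec> u"
      using u strictly_before_append by blast
    moreover have "u \<prec> t @ w"
      using standard_word_rotation[OF u(1) prefix(2)] u prefix by simp
    ultimately show False
      using lexless_asym by blast
  qed
qed

text \<open>The description of Lyndon words by proper suffixes. For the converse, a shorter suffix
  above u differs from it at a letter, so it stays above when the prefix is appended.\<close>

lemma standard_word_iff:
  "standard_word u \<longleftrightarrow> u \<noteq> [] \<and> (\<forall>v w. u = v @ w \<and> v \<noteq> [] \<and> w \<noteq> [] \<longrightarrow> u \<prec> w)"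
proof
  assume "standard_word u"
  then show "u \<noteq> [] \<and> (\<forall>v w. u = v @ w \<and> v \<noteq> [] \<and> w \<noteq> [] \<longrightarrow> u \<prec> w)"
    using standard_word_suffix standard_word_nonempty by blast
next
  assume *: "u \<noteq> [] \<and> (\<forall>v w. u = v @ w \<and> v \<noteq> [] \<and> w \<noteq> [] \<longrightarrow> u \<prec> w)"
  have "u \<prec> w @ v" if "u = v @ w" "v \<noteq> []" "w \<noteq> []" for v w
    using * that strictly_before_append[of u w "[]" v] lexless_strict_length[of u w] by auto
  with * show "standard_word u"
    by (auto simp: standard_word_def word_less_def)
qed

lemma standard_wordI:
  "u \<noteq> [] \<Longrightarrow> (\<And>v w. u = v @ w \<Longrightarrow> v \<noteq> [] \<Longrightarrow> w \<noteq> [] \<Longrightarrow> u \<prec> w) \<Longrightarrow> standard_word u"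
  by (auto simp: standard_word_iff)

lemma standard_word_singleton [simp]: "standard_word [x]"
  by (rule standard_wordI) (auto simp: Cons_eq_append_conv)

text \<open>Cut \<open>u @ v\<close> anywhere. A proper suffix of u differs from u at a letter and
  stays above after v is appended; at the boundary \<open>u @ v\<close> \<prec> v; further right the
  suffix lies above v.\<close>

lemma standard_word_append:
  assumes u: "standard_word u" and v: "standard_word v" and uv: "u \<prec> v"
  shows "standard_word (u @ v)"
proof (rule standard_wordI)
  have uvv: "u @ v \<prec> v"
    using uv
  proof (cases rule: lexless_cases)
    case strict
    then show ?thesis
      using strictly_before_append[of u v v "[]"] by simp
  next
    case (prefix c)
    then have "v \<prec> c"
      using v u by (intro standard_word_suffix[of v u c]) (auto dest: standard_word_nonempty)
    then have "u @ v \<prec> u @ c"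
      by simp
    then show ?thesis
      using prefix by simp
  qed
  fix a b
  assume ab: "u @ v = a @ b" "a \<noteq> []" "b \<noteq> []"
  obtain t where "u @ t = a \<and> v = t @ b \<or> u = a @ t \<and> t @ v = b"
    using ab(1) by (auto simp: append_eq_append_conv2)
  then consider "t \<noteq> []" "u = a @ t" "b = t @ v" | "a = u" "b = v"
      | "t \<noteq> []" "a = u @ t" "v = t @ b"
    by (cases "t = []") auto
  then show "u @ v \<prec> b"
  proof cases
    case 1
    then have "strictly_before u t"
      using standard_word_suffix[OF u] ab by (simp add: lexless_strict_length)
    then show ?thesis
      using 1 strictly_before_append by blast
  next
    case 2
    then show ?thesis
      using uvv by simp
  next
    case 3
    then show ?thesis
      using standard_word_suffix[OF v] uvv ab lexless_trans by blast
  qed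
qed (use u in \<open>auto dest: standard_word_nonempty\<close>)

lemma standard_word_append_less:
  assumes "standard_word u" "standard_word v" "u \<prec> v"
  shows "u @ v \<prec> v"
  using standard_word_suffix[OF standard_word_append[OF assms] refl]
    standard_word_nonempty assms by blast

lemma standard_word_less_parts:
  assumes "standard_word (u @ v)" "u \<noteq> []" "v \<noteq> []"
  shows "u \<prec> v"
  using assms lexless_append[of v u] lexless_trans standard_word_suffix[of "u @ v" u v] by blast

text \<open>A nonstandard word has a proper suffix that is not above it; passing to such suffixes
  ends in a standard one. It is compared below with the longest proper standard suffix.\<close>

lemma standard_word_minimal_suffix:
  assumes "v \<noteq> []"
  obtains a s where "v = a @ s" "standard_word s" "s \<preceq> v"
proof -
  have "\<exists>a s. v = a @ s \<and> s \<noteq> [] \<and> standard_word s \<and> s \<preceq> v" using assms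
  proof (induction "length v" arbitrary: v rule: less_induct)
    case less
    show ?case
    proof (cases "standard_word v")
      case True
      then show ?thesis
        using less.prems by (metis append_Nil)
    next
      case False
      then obtain a b where ab: "v = a @ b" "a \<noteq> []" "b \<noteq> []" "\<not> v \<prec> b"
        using less.prems by (auto simp: standard_word_iff)
      then have "b \<preceq> v"
        using lexless_linear by blast
      moreover obtain a' s where "b = a' @ s" "s \<noteq> []" "standard_word s" "s \<preceq> b"
        using less.hyps[of b] ab by auto
      ultimately show ?thesis
        using ab by (metis append_assoc lexless_trans)
    qed
  qed
  with that show ?thesis by blast
qed

section \<open>Standard factorization\<close>

lemma std_nword_single [simp]: "std_nword [x] = NVar x"
proof -
  have "\<not> standard_split [x] k" for k
    by (auto simp: standard_split_def)
  then show ?thesis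
    by (subst std_nword.simps) auto
qed

lemma standard_splitI:
  "standard_word u \<Longrightarrow> standard_word v \<Longrightarrow> standard_split (u @ v) (length u)"
  by (simp add: standard_split_def standard_word_def)

lemma std_nword_first_split:
  assumes uv: "standard_word u" "standard_word v"
    and first: "\<And>k. standard_split (u @ v) k \<Longrightarrow> length u \<le> k"
  shows "std_nword (u @ v) = NBr (std_nword u) (std_nword v)"
proof -
  have s: "standard_split (u @ v) (length u)"
    using uv by (rule standard_splitI)
  then have "(LEAST k. standard_split (u @ v) k) = length u"
    using first by (intro Least_equality) auto
  then show ?thesis
    using s by (subst std_nword.simps) auto
qed

text \<open>
  The last clause holds because the right factor of the standard splitting is the longest proper
  standard suffix.
\<close>

lemma standard_splitting:
  assumes u: "standard_word u" "2 \<le> length u"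
  obtains u1 u2 where "u = u1 @ u2" "standard_word u1" "standard_word u2" "u1 \<prec> u2"
    "std_nword u = NBr (std_nword u1) (std_nword u2)"
    "\<And>a s. u = a @ s \<Longrightarrow> a \<noteq> [] \<Longrightarrow> standard_word s \<Longrightarrow> u2 \<preceq> s"
proof -
  \<comment> \<open>Only the suffix is required to be standard. The prefix cut off at the least such
    position turns out to be standard too, so this is also the first \<open>standard_split\<close>,
    the one used by \<open>std_nword\<close>.\<close>
  define P where "P k \<longleftrightarrow> 0 < k \<and> k < length u \<and> standard_word (drop k u)" for k
  have "P (length u - 1)"
  proof -
    have "drop (length u - 1) u = [last u]"
      using u by (metis append_butlast_last_id append_eq_conv_conj length_butlast standard_word_nonempty)
    then show ?thesis
      using u by (simp add: P_def)
  qed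
  define k where "k = (LEAST k. P k)"
  have k: "P k" and least: "\<And>j. P j \<Longrightarrow> k \<le> j"
    unfolding k_def using \<open>P _\<close> by (auto intro: LeastI Least_le)
  define u1 u2 where "u1 = take k u" and "u2 = drop k u"
  have u12: "u = u1 @ u2" "u1 \<noteq> []" "u2 \<noteq> []" "standard_word u2" "length u1 = k"
    using k by (auto simp: u1_def u2_def P_def)
  have longest: "k \<le> length a" if "u = a @ s" "a \<noteq> []" "standard_word s" for a s
    using that by (intro least) (auto simp: P_def dest: standard_word_nonempty)
  have u1: "standard_word u1"
  proof (rule standard_wordI)
    fix a b
    assume ab: "u1 = a @ b" "a \<noteq> []" "b \<noteq> []"
    show "u1 \<prec> b"
    proof (rule ccontr)
      assume "\<not> u1 \<prec> b"
      then have "b \<preceq> u1"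
        using lexless_linear by blast
      obtain a' s where s: "b = a' @ s" "standard_word s" "s \<preceq> b"
        using ab standard_word_minimal_suffix by metis
      \<comment> \<open>Otherwise \<open>s @ u2\<close> would be a longer standard suffix than u2.
        The absurd chain is then u1 \<prec> u \<prec> u2 \<preceq> s \<preceq> b \<preceq>
        u1.\<close>
      have "\<not> s \<prec> u2"
      proof
        assume "s \<prec> u2"
        then have "standard_word (s @ u2)"
          using s u12 by (intro standard_word_append)
        then have "k \<le> length (a @ a')"
          using longest[of "a @ a'" "s @ u2"] u12 ab s by simp
        with u12 ab s show False
          by (auto simp: standard_word_def)
      qed
      then have "u2 \<preceq> s"
        using lexless_linear by blast
      moreover have "u \<prec> u2" "u1 \<prec> u"
        using standard_word_suffix[OF u(1)] lexless_append[of u2 u1] u12 by auto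
      ultimately show False
        using s \<open>b \<preceq> u1\<close> lexless_trans lexless_irrefl by metis
    qed
  qed (use u12 in simp)
  show ?thesis
  proof (rule that[OF u12(1) u1 u12(4)])
    show "u1 \<prec> u2"
      using standard_word_less_parts u u12 by blast
    have "length u1 \<le> j" if "standard_split (u1 @ u2) j" for j
      using that least[of j] u12 by (simp add: P_def standard_split_def)
    then show "std_nword u = NBr (std_nword u1) (std_nword u2)"
      using std_nword_first_split[OF u1 u12(4)] u12 by simp
    fix a s
    assume as: "u = a @ s" "a \<noteq> []" "standard_word s"
    then have "length u1 \<le> length a"
      using longest u12 by simp
    then obtain b where "u2 = b @ s"
      using as u12 by (auto simp: append_eq_append_conv2)
    then show "u2 \<preceq> s"
      using standard_word_suffix[OF u12(4), of b s] as by (cases "b = []") (auto dest: standard_word_nonempty)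
  qed
qed

text \<open>If the cut between u and v is not the first standard one, an earlier cut
  \<open>u = a @ b\<close> has \<open>b @ v\<close> standard, so b \<prec> v. A standard suffix s of
  b with s \<preceq> b then gives u2 \<preceq> s \<preceq> b \<prec> v. This second case is the one
  in which the bracket needs the Jacobi identity.\<close>

lemma std_nword_append_cases:
  assumes u: "standard_word u" and v: "standard_word v" and uv: "u \<prec> v"
  obtains (standard) "std_nword (u @ v) = NBr (std_nword u) (std_nword v)"
  | (split) u1 u2 where "u = u1 @ u2" "standard_word u1" "standard_word u2" "u1 \<prec> u2"
      "std_nword u = NBr (std_nword u1) (std_nword u2)" "u2 \<prec> v"
proof (cases "\<exists>k. standard_split (u @ v) k \<and> k < length u")
  case False
  then show ?thesis
    using std_nword_first_split[OF u v] standard by force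
next
  case True
  then obtain k where k: "standard_split (u @ v) k" "k < length u"
    by blast
  define a b where "a = take k u" and "b = drop k u"
  have ab: "u = a @ b" "a \<noteq> []" "b \<noteq> []" "standard_word (b @ v)"
    using k by (auto simp: a_def b_def standard_split_def)
  then have "b \<prec> v"
    using standard_word_less_parts v standard_word_nonempty by blast
  obtain a' s where s: "b = a' @ s" "standard_word s" "s \<preceq> b"
    using ab standard_word_minimal_suffix by metis
  have "2 \<le> length u"
    using ab by (cases a; cases b) auto
  then obtain u1 u2 where u12: "u = u1 @ u2" "standard_word u1" "standard_word u2" "u1 \<prec> u2"
      "std_nword u = NBr (std_nword u1) (std_nword u2)"
    and least: "\<And>a s. u = a @ s \<Longrightarrow> a \<noteq> [] \<Longrightarrow> standard_word s \<Longrightarrow> u2 \<preceq> s"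
    using standard_splitting[OF u] by metis
  have "u2 \<preceq> s"
    using least[of "a @ a'" s] ab s by simp
  then have "u2 \<prec> v"
    using s \<open>b \<prec> v\<close> lexless_trans by metis
  with u12 split show ?thesis
    by blast
qed

lemma foliage_std_nword [simp]: "standard_word u \<Longrightarrow> foliage (std_nword u) = u"
proof (induction "length u" arbitrary: u rule: less_induct)
  case less
  show ?case
  proof (cases "2 \<le> length u")
    case True
    then obtain u1 u2 where "u = u1 @ u2" "standard_word u1" "standard_word u2"
        "std_nword u = NBr (std_nword u1) (std_nword u2)"
      using standard_splitting[OF less.prems] by metis
    then show ?thesis
      using less.hyps[of u1] less.hyps[of u2] standard_word_nonempty[of u1]
        standard_word_nonempty[of u2] by simp
  next
    case False
    then obtain x where "u = [x]"
      using standard_word_nonempty[OF less.prems] by (cases u) (auto simp: not_le less_Suc_eq)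
    then show ?thesis
      by simp
  qed
qed

section \<open>Splitting a standard word around an occurrence of a subword\<close>

definition subword :: "'x list \<Rightarrow> 'x list \<Rightarrow> bool" where
  "subword w u \<longleftrightarrow> (\<exists>a b. u = a @ w @ b)"

lemma subword_append_left: "subword w u \<Longrightarrow> subword w (v @ u)"
  and subword_append_right: "subword w u \<Longrightarrow> subword w (u @ v)"
  unfolding subword_def by (metis append_assoc)+

lemma subword_refl [simp]: "subword w w"
  unfolding subword_def by (metis append_Nil append_Nil2)

text \<open>
  Merge adjacent increasing factors of \<open>us\<close> until only two factors are left. Such a pair always
  exists, since a nonincreasing product of at least two standard words is not standard.
\<close>

lemma standard_word_merge:
  assumes "standard_word (concat us)" "\<And>u. u \<in> set us \<Longrightarrow> standard_word u"
    and "2 \<le> length us" "v \<in> set us" "subword w v"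
  shows "\<exists>u' v'. concat us = u' @ v' \<and> standard_word u' \<and> standard_word v' \<and> u' \<prec> v' \<and>
           (subword w u' \<or> subword w v')"
  using assms
proof (induction "length us" arbitrary: us v rule: less_induct)
  case less
  note std = less.prems(2)
  show ?case
  proof (cases "length us = 2")
    case True
    then obtain u' v' where us: "us = [u', v']"
      by (auto simp: length_Suc_conv numeral_2_eq_2)
    then show ?thesis
      using less.prems std standard_word_nonempty standard_word_less_parts[of u' v'] by auto
  next
    case False
    \<comment> \<open>Otherwise the factors never increase, so y \<preceq> x for the first factor x
      and the last factor y. But x is a proper prefix and y a proper suffix of the standard product,
      whence x \<prec> \<open>concat us\<close> \<prec> y.\<close>
    obtain i where i: "Suc i < length us" "us ! i \<prec> us ! Suc i"
    proof (rule ccontr)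
      assume "\<not> thesis"
      then have "\<forall>i. Suc i < length us \<longrightarrow> us ! Suc i \<preceq> us ! i"
        using lexless_linear that by metis
      moreover have "transp (\<lambda>a b :: 'a list. b \<preceq> a)"
        using lexless_trans by (auto intro!: transpI)
      ultimately have "sorted_wrt (\<lambda>a b. b \<preceq> a) us"
        by (simp add: sorted_wrt_iff_nth_Suc_transp)
      moreover obtain x y vs where us: "us = x # vs @ [y]"
        using less.prems(3) by (metis One_nat_def Suc_1 append_butlast_last_id length_Cons
            list.exhaust list.size(3) nat.simps(3) not_less_eq_eq le_zero_eq numeral_2_eq_2)
      ultimately have "y \<preceq> x"
        by auto
      moreover have "concat us \<prec> y"
        using less.prems(1) us std by (intro standard_word_suffix[of _ "x @ concat vs"])
          (auto dest: standard_word_nonempty)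
      moreover have "x \<prec> concat us"
        using us std[of y] by (auto intro!: lexless_append dest: standard_word_nonempty)
      ultimately show False
        using lexless_trans lexless_irrefl by metis
    qed
    define us' where "us' = take i us @ (us ! i @ us ! Suc i) # drop (Suc (Suc i)) us"
    have us: "us = take i us @ us ! i # us ! Suc i # drop (Suc (Suc i)) us"
      using i by (metis Cons_nth_drop_Suc Suc_lessD append_take_drop_id)
    have c: "concat us' = concat us"
      unfolding us'_def by (subst (4) us) simp
    have set_us: "set us = set (take i us) \<union> {us ! i, us ! Suc i} \<union> set (drop (Suc (Suc i)) us)"
      by (subst us) auto
    obtain v' where v': "v' \<in> set us'" "subword w v'"
      using less.prems(4,5) set_us subword_append_left subword_append_right
      unfolding us'_def by fastforce
    have "standard_word (us ! i @ us ! Suc i)"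
      using i std by (intro standard_word_append) auto
    then have "standard_word u" if "u \<in> set us'" for u
      using that std set_us by (auto simp: us'_def)
    moreover have "length us' = length us - 1"
      using i by (simp add: us'_def)
    ultimately show ?thesis
      using less.hyps[of us' v'] c less.prems(1,3) v' False by simp
  qed
qed

text \<open>The occurrence of w enters the merging as one block among single letters, so no merge
  cuts it. The factors need not be those of the standard factorization; they serve the induction on
  length in both rewriting arguments.\<close>

lemma standard_word_subword_split:
  assumes u: "standard_word u" and w: "standard_word w" "subword w u" "w \<noteq> u"
  obtains u' v' where "u = u' @ v'" "standard_word u'" "standard_word v'" "u' \<prec> v'"
    "subword w u' \<or> subword w v'"
proof -
  obtain a b where ab: "u = a @ w @ b"
    using w by (auto simp: subword_def)
  define us where "us = map (\<lambda>x. [x]) a @ w # map (\<lambda>x. [x]) b"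
  have c: "concat us = u"
    using ab by (simp add: us_def)
  have "standard_word v" if "v \<in> set us" for v
    using that w by (auto simp: us_def)
  moreover have "2 \<le> length us"
    using ab w by (cases a; cases b) (auto simp: us_def)
  moreover have "w \<in> set us"
    by (simp add: us_def)
  ultimately show ?thesis
    using standard_word_merge[of us w w] that u unfolding c by auto
qed

text \<open>A proper border b lies above w as a suffix, but not above w as a prefix.\<close>

lemma standard_word_unbordered:
  assumes "standard_word w" "w = a @ b" "w = b @ c" "b \<noteq> []"
  shows "a = []"
proof (rule ccontr)
  assume "a \<noteq> []"
  then have "w \<prec> b"
    using assms standard_word_suffix by blast
  moreover have "b \<preceq> w"
    using assms(3) lexless_append[of c b] by (cases "c = []") simp_all
  ultimately show False
    using lexless_trans lexless_irrefl by metis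
qed

subsection \<open>Linear maps between spaces of finitely supported functions\<close>

interpretation V: vector_space "scale :: 'k::field \<Rightarrow> ('b \<Rightarrow>\<^sub>0 'k) \<Rightarrow> _"
  by (rule vector_space_scale)

abbreviation klinear :: "(('a \<Rightarrow>\<^sub>0 'k::field) \<Rightarrow> ('b \<Rightarrow>\<^sub>0 'k)) \<Rightarrow> bool" where
  "klinear \<equiv> Vector_Spaces.linear scale scale"

lemma klinearI:
  "(\<And>a b. h (a + b) = h a + h b) \<Longrightarrow> (\<And>c a. h (scale c a) = scale c (h a)) \<Longrightarrow> klinear h"
  by (simp add: Vector_Spaces.linear_iff vector_space_scale)

lemma klinear_add: "klinear h \<Longrightarrow> h (a + b) = h a + h b"
  and klinear_scale: "klinear h \<Longrightarrow> h (scale c a) = scale c (h a)"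
  by (simp_all add: Vector_Spaces.linear_iff)

lemma klinear_zero: "klinear h \<Longrightarrow> h 0 = 0"
  using klinear_scale[of h 0 0] by simp

lemma klinear_diff: "klinear h \<Longrightarrow> h (a - b) = h a - h b"
  using klinear_add[of h "a - b" b] by simp

lemma klinear_sum: "klinear h \<Longrightarrow> h (sum g S) = (\<Sum>x\<in>S. h (g x))"
  by (induction S rule: infinite_finite_induct) (auto simp: klinear_zero klinear_add)

lemma klinear_span:
  assumes "klinear h" "x \<in> lin_span G" "\<And>g. g \<in> G \<Longrightarrow> h g \<in> lin_span G'"
  shows "h x \<in> lin_span G'"
  using assms(2)
proof (induction rule: V.span_induct_alt)
  case base
  then show ?case by (simp add: klinear_zero[OF assms(1)] V.span_zero)
next
  case (step c x y)
  then show ?case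
    by (simp add: klinear_add[OF assms(1)] klinear_scale[OF assms(1)] V.span_add V.span_scale assms(3))
qed

lemma poly_eq_sum: "a = (\<Sum>b\<in>Poly_Mapping.keys a. scale (Poly_Mapping.lookup a b) (basis_vec b))"
proof (rule poly_mapping_eqI)
  fix k
  have "(\<Sum>b\<in>Poly_Mapping.keys a. Poly_Mapping.lookup a b * Poly_Mapping.lookup (basis_vec b) k)
      = (\<Sum>b\<in>Poly_Mapping.keys a. if b = k then Poly_Mapping.lookup a k else 0)"
    by (rule sum.cong) (auto simp: lookup_single when_def)
  also have "\<dots> = Poly_Mapping.lookup a k"
    by (auto simp: not_in_keys_iff_lookup_eq_zero)
  finally show "Poly_Mapping.lookup a k =
      Poly_Mapping.lookup (\<Sum>b\<in>Poly_Mapping.keys a. scale (Poly_Mapping.lookup a b) (basis_vec b)) k"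
    by (simp add: lookup_sum)
qed

lemma keys_scale: "Poly_Mapping.keys (scale c a) \<subseteq> Poly_Mapping.keys a"
  by (auto simp: in_keys_iff)

lemma span_basis_vec: "a \<in> lin_span (basis_vec ` K) \<longleftrightarrow> Poly_Mapping.keys a \<subseteq> K"
proof
  assume "a \<in> lin_span (basis_vec ` K)"
  then show "Poly_Mapping.keys a \<subseteq> K"
  proof (induction rule: V.span_induct_alt)
    case (step c x y)
    then show ?case
      using Poly_Mapping.keys_add[of "scale c x" y] keys_scale[of c x] by fastforce
  qed simp
next
  assume "Poly_Mapping.keys a \<subseteq> K"
  then show "a \<in> lin_span (basis_vec ` K)"
    by (subst poly_eq_sum, intro V.span_sum V.span_scale V.span_base) auto
qed

lemma klinear_eqI:
  assumes "klinear h" "klinear h'" "\<And>b. h (basis_vec b) = h' (basis_vec b)"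
  shows "h a = h' a"
  by (subst (1 2) poly_eq_sum)
    (simp add: klinear_sum[OF assms(1)] klinear_sum[OF assms(2)] klinear_scale[OF assms(1)]
      klinear_scale[OF assms(2)] assms(3))

lemma lin_ext_superset:
  "finite S \<Longrightarrow> Poly_Mapping.keys a \<subseteq> S \<Longrightarrow>
    lin_ext F a = (\<Sum>b\<in>S. scale (Poly_Mapping.lookup a b) (F b))"
  unfolding lin_ext_def by (rule sum.mono_neutral_left) (auto simp: not_in_keys_iff_lookup_eq_zero)

lemma klinear_lin_ext: "klinear (lin_ext (F :: 'a \<Rightarrow> ('b \<Rightarrow>\<^sub>0 'k::field)))"
proof (rule klinearI)
  fix a b :: "'a \<Rightarrow>\<^sub>0 'k"
  let ?S = "Poly_Mapping.keys a \<union> Poly_Mapping.keys b"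
  have "lin_ext F (a + b) = (\<Sum>x\<in>?S. scale (Poly_Mapping.lookup (a + b) x) (F x))"
    by (intro lin_ext_superset) (use Poly_Mapping.keys_add[of a b] in auto)
  also have "\<dots> = lin_ext F a + lin_ext F b"
    by (simp add: lin_ext_superset[of ?S] Poly_Mapping.lookup_add V.scale_left_distrib sum.distrib)
  finally show "lin_ext F (a + b) = lin_ext F a + lin_ext F b" .
next
  fix c and a :: "'a \<Rightarrow>\<^sub>0 'k"
  have "lin_ext F (scale c a) = (\<Sum>x\<in>Poly_Mapping.keys a. scale (Poly_Mapping.lookup (scale c a) x) (F x))"
    by (intro lin_ext_superset) (use keys_scale[of c a] in auto)
  then show "lin_ext F (scale c a) = scale c (lin_ext F a)"
    by (simp add: lin_ext_def V.scale_sum_right)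
qed

lemma lin_ext_basis_vec [simp]: "lin_ext F (basis_vec b) = F b"
  by (simp add: lin_ext_def)

lemma lin_ext_cong: "(\<And>b. b \<in> Poly_Mapping.keys a \<Longrightarrow> F b = G b) \<Longrightarrow> lin_ext F a = lin_ext G a"
  by (simp add: lin_ext_def)

lemma klinear_lin_ext_param:
  assumes "\<And>b. klinear (\<lambda>x. F x b)"
  shows "klinear (\<lambda>x. lin_ext (F x) a)"
  by (rule klinearI)
    (simp_all add: lin_ext_def klinear_add[OF assms] klinear_scale[OF assms] V.scale_right_distrib
      sum.distrib V.scale_sum_right mult.commute)

lemma klinear_id: "klinear (\<lambda>x. x)"
  by (rule klinearI) auto

lemma klinear_comp: "klinear h \<Longrightarrow> klinear h' \<Longrightarrow> klinear (\<lambda>x. h (h' x))"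
  by (rule klinearI) (simp_all add: klinear_add klinear_scale)

lemma klinear_compose_add: "klinear h \<Longrightarrow> klinear h' \<Longrightarrow> klinear (\<lambda>x. h x + h' x)"
  by (rule klinearI) (simp_all add: klinear_add klinear_scale V.scale_right_distrib)

lemma klinear_compose_diff: "klinear h \<Longrightarrow> klinear h' \<Longrightarrow> klinear (\<lambda>x. h x - h' x)"
  by (rule klinearI) (simp_all add: klinear_add klinear_scale V.scale_right_diff_distrib)

lemma klinear_compose_scale: "klinear h \<Longrightarrow> klinear (\<lambda>x. scale c (h x))"
  by (rule klinearI) (simp_all add: klinear_add klinear_scale V.scale_right_distrib V.scale_left_commute)

subsection \<open>The free algebra\<close>

lemma scale_conv_mult: "scale c P = Poly_Mapping.single [] c * (P :: 'x list \<Rightarrow>\<^sub>0 'k::field)"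
  unfolding scale_def mult_map_scale_conv_mult zero_list_def ..

lemma basis_vec_mult: "basis_vec u * basis_vec v = (basis_vec (u @ v) :: 'x list \<Rightarrow>\<^sub>0 'k::field)"
  by (simp add: mult_single plus_list_def)

lemma one_eq_basis_vec: "1 = (basis_vec [] :: 'x list \<Rightarrow>\<^sub>0 'k::field)"
  by (simp add: zero_list_def[symmetric])

lemma scale_mult_left: "scale c P * Q = scale c (P * Q :: 'x list \<Rightarrow>\<^sub>0 'k::field)"
  by (simp add: scale_conv_mult mult.assoc)

lemma single_Nil_commute:
  "Poly_Mapping.single [] c * P = P * Poly_Mapping.single [] (c :: 'k::field)"
proof -
  have "Poly_Mapping.single [] c * scale d (basis_vec b) =
      scale d (basis_vec b) * Poly_Mapping.single [] c" for d and b :: "'a list"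
    by (simp add: scale_conv_mult mult_single plus_list_def mult.commute)
  then show ?thesis
    by (subst (1 2) poly_eq_sum[of P]) (simp add: sum_distrib_left sum_distrib_right)
qed

lemma scale_mult_right: "P * scale c Q = scale c (P * Q :: 'x list \<Rightarrow>\<^sub>0 'k::field)"
proof -
  have "P * scale c Q = P * Poly_Mapping.single [] c * Q"
    by (simp only: scale_conv_mult mult.assoc)
  then show ?thesis
    by (simp only: scale_conv_mult single_Nil_commute[of c P, symmetric] mult.assoc)
qed

lemma klinear_mult_left: "klinear h \<Longrightarrow> klinear (\<lambda>P. h P * (Q :: 'x list \<Rightarrow>\<^sub>0 'k::field))"
  by (rule klinearI) (simp_all add: klinear_add klinear_scale scale_mult_left algebra_simps)

lemma klinear_mult_right: "klinear h \<Longrightarrow> klinear (\<lambda>P. (Q :: 'x list \<Rightarrow>\<^sub>0 'k::field) * h P)"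
  by (rule klinearI) (simp_all add: klinear_add klinear_scale scale_mult_right algebra_simps)

lemmas klinear_intros = klinear_id klinear_mult_left klinear_mult_right klinear_compose_add
  klinear_compose_diff klinear_compose_scale

lemma span_mult:
  fixes P :: "'x list \<Rightarrow>\<^sub>0 'k::field"
  assumes "P \<in> lin_span G" "Q \<in> lin_span G'" "\<And>a b. a \<in> G \<Longrightarrow> b \<in> G' \<Longrightarrow> a * b \<in> lin_span K"
  shows "P * Q \<in> lin_span K"
  by (rule klinear_span[OF klinear_mult_left[OF klinear_id] assms(1)],
      rule klinear_span[OF klinear_mult_right[OF klinear_id] assms(2)], rule assms(3))

lemma ideal_gen_scale: "P \<in> ideal_gen R \<Longrightarrow> scale c P \<in> ideal_gen (R :: ('x list \<Rightarrow>\<^sub>0 'k::field) set)"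
  unfolding scale_conv_mult by (rule ideal_gen.mult_left)

lemma ideal_gen_uminus: "P \<in> ideal_gen R \<Longrightarrow> - P \<in> ideal_gen R"
  using ideal_gen.mult_left[of P R "- 1"] by simp

lemma ideal_gen_diff: "P \<in> ideal_gen R \<Longrightarrow> Q \<in> ideal_gen R \<Longrightarrow> P - Q \<in> ideal_gen R"
  using ideal_gen.add[of P R "- Q"] ideal_gen_uminus by fastforce

lemma span_ideal_gen: "lin_span (ideal_gen R) = ideal_gen (R :: ('x list \<Rightarrow>\<^sub>0 'k::field) set)"
  by (subst V.span_eq_iff) (auto simp: V.subspace_def intro: ideal_gen.intros ideal_gen_scale)

lemma ideal_gen_zero: "P \<in> ideal_gen {0} \<Longrightarrow> P = 0"
  by (induction rule: ideal_gen.induct) auto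

subsection \<open>The degree-lexicographic order on words\<close>

lemma word_deg_append: "word_deg D (u @ v) = word_deg D u + word_deg D v"
  by (simp add: word_deg_def)

lemma word_deg_mset: "word_deg D u = sum_mset (image_mset D (mset u))"
  by (simp add: word_deg_def sum_mset_sum_list flip: mset_map)

text \<open>Since \<prec> is reversed, the lower of two words of equal degree is the \<prec>-larger
  one: a leading word is \<prec>-smallest in the top degree.\<close>

definition lower_word :: "('x::linorder \<Rightarrow> 'd::linordered_ab_group_add) \<Rightarrow> 'x list \<Rightarrow> 'x list \<Rightarrow> bool" where
  "lower_word D u v \<longleftrightarrow>
     word_deg D u < word_deg D v \<or> word_deg D u = word_deg D v \<and> v \<prec> u"

lemma lower_word_trans: "lower_word D u v \<Longrightarrow> lower_word D v w \<Longrightarrow> lower_word D u w"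
  unfolding lower_word_def using lexless_trans by (metis less_trans)

lemma lower_word_irrefl [simp]: "\<not> lower_word D u u"
  by (simp add: lower_word_def)

lemma lower_word_linear: "lower_word D u v \<or> u = v \<or> lower_word D v u"
  unfolding lower_word_def using lexless_linear by (metis linorder_cases)

section \<open>Well-foundedness of the degree-lexicographic order\<close>

lemma strict_mono_mono_subseq:
  fixes f :: "nat \<Rightarrow> nat"
  obtains \<phi> :: "nat \<Rightarrow> nat" where "strict_mono \<phi>" "mono (\<lambda>n. f (\<phi> n))"
proof -
  obtain g where g: "strict_mono g" "monoseq (\<lambda>n. f (g n))"
    using seq_monosub by blast
  show thesis
  proof (cases "\<forall>m n. m \<le> n \<longrightarrow> f (g m) \<le> f (g n)")
    case True
    then show ?thesis
      using that[of g] g(1) by (simp add: mono_def)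
  next
    case False
    then have dec: "f (g n) \<le> f (g m)" if "m \<le> n" for m n
      using g(2) that by (auto simp: monoseq_def)
    obtain N where N: "\<And>n. f (g N) \<le> f (g n)"
      using ex_has_least_nat[of "\<lambda>n. True" 0 "\<lambda>n. f (g n)"] by auto
    then have "f (g (N + n)) = f (g N)" for n
      using dec[of N "N + n"] by (simp add: antisym)
    then have "mono (\<lambda>n. f (g (N + n)))"
      by (auto simp: mono_def)
    moreover have "strict_mono (\<lambda>n. g (N + n))"
      using g(1) by (auto simp: strict_mono_def)
    ultimately show ?thesis
      using that by blast
  qed
qed

text \<open>Dickson's lemma: the sequence is thinned out one coordinate at a time, and a coordinate
  that is already monotone stays so along a subsequence.\<close>

lemma Dickson_subseq:
  fixes f :: "nat \<Rightarrow> 'x \<Rightarrow> nat"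
  assumes "finite X"
  shows "\<exists>\<phi> :: nat \<Rightarrow> nat. strict_mono \<phi> \<and> (\<forall>x\<in>X. mono (\<lambda>n. f (\<phi> n) x))"
  using assms
proof induction
  case empty
  then show ?case
    using strict_mono_id by blast
next
  case (insert x X)
  then obtain \<phi> :: "nat \<Rightarrow> nat" where \<phi>: "strict_mono \<phi>" "\<forall>x\<in>X. mono (\<lambda>n. f (\<phi> n) x)"
    by blast
  obtain \<psi> :: "nat \<Rightarrow> nat" where \<psi>: "strict_mono \<psi>" "mono (\<lambda>n. f (\<phi> (\<psi> n)) x)"
    using strict_mono_mono_subseq[of "\<lambda>n. f (\<phi> n) x"] by blast
  have "strict_mono (\<lambda>n. \<phi> (\<psi> n))"
    using \<phi>(1) \<psi>(1) by (simp add: strict_mono_def)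
  moreover have "mono (\<lambda>n. f (\<phi> (\<psi> n)) y)" if "y \<in> X" for y
    using \<phi>(2) that strict_mono_mono[OF \<psi>(1)] by (simp add: mono_def)
  ultimately show ?case
    using \<psi>(2) by (intro exI[of _ "\<lambda>n. \<phi> (\<psi> n)"]) auto
qed

lemma finite_mset_eq: "finite {u :: 'x::finite list. mset u = M}"
proof (rule finite_subset)
  show "{u :: 'x list. mset u = M} \<subseteq> {u. set u \<subseteq> UNIV \<and> length u = size M}"
    by (auto simp flip: size_mset)
qed (rule finite_lists_length_eq, simp)

locale degrees =
  fixes D :: "'x::{finite,linorder} \<Rightarrow> 'd::linordered_ab_group_add"
  assumes D_pos: "0 < D i"
begin

lemma word_deg_pos: "u \<noteq> [] \<Longrightarrow> 0 < word_deg D u"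
proof (induction u)
  case (Cons x u)
  then show ?case
    using D_pos[of x] by (cases "u = []") (auto simp: word_deg_def add_pos_pos)
qed simp

lemma word_deg_nonneg: "0 \<le> word_deg D u"
  using word_deg_pos[of u] by (cases "u = []") (auto simp: word_deg_def)

lemma mset_subset_word_deg:
  assumes "mset u \<subseteq># mset v" "word_deg D v \<le> word_deg D u"
  shows "mset u = mset v"
proof -
  obtain M where M: "mset v = mset u + M"
    using assms(1) by (metis mset_subset_eq_exists_conv)
  obtain m where m: "mset m = M"
    using ex_mset by blast
  have "word_deg D v = word_deg D u + word_deg D m"
    by (simp add: word_deg_mset M m)
  then have "m = []"
    using assms(2) word_deg_pos[of m] by (cases "m = []") auto
  then show ?thesis
    using M m by simp
qed

text \<open>A proper extension has strictly greater degree, so the prefix case cannot occur. This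
  makes \<open>lower_word\<close> compatible with right multiplication, which \<prec> alone is
  not.\<close>

lemma lexless_strict_deg:
  assumes "u \<prec> v" "word_deg D v \<le> word_deg D u"
  shows "strictly_before u v"
  using assms(1)
proof (rule lexless_strict)
  fix c :: "'x list"
  assume "c \<noteq> []"
  then show "v \<noteq> u @ c"
    using assms(2) word_deg_pos[of c] by (auto simp: word_deg_append)
qed

lemma lower_word_append:
  assumes "lower_word D u v"
  shows "lower_word D (a @ u @ b) (a @ v @ b)"
  using assms strictly_before_append[OF lexless_strict_deg, of v u b b]
  by (auto simp: lower_word_def word_deg_append)

text \<open>Dickson's lemma extracts from a descending sequence a subsequence with growing contents.
  The degrees do not grow, so by positivity all contents are equal; but only finitely many words
  share a content.\<close>

lemma wf_lower_word: "wf {(u, v). lower_word D u v}"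
proof (rule ccontr)
  assume "\<not> wf {(u, v). lower_word D u v}"
  then obtain f where f: "lower_word D (f (Suc i)) (f i)" for i
    by (auto simp: wf_iff_no_infinite_down_chain)
  have less: "lower_word D (f n) (f m)" if "m < n" for m n
    using that by (induction rule: less_Suc_induct) (auto intro: f lower_word_trans)
  obtain \<phi> :: "nat \<Rightarrow> nat" where \<phi>: "strict_mono \<phi>" "\<And>x. mono (\<lambda>n. count (mset (f (\<phi> n))) x)"
    using Dickson_subseq[of UNIV "\<lambda>n. count (mset (f n))"] by auto
  have "mset (f (\<phi> n)) = mset (f (\<phi> 0))" for n
  proof (cases "n = 0")
    case False
    then have "lower_word D (f (\<phi> n)) (f (\<phi> 0))"
      using less \<phi>(1) by (simp add: strict_mono_def)
    moreover have "mset (f (\<phi> 0)) \<subseteq># mset (f (\<phi> n))"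
      using \<phi>(2) by (auto intro!: mset_subset_eqI simp: mono_def)
    ultimately show ?thesis
      using mset_subset_word_deg[of "f (\<phi> 0)" "f (\<phi> n)"] by (auto simp: lower_word_def)
  qed simp
  then have "range (\<lambda>n. f (\<phi> n)) \<subseteq> {u. mset u = mset (f (\<phi> 0))}"
    by auto
  then have "finite (range (\<lambda>n. f (\<phi> n)))"
    using finite_mset_eq finite_subset by blast
  moreover have "inj (\<lambda>n. f (\<phi> n))"
  proof (rule linorder_injI)
    fix m n :: nat
    assume "m < n"
    then show "f (\<phi> m) \<noteq> f (\<phi> n)"
      using less \<phi>(1) lower_word_irrefl by (metis strict_monoD)
  qed
  ultimately show False
    using finite_imageD infinite_UNIV_nat by blast
qed

subsection \<open>Leading words of an ideal with one generator\<close>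

definition lower_polys :: "'x list \<Rightarrow> ('x list \<Rightarrow>\<^sub>0 'k::field) set" where
  "lower_polys u = lin_span (basis_vec ` {v. lower_word D v u})"

lemma lower_polys_iff:
  "P \<in> lower_polys u \<longleftrightarrow> (\<forall>v\<in>Poly_Mapping.keys P. lower_word D v u)"
  unfolding lower_polys_def span_basis_vec by auto

lemma lower_polys_add: "P \<in> lower_polys u \<Longrightarrow> Q \<in> lower_polys u \<Longrightarrow> P + Q \<in> lower_polys u"
  and lower_polys_diff: "P \<in> lower_polys u \<Longrightarrow> Q \<in> lower_polys u \<Longrightarrow> P - Q \<in> lower_polys u"
  and lower_polys_scale: "P \<in> lower_polys u \<Longrightarrow> scale c P \<in> lower_polys u"
  unfolding lower_polys_def by (fact V.span_add V.span_diff V.span_scale)+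

lemma span_lower_polys: "G \<subseteq> lower_polys u \<Longrightarrow> lin_span G \<subseteq> lower_polys u"
  unfolding lower_polys_def by (rule V.span_minimal) auto

definition leading_word :: "('x list \<Rightarrow>\<^sub>0 'k::field) \<Rightarrow> 'x list \<Rightarrow> bool" where
  "leading_word P u \<longleftrightarrow> Poly_Mapping.lookup P u \<noteq> 0 \<and>
     (\<forall>v\<in>Poly_Mapping.keys P. v \<noteq> u \<longrightarrow> lower_word D v u)"

lemma leading_word_unique:
  assumes "leading_word P u" "leading_word P v"
  shows "u = v"
proof (rule ccontr)
  assume "u \<noteq> v"
  then have "lower_word D u v" "lower_word D v u"
    using assms by (auto simp: leading_word_def in_keys_iff)
  then show False
    using lower_word_trans lower_word_irrefl by blast
qed

lemma leading_wordI:
  assumes "P - scale c (basis_vec u) \<in> lower_polys u" "c \<noteq> 0"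
  shows "leading_word P u"
proof -
  have l: "lower_word D v u" if "Poly_Mapping.lookup (P - scale c (basis_vec u)) v \<noteq> 0" for v
    using assms(1) that by (auto simp: lower_polys_iff in_keys_iff)
  have "Poly_Mapping.lookup P u = c"
    using l[of u] by (auto simp: lookup_minus)
  moreover have "lower_word D v u" if "v \<in> Poly_Mapping.keys P" "v \<noteq> u" for v
    using l[of v] that by (auto simp: lookup_minus lookup_single in_keys_iff)
  ultimately show ?thesis
    using assms(2) by (auto simp: leading_word_def)
qed

end

lemma ideal_gen_singleton:
  "ideal_gen {F} = lin_span {basis_vec a * F * basis_vec b | a b. True}" (is "_ = lin_span ?G") for F :: "'x list \<Rightarrow>\<^sub>0 'k::field"
proof
  have UN: "P \<in> lin_span (basis_vec ` UNIV)" for P :: "'x list \<Rightarrow>\<^sub>0 'k"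
    by (simp add: span_basis_vec)
  show "ideal_gen {F} \<subseteq> lin_span ?G"
  proof
    fix P
    assume "P \<in> ideal_gen {F}"
    then show "P \<in> lin_span ?G"
    proof induction
      case zero
      then show ?case by (rule V.span_zero)
    next
      case (gen r)
      then have "r = basis_vec [] * F * basis_vec []"
        by (simp flip: one_eq_basis_vec)
      then show ?case
        unfolding \<open>r = _\<close> by (intro V.span_base) blast
    next
      case (add a b)
      then show ?case by (intro V.span_add)
    next
      case (mult_left a c)
      show ?case
      proof (rule span_mult[OF UN mult_left.IH])
        fix x y :: "'x list \<Rightarrow>\<^sub>0 'k"
        assume "x \<in> basis_vec ` UNIV" "y \<in> ?G"
        then obtain u a b where "x = basis_vec u" "y = basis_vec a * F * basis_vec b"
          by auto
        then have "x * y = basis_vec (u @ a) * F * basis_vec b"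
          by (simp add: mult.assoc flip: basis_vec_mult)
        then show "x * y \<in> lin_span ?G"
          by (intro V.span_base) auto
      qed
    next
      case (mult_right a c)
      show ?case
      proof (rule span_mult[OF mult_right.IH UN])
        fix x y :: "'x list \<Rightarrow>\<^sub>0 'k"
        assume "y \<in> basis_vec ` UNIV" "x \<in> ?G"
        then obtain u a b where "y = basis_vec u" "x = basis_vec a * F * basis_vec b"
          by auto
        then have "x * y = basis_vec a * F * basis_vec (b @ u)"
          by (simp add: mult.assoc flip: basis_vec_mult)
        then show "x * y \<in> lin_span ?G"
          by (intro V.span_base) auto
      qed
    qed
  qed
next
  have "F \<in> ideal_gen {F}"
    by (simp add: ideal_gen.gen)
  then have "basis_vec a * F * basis_vec b \<in> ideal_gen {F}" for a b
    by (intro ideal_gen.mult_right ideal_gen.mult_left)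
  then have "?G \<subseteq> ideal_gen {F}"
    by blast
  then have "lin_span ?G \<subseteq> lin_span (ideal_gen {F})"
    by (rule V.span_mono)
  then show "lin_span ?G \<subseteq> ideal_gen {F}"
    by (simp only: span_ideal_gen)
qed

text \<open>
  An unbordered leading word has no overlap with itself, so there is only the trivial
  ambiguity of two disjoint occurrences, which resolves: \<open>F\<close> is a Groebner basis.
\<close>

locale unbordered_relation = degrees D
  for D :: "'x::{finite,linorder} \<Rightarrow> 'd::linordered_ab_group_add" +
  fixes F :: "'x list \<Rightarrow>\<^sub>0 'k::field" and w :: "'x list"
  assumes lead: "F - basis_vec w \<in> lower_polys w"
    and unbordered: "w = a @ b \<Longrightarrow> w = b @ c \<Longrightarrow> b \<noteq> [] \<Longrightarrow> a = []"
begin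

definition mono_mult :: "'x list \<Rightarrow> 'x list \<Rightarrow> ('x list \<Rightarrow>\<^sub>0 'k)" where
  "mono_mult a b = basis_vec a * F * basis_vec b"

definition mults_below :: "'x list \<Rightarrow> ('x list \<Rightarrow>\<^sub>0 'k) set" where
  "mults_below x = {mono_mult a b | a b. lower_word D (a @ w @ b) x}"

definition mults_upto :: "'x list \<Rightarrow> ('x list \<Rightarrow>\<^sub>0 'k) set" where
  "mults_upto x = {mono_mult a b | a b. a @ w @ b = x \<or> lower_word D (a @ w @ b) x}"

lemma mono_mult_lead: "mono_mult a b - basis_vec (a @ w @ b) \<in> lower_polys (a @ w @ b)"
proof -
  have "mono_mult a b - basis_vec (a @ w @ b) = basis_vec a * (F - basis_vec w) * basis_vec b"
    by (simp add: mono_mult_def algebra_simps basis_vec_mult)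
  also have "\<dots> \<in> lower_polys (a @ w @ b)"
    unfolding lower_polys_def
    by (rule klinear_span[OF _ lead[unfolded lower_polys_def]])
       (auto intro!: klinear_intros V.span_base imageI simp: basis_vec_mult lower_word_append)
  finally show ?thesis .
qed

text \<open>Both multiples are compared with the product a F c F b. Each differs from it by a term
  with \<open>F - basis_vec w\<close> at one of the two places, that is, with words lower than w
  there.\<close>

lemma mono_mult_swap_disjoint:
  "mono_mult a (c @ w @ b) - mono_mult (a @ w @ c) b \<in> lin_span (mults_below (a @ w @ c @ w @ b))"
proof -
  let ?A = "basis_vec a :: 'x list \<Rightarrow>\<^sub>0 'k" and ?B = "basis_vec b :: 'x list \<Rightarrow>\<^sub>0 'k"
    and ?C = "basis_vec c :: 'x list \<Rightarrow>\<^sub>0 'k" and ?W = "basis_vec w :: 'x list \<Rightarrow>\<^sub>0 'k"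
  let ?R = "F - ?W"
  have R: "?R \<in> lin_span (basis_vec ` {v. lower_word D v w})"
    using lead by (simp add: lower_polys_def)
  have m: "mono_mult a (c @ w @ b) - mono_mult (a @ w @ c) b
      = ?A * ?R * ?C * F * ?B - ?A * F * ?C * ?R * ?B"
    by (simp add: mono_mult_def algebra_simps flip: basis_vec_mult)
  have 1: "?A * ?R * ?C * F * ?B \<in> lin_span (mults_below (a @ w @ c @ w @ b))"
  proof (rule klinear_span[OF _ R])
    fix g :: "'x list \<Rightarrow>\<^sub>0 'k"
    assume "g \<in> basis_vec ` {v. lower_word D v w}"
    then obtain v where v: "g = basis_vec v" "lower_word D v w" by auto
    have "?A * g * ?C * F * ?B = mono_mult (a @ v @ c) b"
      by (simp add: mono_mult_def v mult.assoc flip: basis_vec_mult)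
    moreover have "lower_word D ((a @ v @ c) @ w @ b) (a @ w @ c @ w @ b)"
      using lower_word_append[OF v(2), of a "c @ w @ b"] by simp
    ultimately show "?A * g * ?C * F * ?B \<in> lin_span (mults_below (a @ w @ c @ w @ b))"
      unfolding mults_below_def by (intro V.span_base) blast
  qed (intro klinear_intros)
  have 2: "?A * F * ?C * ?R * ?B \<in> lin_span (mults_below (a @ w @ c @ w @ b))"
  proof (rule klinear_span[OF _ R])
    fix g :: "'x list \<Rightarrow>\<^sub>0 'k"
    assume "g \<in> basis_vec ` {v. lower_word D v w}"
    then obtain v where v: "g = basis_vec v" "lower_word D v w" by auto
    have "?A * F * ?C * g * ?B = mono_mult a (c @ v @ b)"
      by (simp add: mono_mult_def v mult.assoc flip: basis_vec_mult)
    moreover have "lower_word D (a @ w @ c @ v @ b) (a @ w @ c @ w @ b)"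
      using lower_word_append[OF v(2), of "a @ w @ c" b] by simp
    ultimately show "?A * F * ?C * g * ?B \<in> lin_span (mults_below (a @ w @ c @ w @ b))"
      unfolding mults_below_def by (intro V.span_base) blast
  qed (intro klinear_intros)
  show ?thesis
    unfolding m using 1 2 by (rule V.span_diff)
qed

text \<open>If the second occurrence of w began inside the first, their overlap would be a border of
  w. So it begins after the first has ended, and the disjoint case applies.\<close>

lemma mono_mult_swap_less:
  assumes "a @ w @ b = a' @ w @ b'" "length a < length a'"
  shows "mono_mult a b - mono_mult a' b' \<in> lin_span (mults_below (a @ w @ b))"
proof -
  obtain t where "a @ t = a' \<and> w @ b = t @ w @ b' \<or> a = a' @ t"
    using assms(1) unfolding append_eq_append_conv2 by blast
  then have t: "a' = a @ t" "w @ b = t @ w @ b'" "t \<noteq> []"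
    using assms(2) by auto
  have "\<not> length t < length w"
  proof
    assume "length t < length w"
    obtain s where "w = t @ s \<and> s @ b = w @ b' \<or> w @ s = t"
      using t(2) unfolding append_eq_append_conv2 by blast
    with \<open>length t < length w\<close> have s: "w = t @ s" "s @ b = w @ b'" "s \<noteq> []"
      by auto
    obtain r where "s = w @ r \<or> s @ r = w"
      using s(2) unfolding append_eq_append_conv2 by blast
    moreover have "length s \<le> length w"
      using s(1) by simp
    ultimately obtain r where "w = s @ r"
      by (cases "s = w @ r") auto
    then show False
      using unbordered[of t s r] s t by blast
  qed
  moreover obtain c where "w = t @ c \<and> c @ b = w @ b' \<or> w @ c = t \<and> b = c @ w @ b'"
    using t(2) unfolding append_eq_append_conv2 by blast
  ultimately have "t = w @ c" "b = c @ w @ b'"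
    by auto
  then show ?thesis
    using mono_mult_swap_disjoint[of a c b'] t by simp
qed

lemma mono_mult_swap:
  assumes "a @ w @ b = a' @ w @ b'"
  shows "mono_mult a b - mono_mult a' b' \<in> lin_span (mults_below (a @ w @ b))"
proof (cases "length a" "length a'" rule: linorder_cases)
  case less
  then show ?thesis
    using mono_mult_swap_less assms by blast
next
  case equal
  then show ?thesis
    using assms by (simp add: V.span_zero)
next
  case greater
  then show ?thesis
    using mono_mult_swap_less[OF assms[symmetric]] assms
      V.span_neg[of "mono_mult a' b' - mono_mult a b"] by simp
qed

text \<open>Supplies the smaller bound for the well-founded induction: finitely many multiples below
  x have a greatest leading word y. The zero polynomial is excluded because the empty combination
  offers no such y.\<close>

lemma mults_below_upto:
  assumes "P \<in> lin_span (mults_below x)" "P \<noteq> 0"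
  obtains y where "lower_word D y x" "P \<in> lin_span (mults_upto y)"
proof -
  have "P = 0 \<or> (\<exists>y. lower_word D y x \<and> P \<in> lin_span (mults_upto y))"
    using assms(1)
  proof (induction rule: V.span_induct_alt)
    case (step c g P)
    obtain a b where g: "g = mono_mult a b" "lower_word D (a @ w @ b) x"
      using step(1) by (auto simp: mults_below_def)
    have gy: "scale c g \<in> lin_span (mults_upto y)" if "a @ w @ b = y \<or> lower_word D (a @ w @ b) y" for y
      using that g by (intro V.span_scale V.span_base) (auto simp: mults_upto_def)
    show ?case
    proof (cases "P = 0")
      case True
      then show ?thesis
        using gy g by auto
    next
      case False
      then obtain y where y: "lower_word D y x" "P \<in> lin_span (mults_upto y)"
        using step by blast
      define z where "z = (if lower_word D y (a @ w @ b) then a @ w @ b else y)"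
      have "mults_upto y \<subseteq> mults_upto z"
        unfolding mults_upto_def z_def using lower_word_trans by fastforce
      then have "P \<in> lin_span (mults_upto z)"
        using y V.span_mono by blast
      moreover have "scale c g \<in> lin_span (mults_upto z)"
        using lower_word_linear[of D y "a @ w @ b"] by (intro gy) (auto simp: z_def)
      moreover have "lower_word D z x"
        using y g by (simp add: z_def)
      ultimately show ?thesis
        using V.span_add by blast
    qed
  qed simp
  with assms(2) that show ?thesis by blast
qed

text \<open>Multiples with leading word exactly x agree modulo multiples below x, so P is c times
  one of them plus multiples below x. If c is nonzero, P has leading word x, which contains w; if c
  = 0, the bound drops and induction applies.\<close>

lemma leading_word_mults_upto:
  "P \<in> lin_span (mults_upto x) \<Longrightarrow> leading_word P u \<Longrightarrow> subword w u"
proof (induction x arbitrary: P rule: wf_induct_rule[OF wf_lower_word])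
  case (1 x)
  have below: "subword w u" if "P \<in> lin_span (mults_below x)"
  proof -
    have "P \<noteq> 0"
      using 1 by (auto simp: leading_word_def)
    then show ?thesis
      using mults_below_upto[OF that] 1 by (metis case_prodI mem_Collect_eq)
  qed
  show ?case
  proof (cases "\<exists>a b. a @ w @ b = x")
    case False
    then have "mults_upto x = mults_below x"
      by (auto simp: mults_upto_def mults_below_def)
    then show ?thesis
      using 1 below by simp
  next
    case True
    then obtain a b where ab: "a @ w @ b = x" by blast
    have "mults_upto x \<subseteq> lin_span (insert (mono_mult a b) (mults_below x))"
    proof
      fix g
      assume "g \<in> mults_upto x"
      then consider a' b' where "g = mono_mult a' b'" "a' @ w @ b' = x" | "g \<in> mults_below x"
        by (auto simp: mults_upto_def mults_below_def)
      then show "g \<in> lin_span (insert (mono_mult a b) (mults_below x))"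
      proof cases
        case 1
        have "g - mono_mult a b \<in> lin_span (insert (mono_mult a b) (mults_below x))"
          using mono_mult_swap[of a' b' a b] ab 1
            V.span_mono[OF subset_insertI, of "mults_below x" "mono_mult a b"] by auto
        moreover have "mono_mult a b \<in> lin_span (insert (mono_mult a b) (mults_below x))"
          by (simp add: V.span_base)
        ultimately show ?thesis
          using V.span_add by fastforce
      qed (simp add: V.span_base)
    qed
    then have "P \<in> lin_span (insert (mono_mult a b) (mults_below x))"
      using 1(2) V.span_mono V.span_span by blast
    then obtain c where c: "P - scale c (mono_mult a b) \<in> lin_span (mults_below x)"
      by (auto simp: V.span_insert)
    show ?thesis
    proof (cases "c = 0")
      case True
      then show ?thesis
        using c below by simp
    next
      case False
      have "mults_below x \<subseteq> lower_polys x"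
      proof
        fix g
        assume "g \<in> mults_below x"
        then obtain a b where g: "g = mono_mult a b" "lower_word D (a @ w @ b) x"
          by (auto simp: mults_below_def)
        have "g - basis_vec (a @ w @ b) \<in> lower_polys x"
          using mono_mult_lead[of a b] g lower_word_trans unfolding lower_polys_iff by blast
        moreover have "basis_vec (a @ w @ b) \<in> lower_polys x"
          using g by (simp add: lower_polys_iff)
        ultimately show "g \<in> lower_polys x"
          using lower_polys_add by fastforce
      qed
      then have "P - scale c (mono_mult a b) \<in> lower_polys x"
        using c span_lower_polys by blast
      moreover have "scale c (mono_mult a b - basis_vec x) \<in> lower_polys x"
        using mono_mult_lead[of a b] ab by (simp add: lower_polys_scale)
      ultimately have "(P - scale c (mono_mult a b)) + scale c (mono_mult a b - basis_vec x) \<in> lower_polys x"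
        by (rule lower_polys_add)
      then have "P - scale c (basis_vec x) \<in> lower_polys x"
        by (simp add: V.scale_right_diff_distrib)
      then have "leading_word P x"
        using False by (rule leading_wordI)
      then have "u = x"
        using 1(3) leading_word_unique by blast
      then show ?thesis
        using ab by (auto simp: subword_def)
    qed
  qed
qed

lemma leading_word_ideal:
  assumes "P \<in> ideal_gen {F}" "leading_word P u"
  shows "subword w u"
proof -
  have "\<exists>x. P \<in> lin_span (mults_upto x)"
    using assms(1) unfolding ideal_gen_singleton
  proof (induction rule: V.span_induct_alt)
    case base
    then show ?case by (auto intro: V.span_zero)
  next
    case (step c g P)
    then obtain a b x where g: "g = mono_mult a b" "P \<in> lin_span (mults_upto x)"
      by (auto simp: mono_mult_def)
    define z where "z = (if lower_word D x (a @ w @ b) then a @ w @ b else x)"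
    have "mults_upto x \<subseteq> mults_upto z"
      unfolding mults_upto_def z_def using lower_word_trans by fastforce
    then have "P \<in> lin_span (mults_upto z)"
      using g V.span_mono by blast
    moreover have "scale c g \<in> lin_span (mults_upto z)"
      using lower_word_linear[of D x "a @ w @ b"] g
      by (intro V.span_scale V.span_base) (auto simp: z_def mults_upto_def)
    ultimately show ?case
      using V.span_add by blast
  qed
  then show ?thesis
    using leading_word_mults_upto assms(2) by blast
qed

end

subsection \<open>Leading words of super-letters\<close>

definition words_ge :: "'x::linorder list \<Rightarrow> 'x list set" where
  "words_ge u = {v. mset v = mset u \<and> u \<preceq> v}"

definition words_gt :: "'x::linorder list \<Rightarrow> 'x list set" where
  "words_gt u = {v. mset v = mset u \<and> u \<prec> v}"

text \<open>The other words are rearrangements of u, a condition free of D that yields the leading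
  word for any degrees. It passes to products because distinct words of equal length differ at a
  letter.\<close>

definition monic_at :: "('x::linorder list \<Rightarrow>\<^sub>0 'k::field) \<Rightarrow> 'x list \<Rightarrow> bool" where
  "monic_at P u \<longleftrightarrow> P - basis_vec u \<in> lin_span (basis_vec ` words_gt u)"

lemma words_gt_append_ge: "a \<in> words_gt u \<Longrightarrow> b \<in> words_ge v \<Longrightarrow> a @ b \<in> words_gt (u @ v)"
  using strictly_before_append[OF lexless_strict_length, of u a v b]
  by (auto simp: words_gt_def words_ge_def dest: mset_eq_length)

lemma words_append_gt: "b \<in> words_gt v \<Longrightarrow> u @ b \<in> words_gt (u @ v)"
  by (auto simp: words_gt_def)

lemma words_ge_gt: "words_ge u = insert u (words_gt u)"
  by (auto simp: words_ge_def words_gt_def)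

lemma monic_at_ge:
  assumes "monic_at P u"
  shows "P \<in> lin_span (basis_vec ` words_ge u)"
proof -
  have "P - basis_vec u \<in> lin_span (basis_vec ` words_ge u)"
    using assms V.span_mono[of "basis_vec ` words_gt u" "basis_vec ` words_ge u"]
    by (auto simp: monic_at_def words_ge_gt)
  moreover have "basis_vec u \<in> lin_span (basis_vec ` words_ge u)"
    by (intro V.span_base) (simp add: words_ge_gt)
  ultimately show ?thesis
    using V.span_add by fastforce
qed

lemma monic_at_mult:
  assumes P: "monic_at P u" and Q: "monic_at Q v"
  shows "monic_at (P * Q) (u @ v)"
proof -
  have "(P - basis_vec u) * Q \<in> lin_span (basis_vec ` words_gt (u @ v))"
    using P monic_at_ge[OF Q] unfolding monic_at_def
    by (rule span_mult) (auto simp: basis_vec_mult intro!: V.span_base imageI words_gt_append_ge)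
  moreover have "basis_vec u * (Q - basis_vec v) \<in> lin_span (basis_vec ` words_gt (u @ v))"
    using Q unfolding monic_at_def
    by (rule klinear_span[rotated])
      (auto intro!: klinear_intros V.span_base imageI words_append_gt simp: basis_vec_mult)
  ultimately have "(P - basis_vec u) * Q + basis_vec u * (Q - basis_vec v)
      \<in> lin_span (basis_vec ` words_gt (u @ v))"
    by (rule V.span_add)
  then show ?thesis
    by (simp add: monic_at_def algebra_simps basis_vec_mult)
qed

lemma monic_at_diff:
  assumes P: "monic_at P u" and Q: "monic_at Q v" and uv: "v \<in> words_gt u"
  shows "monic_at (P - scale c Q) u"
proof -
  have "words_ge v \<subseteq> words_gt u"
    using uv lexless_trans by (auto simp: words_ge_def words_gt_def)
  then have "basis_vec ` words_ge v \<subseteq> basis_vec ` words_gt u"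
    by (rule image_mono)
  then have "Q \<in> lin_span (basis_vec ` words_gt u)"
    using monic_at_ge[OF Q] V.span_mono by blast
  then have "(P - basis_vec u) - scale c Q \<in> lin_span (basis_vec ` words_gt u)"
    by (rule V.span_diff[OF P[unfolded monic_at_def] V.span_scale])
  then show ?thesis
    by (simp add: monic_at_def algebra_simps)
qed

text \<open>The second product in the skew commutator is monic at \<open>u2 @ u1\<close>, a rotation
  of the standard word u and therefore above it for \<prec>; so the coefficient p does not affect
  the leading term.\<close>

lemma monic_at_super_letter:
  "standard_word u \<Longrightarrow> monic_at (super_letter \<chi> \<gamma> u) u"
proof (induction "length u" arbitrary: u rule: less_induct)
  case less
  show ?case
  proof (cases "2 \<le> length u")
    case True
    then obtain u1 u2 where u: "u = u1 @ u2" "standard_word u1" "standard_word u2"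
        "std_nword u = NBr (std_nword u1) (std_nword u2)"
      using standard_splitting[OF less.prems] by metis
    have ne: "u1 \<noteq> []" "u2 \<noteq> []"
      using u standard_word_nonempty by auto
    have m: "monic_at (super_letter \<chi> \<gamma> u1) u1" "monic_at (super_letter \<chi> \<gamma> u2) u2"
      using less.hyps u ne by auto
    have "u2 @ u1 \<in> words_gt (u1 @ u2)"
      using standard_word_rotation[OF less.prems u(1) ne] by (simp add: words_gt_def)
    then have "monic_at (super_letter \<chi> \<gamma> u1 * super_letter \<chi> \<gamma> u2
        - scale (pp \<chi> \<gamma> u1 u2) (super_letter \<chi> \<gamma> u2 * super_letter \<chi> \<gamma> u1)) (u1 @ u2)"
      using m by (intro monic_at_diff[of _ "u1 @ u2" _ "u2 @ u1"] monic_at_mult)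
    then show ?thesis
      using u by (simp add: super_letter_def)
  next
    case False
    then obtain x where "u = [x]"
      using standard_word_nonempty[OF less.prems] by (cases u) (auto simp: not_le less_Suc_eq)
    then show ?thesis
      by (simp add: super_letter_def monic_at_def V.span_zero)
  qed
qed

definition super_product ::
  "('x::linorder \<Rightarrow> 'g::ab_group_add \<Rightarrow> 'k::field) \<Rightarrow> ('x \<Rightarrow> 'g) \<Rightarrow> 'x list list \<Rightarrow> ('x list \<Rightarrow>\<^sub>0 'k)" where
  "super_product \<chi> \<gamma> us = prod_list (map (super_letter \<chi> \<gamma>) us)"

lemma super_product_simps [simp]:
  "super_product \<chi> \<gamma> [] = 1"
  "super_product \<chi> \<gamma> (u # us) = super_letter \<chi> \<gamma> u * super_product \<chi> \<gamma> us"
  "super_product \<chi> \<gamma> (us @ vs) = super_product \<chi> \<gamma> us * super_product \<chi> \<gamma> vs"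
  by (simp_all add: super_product_def)

lemma monic_at_super_product:
  "\<forall>u\<in>set us. standard_word u \<Longrightarrow> monic_at (super_product \<chi> \<gamma> us) (concat us)"
proof (induction us)
  case Nil
  then show ?case
    by (simp add: monic_at_def one_eq_basis_vec V.span_zero)
next
  case (Cons u us)
  then show ?case
    by (auto intro!: monic_at_mult monic_at_super_letter)
qed

subsection \<open>The leading word of the relation\<close>

lemma super_letters_of_relation:
  assumes "Poly_Mapping.keys f \<subseteq> standard_nwords"
  shows "star \<chi> \<gamma> f = (\<Sum>u | standard_word u \<and> std_nword u \<in> Poly_Mapping.keys f.
           scale (Poly_Mapping.lookup f (std_nword u)) (super_letter \<chi> \<gamma> u))"
    and "finite {u. standard_word u \<and> std_nword u \<in> Poly_Mapping.keys f}"
proof -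
  let ?S = "{u. standard_word u \<and> std_nword u \<in> Poly_Mapping.keys f}"
  have inj: "inj_on std_nword ?S"
    by (rule inj_onI) (metis foliage_std_nword mem_Collect_eq)
  have img: "std_nword ` ?S = Poly_Mapping.keys f"
    using assms by (auto simp: standard_nwords_def)
  show "finite ?S"
    using finite_imageD[OF _ inj] img by simp
  have "star \<chi> \<gamma> f = (\<Sum>s\<in>std_nword ` ?S. scale (Poly_Mapping.lookup f s) (skew_value \<chi> \<gamma> s))"
    by (simp add: star_def lin_ext_def img)
  also have "\<dots> = (\<Sum>u\<in>?S. scale (Poly_Mapping.lookup f (std_nword u)) (super_letter \<chi> \<gamma> u))"
    by (subst sum.reindex[OF inj]) (simp add: super_letter_def)
  finally show "star \<chi> \<gamma> f = \<dots>" .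
qed

context degrees
begin

lemma words_gt_lower_word: "v \<in> words_gt u \<Longrightarrow> lower_word D v u"
  by (simp add: words_gt_def lower_word_def word_deg_mset)

lemma words_ge_lower_word: "v \<in> words_ge u \<Longrightarrow> lower_word D u x \<Longrightarrow> lower_word D v x"
  using words_gt_lower_word lower_word_trans unfolding words_ge_gt by blast

lemma monic_at_lower_polys: "monic_at P u \<Longrightarrow> P - basis_vec u \<in> lower_polys u"
  unfolding monic_at_def
  by (rule subsetD[OF span_lower_polys]) (auto simp: lower_polys_iff words_gt_lower_word)

lemma monic_at_lower: "monic_at P u \<Longrightarrow> lower_word D u x \<Longrightarrow> P \<in> lower_polys x"
  by (drule monic_at_ge, rule subsetD[OF span_lower_polys])
    (auto simp: lower_polys_iff words_ge_lower_word)

text \<open>Read off from the nonassociative words of f, without reference to characters, so that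
  one word w serves both for skew commutators and for ordinary ones.\<close>

definition leading_standard_word :: "('x nword \<Rightarrow>\<^sub>0 'k::field) \<Rightarrow> 'x list \<Rightarrow> bool" where
  "leading_standard_word f w \<longleftrightarrow> standard_word w \<and> std_nword w \<in> Poly_Mapping.keys f \<and>
     (\<forall>v. standard_word v \<and> std_nword v \<in> Poly_Mapping.keys f \<longrightarrow> v = w \<or> lower_word D v w)"

text \<open>For f = 0 there is no leading word and nothing is reducible; both sets of the theorem
  then come from all standard words.\<close>

definition reducible :: "('x nword \<Rightarrow>\<^sub>0 'k::field) \<Rightarrow> 'x list \<Rightarrow> bool" where
  "reducible f u \<longleftrightarrow> (\<exists>w. leading_standard_word f w \<and> subword w u)"

lemma maximal_word_exists:
  assumes "finite S" "S \<noteq> {}"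
  shows "\<exists>w\<in>S. \<forall>v\<in>S. v = w \<or> lower_word D v w"
  using assms
proof (induction rule: finite_ne_induct)
  case (insert x S)
  then obtain w where w: "w \<in> S" "\<forall>v\<in>S. v = w \<or> lower_word D v w"
    by blast
  show ?case
  proof (cases "lower_word D w x")
    case True
    have "lower_word D v x" if "v \<in> S" for v
      using that w(2) True lower_word_trans[of D v w x] by auto
    then show ?thesis by blast
  next
    case False
    then have "\<forall>v\<in>insert x S. v = w \<or> lower_word D v w"
      using w lower_word_linear[of D x w] by blast
    then show ?thesis
      using w by blast
  qed
qed simp

lemma leading_standard_word_exists:
  assumes "Poly_Mapping.keys f \<subseteq> standard_nwords" "f \<noteq> 0"
  obtains w where "leading_standard_word f w"
proof -
  have "{u. standard_word u \<and> std_nword u \<in> Poly_Mapping.keys f} \<noteq> {}"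
  proof -
    have "Poly_Mapping.keys f \<noteq> {}"
      using assms(2) by simp
    then show ?thesis
      using assms(1) unfolding standard_nwords_def by blast
  qed
  then show ?thesis
    using maximal_word_exists[OF super_letters_of_relation(2)[OF assms(1)]] that
    by (auto simp: leading_standard_word_def)
qed

text \<open>Every other super-letter in f* has a leading word below w, so w occurs only in its own
  super-letter, with coefficient 1.\<close>

lemma star_leading:
  fixes f :: "'x nword \<Rightarrow>\<^sub>0 'k::field" and \<chi> :: "'x \<Rightarrow> 'g::ab_group_add \<Rightarrow> 'k"
  assumes f: "Poly_Mapping.keys f \<subseteq> standard_nwords" and w: "leading_standard_word f w"
  defines "c \<equiv> Poly_Mapping.lookup f (std_nword w)"
  shows "star \<chi> \<gamma> f - scale c (basis_vec w) \<in> lower_polys w" "c \<noteq> 0"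
proof -
  let ?S = "{u. standard_word u \<and> std_nword u \<in> Poly_Mapping.keys f}"
  let ?t = "\<lambda>u. scale (Poly_Mapping.lookup f (std_nword u)) (super_letter \<chi> \<gamma> u)"
  have wS: "w \<in> ?S"
    using w by (simp add: leading_standard_word_def)
  show "c \<noteq> 0"
    using wS by (simp add: c_def in_keys_iff)
  have "star \<chi> \<gamma> f - scale c (basis_vec w)
      = scale c (super_letter \<chi> \<gamma> w - basis_vec w) + sum ?t (?S - {w})"
    unfolding super_letters_of_relation(1)[OF f] sum.remove[OF super_letters_of_relation(2)[OF f] wS]
    by (simp add: c_def V.scale_right_diff_distrib)
  also have "\<dots> \<in> lower_polys w"
  proof (intro lower_polys_add lower_polys_scale monic_at_lower_polys monic_at_super_letter)
    show "standard_word w"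
      using wS by simp
    show "sum ?t (?S - {w}) \<in> lower_polys w"
      using w unfolding lower_polys_def leading_standard_word_def
      by (intro V.span_sum V.span_scale)
        (auto simp flip: lower_polys_def intro!: monic_at_lower monic_at_super_letter)
  qed
  finally show "star \<chi> \<gamma> f - scale c (basis_vec w) \<in> lower_polys w" .
qed

lemma leading_word_star_ideal:
  fixes f :: "'x nword \<Rightarrow>\<^sub>0 'k::field" and \<chi> :: "'x \<Rightarrow> 'g::ab_group_add \<Rightarrow> 'k"
  assumes f: "Poly_Mapping.keys f \<subseteq> standard_nwords"
    and P: "P \<in> ideal_gen {star \<chi> \<gamma> f}" "leading_word P u"
  shows "reducible f u"
proof (cases "f = 0")
  case True
  then have "star \<chi> \<gamma> f = 0"
    by (simp add: star_def lin_ext_def)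
  then have "P = 0"
    using P ideal_gen_zero by simp
  then show ?thesis
    using P by (simp add: leading_word_def)
next
  case False
  then obtain w where w: "leading_standard_word f w"
    using leading_standard_word_exists f by blast
  define c where "c = Poly_Mapping.lookup f (std_nword w)"
  define F where "F = scale (inverse c) (star \<chi> \<gamma> f)"
  have c: "star \<chi> \<gamma> f - scale c (basis_vec w) \<in> lower_polys w" "c \<noteq> 0"
    using star_leading[OF f w] by (auto simp: c_def)
  have "scale (inverse c) (star \<chi> \<gamma> f - scale c (basis_vec w)) \<in> lower_polys w"
    using c lower_polys_scale by blast
  then have F: "F - basis_vec w \<in> lower_polys w"
    using c by (simp add: F_def V.scale_right_diff_distrib)
  have "standard_word w"
    using w by (simp add: leading_standard_word_def)
  then interpret unbordered_relation D F w
    using F standard_word_unbordered by unfold_locales blast+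
  have "star \<chi> \<gamma> f = scale c F"
    using c by (simp add: F_def)
  then have star: "star \<chi> \<gamma> f \<in> ideal_gen {F}"
    by (auto intro: ideal_gen_scale ideal_gen.gen)
  have "P \<in> ideal_gen {F}"
    using P(1) by induction (use star in \<open>auto intro: ideal_gen.intros\<close>)
  then show ?thesis
    using leading_word_ideal P(2) w by (auto simp: reducible_def)
qed

end

subsection \<open>From the enveloping algebra to the free algebra\<close>

text \<open>
  The enveloping algebra acts from the right on the free algebra modulo \<open>f\<^sup>*\<close>: the quotient of
  \<open>U\<^sub>P(\<gg>)\<close> by the right ideal generated by the elements \<open>g - 1\<close>. A variable acts by right
  multiplication and \<open>g\<close> acts on a word \<open>u\<close> by the scalar \<open>\<chi>\<^sup>u(g)\<close>.
\<close>

definition char_action :: "('x \<Rightarrow> 'g \<Rightarrow> 'k::field) \<Rightarrow> 'g \<Rightarrow> ('x list \<Rightarrow>\<^sub>0 'k) \<Rightarrow> ('x list \<Rightarrow>\<^sub>0 'k)" where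
  "char_action \<chi> g = lin_ext (\<lambda>u. scale (word_char \<chi> u g) (basis_vec u))"

definition letter_action ::
  "('x \<Rightarrow> 'g \<Rightarrow> 'k::field) \<Rightarrow> ('x list \<Rightarrow>\<^sub>0 'k) \<Rightarrow> 'g + 'x \<Rightarrow> ('x list \<Rightarrow>\<^sub>0 'k)" where
  "letter_action \<chi> P l = (case l of Inl g \<Rightarrow> char_action \<chi> g P | Inr i \<Rightarrow> P * basis_vec [i])"

definition right_action ::
  "('x \<Rightarrow> 'g \<Rightarrow> 'k::field) \<Rightarrow> ('x list \<Rightarrow>\<^sub>0 'k) \<Rightarrow> (('g + 'x) list \<Rightarrow>\<^sub>0 'k) \<Rightarrow> ('x list \<Rightarrow>\<^sub>0 'k)" where
  "right_action \<chi> P = lin_ext (foldl (letter_action \<chi>) P)"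

lemma word_char_append: "word_char \<chi> (u @ v) g = word_char \<chi> u g * word_char \<chi> v g"
  by (simp add: word_char_def)

lemma klinear_char_action: "klinear (char_action \<chi> g)"
  unfolding char_action_def by (rule klinear_lin_ext)

lemma klinear_right_action: "klinear (right_action \<chi> P)"
  unfolding right_action_def by (rule klinear_lin_ext)

lemma char_action_basis_vec [simp]:
  "char_action \<chi> g (basis_vec u) = scale (word_char \<chi> u g) (basis_vec u)"
  by (simp add: char_action_def)

lemma right_action_basis_vec [simp]:
  "right_action \<chi> P (basis_vec w) = foldl (letter_action \<chi>) P w"
  by (simp add: right_action_def)

lemma char_action_mult: "char_action \<chi> g (P * Q) = char_action \<chi> g P * char_action \<chi> g Q"
proof -
  note lin = klinear_intros klinear_comp[OF klinear_char_action] klinear_char_action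
  have "char_action \<chi> g (basis_vec u * Q) = char_action \<chi> g (basis_vec u) * char_action \<chi> g Q" for u
    by (rule klinear_eqI[of "\<lambda>Q. char_action \<chi> g (basis_vec u * Q)" _ Q])
      (auto intro!: lin simp: basis_vec_mult word_char_append scale_mult_left scale_mult_right)
  then show ?thesis
    by (intro klinear_eqI[of "\<lambda>P. char_action \<chi> g (P * Q)" _ P]) (auto intro!: lin)
qed

lemma klinear_foldl_action: "klinear (\<lambda>P. foldl (letter_action \<chi>) P w)"
proof (induction w rule: rev_induct)
  case Nil
  then show ?case by (simp add: klinear_id)
next
  case (snoc l w)
  then show ?case
    by (cases l) (auto simp: letter_action_def intro: klinear_comp[OF klinear_char_action] klinear_mult_left)
qed

lemma klinear_right_action_left: "klinear (\<lambda>P. right_action \<chi> P Q)"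
  unfolding right_action_def by (rule klinear_lin_ext_param) (rule klinear_foldl_action)

lemma right_action_mult: "right_action \<chi> P (Q * R) = right_action \<chi> (right_action \<chi> P Q) R"
proof -
  have "right_action \<chi> P (basis_vec u * R) = right_action \<chi> (right_action \<chi> P (basis_vec u)) R" for u
    by (rule klinear_eqI[of "\<lambda>R. right_action \<chi> P (basis_vec u * R)" _ R])
      (auto intro!: klinear_right_action klinear_comp[OF klinear_right_action] klinear_intros
        simp: basis_vec_mult)
  then show ?thesis
    by (intro klinear_eqI[of "\<lambda>Q. right_action \<chi> P (Q * R)" _ Q])
      (auto intro!: klinear_right_action klinear_comp[OF klinear_right_action]
        klinear_comp[OF klinear_right_action_left] klinear_intros)
qed

lemma klinear_poly_emb: "klinear poly_emb"
  unfolding poly_emb_def by (rule klinear_lin_ext)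

lemma poly_emb_basis_vec [simp]: "poly_emb (basis_vec w) = basis_vec (map Inr w)"
  by (simp add: poly_emb_def)

lemma poly_emb_mult: "poly_emb (P * Q) = poly_emb P * poly_emb Q"
proof -
  note lin = klinear_intros klinear_comp[OF klinear_poly_emb] klinear_poly_emb
  have "poly_emb (basis_vec u * Q) = poly_emb (basis_vec u) * poly_emb Q" for u
    by (rule klinear_eqI[of "\<lambda>Q. poly_emb (basis_vec u * Q)" _ Q]) (auto intro!: lin simp: basis_vec_mult)
  then show ?thesis
    by (intro klinear_eqI[of "\<lambda>P. poly_emb (P * Q)" _ P]) (auto intro!: lin)
qed

lemma super_word_eq: "super_word \<chi> \<gamma> us = poly_emb (super_product \<chi> \<gamma> us)"
  by (induction us) (simp_all add: super_word_def poly_emb_mult one_eq_basis_vec)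

lemma right_action_poly_emb: "right_action \<chi> P (poly_emb Q) = P * Q"
proof -
  have "foldl (letter_action \<chi>) P (map Inr u) = P * basis_vec u" for u
    by (induction u rule: rev_induct)
      (simp_all add: letter_action_def mult.assoc basis_vec_mult flip: one_eq_basis_vec)
  then show ?thesis
    by (intro klinear_eqI[of "\<lambda>Q. right_action \<chi> P (poly_emb Q)" _ Q])
      (auto intro!: klinear_intros klinear_comp[OF klinear_right_action] klinear_poly_emb)
qed

lemma character_zero: "character \<psi> \<Longrightarrow> \<psi> 0 = 1"
  unfolding character_def by (metis add_0 mult_cancel_right1)

lemma word_char_hom:
  assumes "\<And>i. character (\<chi> i)"
  shows "word_char \<chi> u 0 = 1" "word_char \<chi> u (g + h) = word_char \<chi> u g * word_char \<chi> u h"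
proof -
  show "word_char \<chi> u 0 = 1"
    by (induction u) (simp_all add: word_char_def character_zero[OF assms])
  have "\<chi> i (g + h) = \<chi> i g * \<chi> i h" for i
    using assms by (simp add: character_def)
  then show "word_char \<chi> u (g + h) = word_char \<chi> u g * word_char \<chi> u h"
    by (induction u) (simp_all add: word_char_def)
qed

lemma char_action_zero:
  assumes "\<And>i. character (\<chi> i)"
  shows "char_action \<chi> 0 P = P"
  by (rule klinear_eqI) (auto intro: klinear_char_action klinear_id simp: word_char_hom(1)[OF assms])

lemma char_action_add:
  assumes "\<And>i. character (\<chi> i)"
  shows "char_action \<chi> h (char_action \<chi> g P) = char_action \<chi> (g + h) P"
  by (rule klinear_eqI) (auto intro: klinear_char_action klinear_comp
    simp: word_char_hom(2)[OF assms] klinear_scale[OF klinear_char_action])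

lemma char_action_homogeneous:
  assumes "gg_homogeneous \<chi> \<gamma> F"
  obtains c where "char_action \<chi> g F = scale c F"
proof -
  obtain c where c: "\<And>u. u \<in> Poly_Mapping.keys F \<Longrightarrow> word_char \<chi> u g = c"
    using assms unfolding gg_homogeneous_def by metis
  have "char_action \<chi> g F = lin_ext (\<lambda>u. scale c (basis_vec u)) F"
    unfolding char_action_def by (rule lin_ext_cong) (simp add: c)
  also have "\<dots> = scale c F"
    by (rule klinear_eqI) (auto intro: klinear_lin_ext klinear_compose_scale klinear_id)
  finally show ?thesis
    by (rule that)
qed

text \<open>Variables multiply on the right, and g acts by an algebra endomorphism that scales F,
  since all words of F have the same character. So the action descends to the quotient by the ideal
  of F.\<close>

lemma right_action_ideal:
  assumes hom: "gg_homogeneous \<chi> \<gamma> F" and P: "P \<in> ideal_gen {F}"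
  shows "right_action \<chi> P Q \<in> ideal_gen {F}"
proof -
  have char: "char_action \<chi> g P \<in> ideal_gen {F}" if "P \<in> ideal_gen {F}" for g P
    using that
  proof induction
    case (gen r)
    obtain c where "char_action \<chi> g F = scale c F"
      using char_action_homogeneous[OF hom] by blast
    then show ?case
      using gen by (auto intro: ideal_gen_scale ideal_gen.gen)
  qed (auto simp: klinear_zero[OF klinear_char_action] klinear_add[OF klinear_char_action]
      char_action_mult intro: ideal_gen.intros)
  have "foldl (letter_action \<chi>) P w \<in> ideal_gen {F}" for w
    using P by (induction w arbitrary: P)
      (auto simp: letter_action_def char ideal_gen.mult_right split: sum.splits)
  then have "right_action \<chi> P Q \<in> lin_span (ideal_gen {F})"
    by (intro klinear_span[OF klinear_right_action, of Q "basis_vec ` UNIV"])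
      (auto simp: span_basis_vec intro: V.span_base)
  then show ?thesis
    by (simp only: span_ideal_gen)
qed

lemma right_action_UP_ideal:
  assumes char: "\<And>i. character (\<chi> i)" and hom: "gg_homogeneous \<chi> \<gamma> (star \<chi> \<gamma> f)"
    and Q: "Q \<in> UP_ideal \<chi> \<gamma> f"
  shows "right_action \<chi> P Q \<in> ideal_gen {star \<chi> \<gamma> f}"
  using Q unfolding UP_ideal_def
\<comment> \<open>P varies because a left factor c turns the claim for P into the claim for
  \<open>right_action \<chi> P c\<close>.\<close>
proof (induction arbitrary: P)
  case zero
  then show ?case by (simp add: klinear_zero[OF klinear_right_action] ideal_gen.zero)
next
  case (gen r)
  then consider "r = grp_gen 0 - 1"
    | g h where "r = grp_gen g * grp_gen h - grp_gen (g + h)"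
    | g i where "r = grp_gen (- g) * var_gen i * grp_gen g - scale (\<chi> i g) (var_gen i)"
    | "r = poly_emb (star \<chi> \<gamma> f)"
    by auto
  then show ?case
  proof cases
    case 1
    then have "right_action \<chi> P r = 0"
      by (simp add: klinear_diff[OF klinear_right_action] one_eq_basis_vec letter_action_def
          char_action_zero[OF char])
    then show ?thesis by (simp add: ideal_gen.zero)
  next
    case 2
    then have "right_action \<chi> P r = 0"
      by (simp add: klinear_diff[OF klinear_right_action] basis_vec_mult letter_action_def
          char_action_add[OF char])
    then show ?thesis by (simp add: ideal_gen.zero)
  next
    \<comment> \<open>The scalars by which -g and g act on P cancel, and g multiplies the new letter
      by \<open>\<chi> i g\<close>.\<close>
    case 3
    then have "right_action \<chi> P r = 0"
      by (simp add: klinear_diff[OF klinear_right_action] klinear_scale[OF klinear_right_action]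
          basis_vec_mult letter_action_def char_action_mult char_action_add[OF char]
          char_action_zero[OF char] scale_mult_right word_char_def)
    then show ?thesis by (simp add: ideal_gen.zero)
  next
    case 4
    then show ?thesis
      by (auto simp: right_action_poly_emb intro: ideal_gen.mult_left ideal_gen.gen)
  qed
next
  case (add a b)
  then show ?case by (simp add: klinear_add[OF klinear_right_action] ideal_gen.add)
next
  case (mult_left a c)
  then show ?case by (simp add: right_action_mult)
next
  case (mult_right a c)
  then show ?case by (simp add: right_action_mult right_action_ideal[OF hom])
qed

context degrees
begin

text \<open>The first factor has degree at most that of u; being above u, it differs from u at a
  letter, and this decides the comparison for the whole product. The empty product is excluded by
  its degree 0.\<close>

lemma concat_lower_word:
  assumes "\<forall>v\<in>set us. standard_word v \<and> u \<prec> v" "u \<noteq> []"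
    and "word_deg D (concat us) = word_deg D u"
  shows "lower_word D (concat us) u"
proof (cases us)
  case Nil
  then show ?thesis
    using assms word_deg_pos[of u] by (simp add: word_deg_def)
next
  case (Cons v vs)
  have "word_deg D v \<le> word_deg D u"
    using assms(3) Cons word_deg_nonneg[of "concat vs"] by (simp flip: assms(3) add: word_deg_append)
  then have "strictly_before u v"
    using assms Cons by (intro lexless_strict_deg) auto
  then have "u \<prec> concat us"
    using strictly_before_append[of u v "[]"] Cons by simp
  then show ?thesis
    using assms by (simp add: lower_word_def)
qed

text \<open>Acting on 1, group elements disappear and super-words become products of super-letters
  with leading words below u. A relation refuting hardness would thus yield an element of the ideal
  of f* with leading word u.\<close>

lemma UP_hard_if_irreducible:
  fixes f :: "'x nword \<Rightarrow>\<^sub>0 'k::field" and \<chi> :: "'x \<Rightarrow> 'g::ab_group_add \<Rightarrow> 'k"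
  assumes char: "\<And>i. character (\<chi> i)" and hom: "gg_homogeneous \<chi> \<gamma> (star \<chi> \<gamma> f)"
    and f: "Poly_Mapping.keys f \<subseteq> standard_nwords"
    and u: "standard_word u" "\<not> reducible f u"
  shows "UP_hard \<chi> \<gamma> D f u"
  unfolding UP_hard_def
proof
  let ?S = "{super_word \<chi> \<gamma> us | us. (\<forall>v\<in>set us. standard_word v \<and> word_less v u) \<and>
               word_deg D (concat us) = word_deg D u} \<union>
            {grp_gen g * super_word \<chi> \<gamma> us | g us. (\<forall>v\<in>set us. standard_word v) \<and>
               word_deg D (concat us) < word_deg D u}"
  assume "\<exists>c\<in>lin_span ?S. poly_emb (super_letter \<chi> \<gamma> u) - c \<in> UP_ideal \<chi> \<gamma> f"
  then obtain c where c: "c \<in> lin_span ?S" "poly_emb (super_letter \<chi> \<gamma> u) - c \<in> UP_ideal \<chi> \<gamma> f"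
    by blast
  have "right_action \<chi> 1 c \<in> lin_span (lower_polys u)"
    using klinear_right_action c(1)
  proof (rule klinear_span)
    fix s
    assume "s \<in> ?S"
    then consider us where "s = super_word \<chi> \<gamma> us" "\<forall>v\<in>set us. standard_word v \<and> u \<prec> v"
        "word_deg D (concat us) = word_deg D u"
      | g us where "s = grp_gen g * super_word \<chi> \<gamma> us" "\<forall>v\<in>set us. standard_word v"
        "word_deg D (concat us) < word_deg D u"
      by (auto simp: word_less_def)
    then obtain us where "right_action \<chi> 1 s = super_product \<chi> \<gamma> us"
      "\<forall>v\<in>set us. standard_word v" "lower_word D (concat us) u"
    proof cases
      case 1
      then show ?thesis
        using that[of us] concat_lower_word[OF 1(2) standard_word_nonempty[OF u(1)] 1(3)]
        by (simp add: super_word_eq right_action_poly_emb)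
    next
      case 2
      have "right_action \<chi> 1 (grp_gen g) = 1"
        by (simp add: letter_action_def one_eq_basis_vec word_char_def)
      then have "right_action \<chi> 1 s = super_product \<chi> \<gamma> us"
        using 2 by (simp only: right_action_mult super_word_eq right_action_poly_emb mult_1)
      then show ?thesis
        using that[of us] 2 by (simp add: lower_word_def)
    qed
    then have "right_action \<chi> 1 s \<in> lower_polys u"
      using monic_at_lower monic_at_super_product by metis
    then show "right_action \<chi> 1 s \<in> lin_span (lower_polys u)"
      by (rule V.span_base)
  qed
  then have "right_action \<chi> 1 c \<in> lower_polys u"
    using span_lower_polys by blast
  then have "(super_letter \<chi> \<gamma> u - basis_vec u) - right_action \<chi> 1 c \<in> lower_polys u"
    using monic_at_super_letter[OF u(1)] by (intro lower_polys_diff monic_at_lower_polys)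
  then have "leading_word (super_letter \<chi> \<gamma> u - right_action \<chi> 1 c) u"
    by (intro leading_wordI[of _ 1]) (simp_all add: algebra_simps)
  moreover have "right_action \<chi> 1 (poly_emb (super_letter \<chi> \<gamma> u) - c) \<in> ideal_gen {star \<chi> \<gamma> f}"
    using right_action_UP_ideal[OF char hom c(2)] .
  ultimately have "reducible f u"
    using leading_word_star_ideal[OF f]
    by (simp add: klinear_diff[OF klinear_right_action] right_action_poly_emb)
  with u show False by blast
qed

end

subsection \<open>Skew brackets of super-letters\<close>

text \<open>The words u and v stand for the degrees of P and Q and only fix the coefficient. With
  them as separate arguments the bracket is bilinear, so P and Q can be replaced summand by
  summand.\<close>

definition skew_bracket ::
  "('x \<Rightarrow> 'g::ab_group_add \<Rightarrow> 'k::field) \<Rightarrow> ('x \<Rightarrow> 'g) \<Rightarrow> 'x list \<Rightarrow> 'x list \<Rightarrow>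
   ('x list \<Rightarrow>\<^sub>0 'k) \<Rightarrow> ('x list \<Rightarrow>\<^sub>0 'k) \<Rightarrow> ('x list \<Rightarrow>\<^sub>0 'k)" where
  "skew_bracket \<chi> \<gamma> u v P Q = P * Q - scale (pp \<chi> \<gamma> u v) (Q * P)"

lemma klinear_skew_bracket_left: "klinear (\<lambda>P. skew_bracket \<chi> \<gamma> u v P Q)"
  and klinear_skew_bracket_right: "klinear (\<lambda>Q. skew_bracket \<chi> \<gamma> u v P Q)"
  unfolding skew_bracket_def by (intro klinear_intros)+

lemma word_grp_append: "word_grp \<gamma> (u @ v) = word_grp \<gamma> u + word_grp \<gamma> v"
  by (simp add: word_grp_def)

lemma pp_cong:
  "word_char \<chi> u = word_char \<chi> u' \<Longrightarrow> word_grp \<gamma> v = word_grp \<gamma> v' \<Longrightarrow> pp \<chi> \<gamma> u v = pp \<chi> \<gamma> u' v'"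
  by (simp add: pp_def)

lemma skew_bracket_cong:
  "word_char \<chi> u = word_char \<chi> u' \<Longrightarrow> word_grp \<gamma> v = word_grp \<gamma> v' \<Longrightarrow>
    skew_bracket \<chi> \<gamma> u v = skew_bracket \<chi> \<gamma> u' v'"
  by (simp add: skew_bracket_def fun_eq_iff pp_cong[of \<chi> u u' \<gamma> v v'])

lemma word_char_mset:
  assumes "mset u = mset v"
  shows "word_char \<chi> u = word_char \<chi> v"
proof
  fix g
  show "word_char \<chi> u g = word_char \<chi> v g"
    unfolding word_char_def by (metis assms mset_map prod_mset_prod_list)
qed

lemma word_grp_mset: "mset u = mset v \<Longrightarrow> word_grp \<gamma> u = word_grp \<gamma> v"
  unfolding word_grp_def by (metis mset_map sum_mset_sum_list)

lemma super_letter_standard_splitting: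
  assumes "std_nword (u @ v) = NBr (std_nword u) (std_nword v)" "standard_word u" "standard_word v"
  shows "super_letter \<chi> \<gamma> (u @ v) =
    skew_bracket \<chi> \<gamma> u v (super_letter \<chi> \<gamma> u) (super_letter \<chi> \<gamma> v)"
  using assms by (simp add: super_letter_def skew_bracket_def)

text \<open>
  \<open>gr\<close> is a grading of words that determines the group element and the character; both the
  content of a word and the triple of degree, group element and character are needed.
\<close>

locale skew_grading =
  fixes \<chi> :: "'x::linorder \<Rightarrow> 'g::ab_group_add \<Rightarrow> 'k::field" and \<gamma> :: "'x \<Rightarrow> 'g"
    and gr :: "'x list \<Rightarrow> 'c"
  assumes characters: "character (\<chi> i)"
    and gr_append: "gr u = gr u' \<Longrightarrow> gr v = gr v' \<Longrightarrow> gr (u @ v) = gr (u' @ v')"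
    and gr_mset: "mset u = mset v \<Longrightarrow> gr u = gr v"
    and gr_grp: "gr u = gr v \<Longrightarrow> word_grp \<gamma> u = word_grp \<gamma> v"
    and gr_char: "gr u = gr v \<Longrightarrow> word_char \<chi> u = word_char \<chi> v"
begin

lemma pp_append_left: "pp \<chi> \<gamma> (u @ v) w = pp \<chi> \<gamma> u w * pp \<chi> \<gamma> v w"
  by (simp add: pp_def word_char_append)

lemma pp_append_right: "pp \<chi> \<gamma> u (v @ w) = pp \<chi> \<gamma> u v * pp \<chi> \<gamma> u w"
  by (simp add: pp_def word_grp_append word_char_hom(2)[OF characters])

lemma pp_Nil [simp]: "pp \<chi> \<gamma> u [] = 1" "pp \<chi> \<gamma> [] u = 1"
  by (simp_all add: pp_def word_grp_def word_char_hom(1)[OF characters] word_char_def[of _ "[]"])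

lemmas skew_simps = skew_bracket_def pp_append_left pp_append_right scale_mult_left
  scale_mult_right V.scale_right_diff_distrib left_diff_distrib right_diff_distrib mult.assoc

lemma skew_bracket_mult_right:
  "skew_bracket \<chi> \<gamma> a (b @ c) P (Q * R) =
     skew_bracket \<chi> \<gamma> a b P Q * R + scale (pp \<chi> \<gamma> a b) (Q * skew_bracket \<chi> \<gamma> a c P R)"
  by (simp add: skew_simps)

lemma skew_bracket_mult_left:
  "skew_bracket \<chi> \<gamma> (a @ b) c (P * Q) R =
     P * skew_bracket \<chi> \<gamma> b c Q R + scale (pp \<chi> \<gamma> b c) (skew_bracket \<chi> \<gamma> a c P R * Q)"
  by (simp add: skew_simps mult.commute[of "pp \<chi> \<gamma> b c"])

text \<open>The last two terms take the place of the bracket [[P, R], Q] in the classical identity,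
  to which they reduce when all p are 1.\<close>

lemma skew_bracket_jacobi:
  "skew_bracket \<chi> \<gamma> (a @ b) c (skew_bracket \<chi> \<gamma> a b P Q) R =
     skew_bracket \<chi> \<gamma> a (b @ c) P (skew_bracket \<chi> \<gamma> b c Q R)
     + scale (pp \<chi> \<gamma> b c) (skew_bracket \<chi> \<gamma> a c P R * Q)
     - scale (pp \<chi> \<gamma> a b) (Q * skew_bracket \<chi> \<gamma> a c P R)"
  by (simp add: skew_simps mult.commute mult.left_commute)

text \<open>L restricts each factor separately, whereas u matters only through its grade.\<close>

definition super_span :: "'x list set \<Rightarrow> 'x list \<Rightarrow> ('x list \<Rightarrow>\<^sub>0 'k) set" where
  "super_span L u = lin_span {super_product \<chi> \<gamma> us | us. set us \<subseteq> L \<and> gr (concat us) = gr u}"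

lemma super_span_mono: "L \<subseteq> L' \<Longrightarrow> super_span L u \<subseteq> super_span L' u"
  unfolding super_span_def by (rule V.span_mono) auto

lemma super_span_cong: "gr u = gr v \<Longrightarrow> super_span L u = super_span L v"
  by (simp add: super_span_def)

lemma super_letter_super_span: "u \<in> L \<Longrightarrow> super_letter \<chi> \<gamma> u \<in> super_span L u"
  unfolding super_span_def by (intro V.span_base CollectI exI[of _ "[u]"]) auto

lemma super_span_mult:
  assumes "P \<in> super_span L u" "Q \<in> super_span L v"
  shows "P * Q \<in> super_span L (u @ v)"
  using assms unfolding super_span_def
proof (rule span_mult)
  fix a b
  assume "a \<in> {super_product \<chi> \<gamma> us | us. set us \<subseteq> L \<and> gr (concat us) = gr u}"
    and "b \<in> {super_product \<chi> \<gamma> us | us. set us \<subseteq> L \<and> gr (concat us) = gr v}"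
  then obtain us vs where "a = super_product \<chi> \<gamma> us" "set us \<subseteq> L" "gr (concat us) = gr u"
    "b = super_product \<chi> \<gamma> vs" "set vs \<subseteq> L" "gr (concat vs) = gr v"
    by auto
  then show "a * b \<in> lin_span {super_product \<chi> \<gamma> us | us. set us \<subseteq> L \<and> gr (concat us) = gr (u @ v)}"
    by (intro V.span_base CollectI exI[of _ "us @ vs"]) (auto intro: gr_append)
qed

lemma super_span_add: "P \<in> super_span L u \<Longrightarrow> Q \<in> super_span L u \<Longrightarrow> P + Q \<in> super_span L u"
  and super_span_diff: "P \<in> super_span L u \<Longrightarrow> Q \<in> super_span L u \<Longrightarrow> P - Q \<in> super_span L u"
  and super_span_scale: "P \<in> super_span L u \<Longrightarrow> scale c P \<in> super_span L u"
  unfolding super_span_def by (fact V.span_add V.span_diff V.span_scale)+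

text \<open>By the Leibniz rule each term brackets P with one factor and leaves the others as they
  are; moving a past a factor does not change the grade.\<close>

lemma skew_bracket_product_right:
  assumes "\<And>z. z \<in> set us \<Longrightarrow> z \<in> L \<and> skew_bracket \<chi> \<gamma> a z P (super_letter \<chi> \<gamma> z) \<in> super_span L (a @ z)"
  shows "skew_bracket \<chi> \<gamma> a (concat us) P (super_product \<chi> \<gamma> us) \<in> super_span L (a @ concat us)"
  using assms
proof (induction us)
  case Nil
  then show ?case
    by (simp add: skew_bracket_def super_span_def V.span_zero)
next
  case (Cons z us)
  have prod: "super_product \<chi> \<gamma> us \<in> super_span L (concat us)"
    unfolding super_span_def using Cons.prems by (intro V.span_base) auto
  have "skew_bracket \<chi> \<gamma> a z P (super_letter \<chi> \<gamma> z) * super_product \<chi> \<gamma> us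
      \<in> super_span L ((a @ z) @ concat us)"
    using Cons.prems prod by (intro super_span_mult) auto
  moreover have "super_letter \<chi> \<gamma> z * skew_bracket \<chi> \<gamma> a (concat us) P (super_product \<chi> \<gamma> us)
      \<in> super_span L (z @ a @ concat us)"
    using Cons by (intro super_span_mult super_letter_super_span) auto
  moreover have "super_span L (z @ a @ concat us) = super_span L ((a @ z) @ concat us)"
    by (intro super_span_cong gr_mset) simp
  ultimately show ?case
    by (simp add: skew_bracket_mult_right super_span_add super_span_scale)
qed

lemma skew_bracket_product_left:
  assumes "\<And>z. z \<in> set us \<Longrightarrow> z \<in> L \<and> skew_bracket \<chi> \<gamma> z a (super_letter \<chi> \<gamma> z) P \<in> super_span L (z @ a)"
  shows "skew_bracket \<chi> \<gamma> (concat us) a (super_product \<chi> \<gamma> us) P \<in> super_span L (concat us @ a)"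
  using assms
proof (induction us)
  case Nil
  then show ?case
    by (simp add: skew_bracket_def super_span_def V.span_zero)
next
  case (Cons z us)
  have prod: "super_product \<chi> \<gamma> us \<in> super_span L (concat us)"
    unfolding super_span_def using Cons.prems by (intro V.span_base) auto
  have "skew_bracket \<chi> \<gamma> z a (super_letter \<chi> \<gamma> z) P * super_product \<chi> \<gamma> us
      \<in> super_span L ((z @ a) @ concat us)"
    using Cons.prems prod by (intro super_span_mult) auto
  moreover have "super_letter \<chi> \<gamma> z * skew_bracket \<chi> \<gamma> (concat us) a (super_product \<chi> \<gamma> us) P
      \<in> super_span L (z @ concat us @ a)"
    using Cons by (intro super_span_mult super_letter_super_span) auto
  moreover have "super_span L ((z @ a) @ concat us) = super_span L (z @ concat us @ a)"
    by (intro super_span_cong gr_mset) simp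
  ultimately show ?case
    by (simp add: skew_bracket_mult_left super_span_add super_span_scale)
qed

end

definition standard_above :: "'x::linorder list \<Rightarrow> 'x list set" where
  "standard_above u = {z. standard_word z \<and> u \<prec> z}"

lemma standard_above_mono:
  assumes "u \<preceq> v"
  shows "standard_above v \<subseteq> standard_above u"
proof
  fix z
  assume "z \<in> standard_above v"
  then have z: "standard_word z" "v \<prec> z"
    by (simp_all add: standard_above_def)
  have "u \<prec> z"
    using assms
  proof
    assume "u \<prec> v"
    then show ?thesis
      using z(2) by (rule lexless_trans)
  qed (use z in simp)
  with z show "z \<in> standard_above u"
    by (simp add: standard_above_def)
qed

lemma skew_grading_mset:
  assumes "\<And>i. character (\<chi> i)"
  shows "skew_grading \<chi> \<gamma> mset"
  by unfold_locales (fact assms | rule word_grp_mset word_char_mset; assumption | simp)+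

text \<open>If the cut between u and v is not the standard one, then \<open>u = u1 @ u2\<close> with
  u2 \<prec> v, and the Jacobi identity leads to [u1, [u2, v]] and to products of [u1, v] with [u2].
  The brackets to be rewritten have smaller total length, or equal total length and a shorter left
  member; apart from [uv] itself all factors that arise lie above \<open>u @ v\<close>.\<close>

lemma super_letter_bracket:
  fixes \<chi> :: "'x::linorder \<Rightarrow> 'g::ab_group_add \<Rightarrow> 'k::field"
  assumes char: "\<And>i. character (\<chi> i)"
    and "standard_word u" "standard_word v" "u \<prec> v"
  shows "skew_bracket \<chi> \<gamma> u v (super_letter \<chi> \<gamma> u) (super_letter \<chi> \<gamma> v) - super_letter \<chi> \<gamma> (u @ v)
    \<in> skew_grading.super_span \<chi> \<gamma> mset (standard_above (u @ v)) (u @ v)"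
proof -
  interpret skew_grading \<chi> \<gamma> mset
    using char by (rule skew_grading_mset)
  let ?s = "super_letter \<chi> \<gamma>" and ?br = "skew_bracket \<chi> \<gamma>"
  show ?thesis
    using assms(2-4)
  proof (induction "(u, v)" arbitrary: u v
      rule: wf_induct_rule[OF wf_measures[of "[\<lambda>(u, v). length u + length v, \<lambda>(u, v). length u]"]])
    case (1 u v)
    let ?L = "standard_above (u @ v)"
    note IH = 1(1)[simplified]
    have IH': "?br a b (?s a) (?s b) \<in> super_span ?L (a @ b)"
      if "length a + length b < length u + length v \<or>
          length a + length b = length u + length v \<and> length a < length u"
        "standard_word a" "standard_word b" "a \<prec> b" "u @ v \<prec> a @ b" for a b
    proof -
      have "?br a b (?s a) (?s b) - ?s (a @ b) \<in> super_span ?L (a @ b)"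
        using IH[of a b] that super_span_mono[OF standard_above_mono[of "u @ v" "a @ b"], of "a @ b"]
        by blast
      moreover have "?s (a @ b) \<in> super_span ?L (a @ b)"
        using that standard_word_append by (intro super_letter_super_span) (auto simp: standard_above_def)
      ultimately show ?thesis
        using super_span_add by fastforce
    qed
    show ?case
      using 1(2-4)
    proof (cases rule: std_nword_append_cases)
      case standard
      then show ?thesis
        using 1(2-4) by (simp add: super_letter_standard_splitting super_span_def V.span_zero)
    next
      case (split u1 u2)
      have ne: "u1 \<noteq> []" "u2 \<noteq> []" "v \<noteq> []"
        using split 1 standard_word_nonempty by auto
      have len: "length u1 < length u" "length u2 < length u"
        using split ne by auto
      have std: "standard_word (u2 @ v)"
        using split 1 by (intro standard_word_append)
      have "u1 \<prec> u2 @ v"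
        using split(4) lexless_append[OF ne(3), of u2] lexless_trans by blast
      \<comment> \<open>The suffix u2 differs from u at a letter, so the comparison survives
        appending v. Hence u2, and every word above \<open>u2 @ v\<close>, is an admissible
        factor.\<close>
      have "u @ v \<prec> u2"
        using standard_word_suffix[OF 1(2) split(1)] ne len
          strictly_before_append[OF lexless_strict_length, of u u2 v "[]"] by simp
      have "u2 @ v \<prec> v"
        using split 1 by (intro standard_word_append_less)
      let ?X = "?br u2 v (?s u2) (?s v) - ?s (u2 @ v)"
      have X: "?X \<in> super_span (standard_above (u2 @ v)) (u2 @ v)"
        using IH[of u2 v] split(3,6) 1(3) len by simp
      have X': "?br u1 (u2 @ v) (?s u1) ?X \<in> super_span ?L (u @ v)"
        using klinear_skew_bracket_right X[unfolded super_span_def] unfolding super_span_def[of ?L "u @ v"]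
      proof (rule klinear_span)
        fix g
        assume "g \<in> {super_product \<chi> \<gamma> us | us. set us \<subseteq> standard_above (u2 @ v) \<and>
            mset (concat us) = mset (u2 @ v)}"
        then obtain us where us: "g = super_product \<chi> \<gamma> us" "set us \<subseteq> standard_above (u2 @ v)"
            "mset (concat us) = mset (u2 @ v)"
          by blast
        have "z \<in> ?L \<and> ?br u1 z (?s u1) (?s z) \<in> super_span ?L (u1 @ z)" if "z \<in> set us" for z
        proof -
          have z: "standard_word z" "u2 @ v \<prec> z"
            using us that by (auto simp: standard_above_def)
          \<comment> \<open>A factor is no longer than its product, whose content is that of
            \<open>u2 @ v\<close>; so the bracket of u1 with z falls under the induction
            hypothesis.\<close>
          have "mset z \<subseteq># mset (concat us)"
            using that by (induction us) (auto intro: subset_mset.add_increasing2 subset_mset.add_increasing)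
          then have "length z \<le> length u2 + length v"
            using us(3) size_mset_mono by fastforce
          then have "length u1 + length z < length u + length v \<or>
              length u1 + length z = length u + length v \<and> length u1 < length u"
            using split(1) len(1) by auto
          moreover have "u @ v \<prec> z"
            using \<open>u @ v \<prec> u2\<close> z lexless_append[OF ne(3), of u2] lexless_trans by blast
          moreover have "u1 \<prec> z"
            using \<open>u1 \<prec> u2 @ v\<close> z lexless_trans by blast
          moreover have "u @ v \<prec> u1 @ z"
            using z split(1) by simp
          ultimately show ?thesis
            using IH'[of u1 z] z split(2) by (simp add: standard_above_def)
        qed
        then have "?br u1 (concat us) (?s u1) g \<in> super_span ?L (u1 @ concat us)"
          unfolding us(1) by (rule skew_bracket_product_right)
        moreover have "?br u1 (concat us) = ?br u1 (u2 @ v)"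
          using us(3) by (intro skew_bracket_cong word_grp_mset) auto
        moreover have "super_span ?L (u1 @ concat us) = super_span ?L (u @ v)"
          using us(3) split(1) by (intro super_span_cong) simp
        ultimately show "?br u1 (u2 @ v) (?s u1) g
            \<in> lin_span {super_product \<chi> \<gamma> us | us. set us \<subseteq> ?L \<and> mset (concat us) = mset (u @ v)}"
          by (simp add: super_span_def)
      qed
      have Z: "?br u1 (u2 @ v) (?s u1) (?s (u2 @ v)) - ?s (u @ v) \<in> super_span ?L (u @ v)"
        using IH[of u1 "u2 @ v"] split(1,2) len std \<open>u1 \<prec> u2 @ v\<close> by simp
      have Y: "?br u1 v (?s u1) (?s v) \<in> super_span ?L (u1 @ v)"
        using IH'[of u1 v] len split 1 \<open>u2 @ v \<prec> v\<close> lexless_trans[OF split(4) split(6)] ne by simp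
      have u2: "?s u2 \<in> super_span ?L u2"
        using split \<open>u @ v \<prec> u2\<close> by (intro super_letter_super_span) (simp add: standard_above_def)
      have Y1: "?br u1 v (?s u1) (?s v) * ?s u2 \<in> super_span ?L (u @ v)"
        using super_span_mult[OF Y u2] split(1) super_span_cong[of "(u1 @ v) @ u2" "u @ v"] by simp
      have Y2: "?s u2 * ?br u1 v (?s u1) (?s v) \<in> super_span ?L (u @ v)"
        using super_span_mult[OF u2 Y] split(1) super_span_cong[of "u2 @ u1 @ v" "u @ v"] by simp
      have "?br u1 (u2 @ v) (?s u1) ?X
          + (?br u1 (u2 @ v) (?s u1) (?s (u2 @ v)) - ?s (u @ v))
          + scale (pp \<chi> \<gamma> u2 v) (?br u1 v (?s u1) (?s v) * ?s u2)
          - scale (pp \<chi> \<gamma> u1 u2) (?s u2 * ?br u1 v (?s u1) (?s v)) \<in> super_span ?L (u @ v)"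
        by (rule super_span_diff[OF super_span_add[OF super_span_add[OF X' Z]
              super_span_scale[OF Y1]] super_span_scale[OF Y2]])
      moreover have "?br u v (?s u) (?s v) =
          ?br u1 (u2 @ v) (?s u1) (?br u2 v (?s u2) (?s v))
          + scale (pp \<chi> \<gamma> u2 v) (?br u1 v (?s u1) (?s v) * ?s u2)
          - scale (pp \<chi> \<gamma> u1 u2) (?s u2 * ?br u1 v (?s u1) (?s v))"
        using super_letter_standard_splitting[of u1 u2 \<chi> \<gamma>] split
        by (simp add: skew_bracket_jacobi)
      ultimately show ?thesis
        by (simp only: klinear_diff[OF klinear_skew_bracket_right]) (simp add: algebra_simps)
    qed
  qed
qed

subsection \<open>Reducible super-letters are not hard\<close>

context degrees
begin

text \<open>Homogeneity is given for the words of f*, where a standard word of f might have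
  cancelled. Among the standard words of f with a given content, the greatest occurs in no other
  super-letter of f* and keeps its coefficient. So each standard word of f shares its content with
  some word of f*.\<close>

lemma homogeneous_relation:
  fixes f :: "'x nword \<Rightarrow>\<^sub>0 'k::field" and \<chi> :: "'x \<Rightarrow> 'g::ab_group_add \<Rightarrow> 'k"
  assumes f: "Poly_Mapping.keys f \<subseteq> standard_nwords" and hom: "gg_homogeneous \<chi> \<gamma> (star \<chi> \<gamma> f)"
    and u: "standard_word u" "std_nword u \<in> Poly_Mapping.keys f"
    and v: "standard_word v" "std_nword v \<in> Poly_Mapping.keys f"
  shows "word_grp \<gamma> u = word_grp \<gamma> v" "word_char \<chi> u = word_char \<chi> v"
proof -
  let ?S = "{u. standard_word u \<and> std_nword u \<in> Poly_Mapping.keys f}"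
  have key: "\<exists>k\<in>Poly_Mapping.keys (star \<chi> \<gamma> f). mset k = mset u" if "u \<in> ?S" for u
  proof -
    have "finite {v \<in> ?S. mset v = mset u}"
      by (rule finite_subset[OF _ super_letters_of_relation(2)[OF f]]) auto
    moreover have "{v \<in> ?S. mset v = mset u} \<noteq> {}"
      using that by blast
    ultimately obtain m where m: "m \<in> ?S" "mset m = mset u"
      and max: "\<And>v. v \<in> ?S \<Longrightarrow> mset v = mset u \<Longrightarrow> v = m \<or> lower_word D v m"
      using maximal_word_exists[of "{v \<in> ?S. mset v = mset u}"] by blast
    have "Poly_Mapping.lookup (super_letter \<chi> \<gamma> v) m = 0" if "v \<in> ?S - {m}" for v
    proof (rule ccontr)
      assume "Poly_Mapping.lookup (super_letter \<chi> \<gamma> v) m \<noteq> 0"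
      then have "m \<in> words_ge v"
        using monic_at_ge[OF monic_at_super_letter[of v \<chi> \<gamma>]] that
        by (auto simp: span_basis_vec in_keys_iff)
      then have "mset v = mset u" "lower_word D m v"
        using that m words_gt_lower_word by (auto simp: words_ge_gt words_gt_def)
      then show False
        using max[of v] that lower_word_trans[of D m v m] by auto
    qed
    moreover have "Poly_Mapping.lookup (super_letter \<chi> \<gamma> m) m = 1"
    proof -
      have "m \<notin> Poly_Mapping.keys (super_letter \<chi> \<gamma> m - basis_vec m)"
        using monic_at_super_letter[of m \<chi> \<gamma>] m
        by (auto simp: monic_at_def span_basis_vec words_gt_def)
      then show ?thesis
        by (simp add: in_keys_iff lookup_minus)
    qed
    ultimately have "Poly_Mapping.lookup (star \<chi> \<gamma> f) m = Poly_Mapping.lookup f (std_nword m)"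
      unfolding super_letters_of_relation(1)[OF f] sum.remove[OF super_letters_of_relation(2)[OF f] m(1)]
      by (simp add: Poly_Mapping.lookup_add lookup_sum)
    then show ?thesis
      using m by (intro bexI[of _ m]) (auto simp: in_keys_iff)
  qed
  obtain k l where "k \<in> Poly_Mapping.keys (star \<chi> \<gamma> f)" "mset k = mset u"
    "l \<in> Poly_Mapping.keys (star \<chi> \<gamma> f)" "mset l = mset v"
    using key[of u] key[of v] u v by blast
  then show "word_grp \<gamma> u = word_grp \<gamma> v" "word_char \<chi> u = word_char \<chi> v"
    using hom word_grp_mset[of k u \<gamma>] word_grp_mset[of l v \<gamma>]
      word_char_mset[of k u \<chi>] word_char_mset[of l v \<chi>]
    unfolding gg_homogeneous_def by metis+
qed

text \<open>Content is too fine here: solving f* for [w] replaces w by standard words that may agree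
  with it only in degree, group element and character.\<close>

definition grade ::
  "('x \<Rightarrow> 'g::ab_group_add \<Rightarrow> 'k::field) \<Rightarrow> ('x \<Rightarrow> 'g) \<Rightarrow> 'x list \<Rightarrow> 'd \<times> 'g \<times> ('g \<Rightarrow> 'k)" where
  "grade \<chi> \<gamma> u = (word_deg D u, word_grp \<gamma> u, word_char \<chi> u)"

lemma skew_grading_grade:
  assumes "\<And>i. character (\<chi> i)"
  shows "skew_grading \<chi> \<gamma> (grade \<chi> \<gamma>)"
proof unfold_locales
  show "grade \<chi> \<gamma> u = grade \<chi> \<gamma> v" if "mset u = mset v" for u v
    unfolding grade_def word_deg_mset that word_grp_mset[OF that] word_char_mset[OF that] ..
qed (auto simp: grade_def word_deg_append word_grp_append word_char_append fun_eq_iff assms)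

end

locale quantum_relation = degrees D
  for D :: "'x::{finite,linorder} \<Rightarrow> 'd::linordered_ab_group_add" +
  fixes \<chi> :: "'x \<Rightarrow> 'g::ab_group_add \<Rightarrow> 'k::field" and \<gamma> :: "'x \<Rightarrow> 'g"
    and f :: "'x nword \<Rightarrow>\<^sub>0 'k"
  assumes char: "\<And>i. character (\<chi> i)"
    and f: "Poly_Mapping.keys f \<subseteq> standard_nwords"
    and hom: "gg_homogeneous \<chi> \<gamma> (star \<chi> \<gamma> f)"
begin

sublocale skew_grading \<chi> \<gamma> "grade \<chi> \<gamma>"
  using char by (rule skew_grading_grade)

abbreviation "sl \<equiv> super_letter \<chi> \<gamma>"
abbreviation "br \<equiv> skew_bracket \<chi> \<gamma>"

text \<open>Equal grade is demanded where hardness asks only for equal degree, so that these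
  products have the same coefficient as [u] in a skew bracket and can replace it there. In lower
  degree plain words suffice, each being a super-word in single letters.\<close>

definition nonhard_gens :: "'x list \<Rightarrow> ('x list \<Rightarrow>\<^sub>0 'k) set" where
  "nonhard_gens u =
     {super_product \<chi> \<gamma> us | us. set us \<subseteq> standard_above u \<and> grade \<chi> \<gamma> (concat us) = grade \<chi> \<gamma> u}
     \<union> basis_vec ` {z. word_deg D z < word_deg D u}"

definition nonhard_span :: "'x list \<Rightarrow> ('x list \<Rightarrow>\<^sub>0 'k) set" where
  "nonhard_span u = lin_span (nonhard_gens u \<union> ideal_gen {star \<chi> \<gamma> f})"

lemma nonhard_span_diff: "P \<in> nonhard_span u \<Longrightarrow> Q \<in> nonhard_span u \<Longrightarrow> P - Q \<in> nonhard_span u"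
  and nonhard_span_scale: "P \<in> nonhard_span u \<Longrightarrow> scale c P \<in> nonhard_span u"
  unfolding nonhard_span_def by (fact V.span_add V.span_diff V.span_scale)+

lemma super_span_nonhard: "P \<in> super_span (standard_above u) u \<Longrightarrow> P \<in> nonhard_span u"
  unfolding super_span_def nonhard_span_def nonhard_gens_def by (erule subsetD[OF V.span_mono, rotated]) blast

lemma lower_degree_nonhard:
  "P \<in> lin_span (basis_vec ` {z. word_deg D z < word_deg D u}) \<Longrightarrow> P \<in> nonhard_span u"
  unfolding nonhard_span_def nonhard_gens_def by (erule subsetD[OF V.span_mono, rotated]) blast

lemma ideal_nonhard: "P \<in> ideal_gen {star \<chi> \<gamma> f} \<Longrightarrow> P \<in> nonhard_span u"
  unfolding nonhard_span_def by (simp add: V.span_base)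

lemma super_letter_bracket_nonhard:
  assumes "standard_word u" "standard_word v" "u \<prec> v"
  shows "br u v (sl u) (sl v) - sl (u @ v) \<in> nonhard_span (u @ v)"
proof -
  interpret m: skew_grading \<chi> \<gamma> mset
    using char by (rule skew_grading_mset)
  have "m.super_span L w \<subseteq> super_span L w" for L w
    unfolding m.super_span_def super_span_def using gr_mset by (intro V.span_mono) blast
  then show ?thesis
    using super_letter_bracket[where \<chi> = \<chi> and \<gamma> = \<gamma>, OF char assms] super_span_nonhard by blast
qed

lemma super_letter_bracket_above:
  assumes "standard_word a" "standard_word b" "a \<prec> b" "u \<prec> a @ b"
  shows "br a b (sl a) (sl b) \<in> super_span (standard_above u) (a @ b)"
proof -
  interpret m: skew_grading \<chi> \<gamma> mset
    using char by (rule skew_grading_mset)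
  have "m.super_span (standard_above (a @ b)) (a @ b) \<subseteq> super_span (standard_above u) (a @ b)"
    unfolding m.super_span_def super_span_def
    using gr_mset standard_above_mono[of u "a @ b"] assms(4) by (intro V.span_mono) blast
  then have "br a b (sl a) (sl b) - sl (a @ b) \<in> super_span (standard_above u) (a @ b)"
    using super_letter_bracket[where \<chi> = \<chi> and \<gamma> = \<gamma>, OF char assms(1-3)] by blast
  moreover have "sl (a @ b) \<in> super_span (standard_above u) (a @ b)"
    using assms standard_word_append by (intro super_letter_super_span) (auto simp: standard_above_def)
  ultimately show ?thesis
    using super_span_add by fastforce
qed

lemma super_letter_bracket_above':
  assumes "standard_word a" "standard_word b" "u \<prec> a" "u \<prec> b" "u \<prec> a @ b"
  shows "br a b (sl a) (sl b) \<in> super_span (standard_above u) (a @ b)"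
proof (cases "a \<prec> b")
  case True
  then show ?thesis
    using assms super_letter_bracket_above by blast
next
  case False
  have *: "sl a \<in> super_span (standard_above u) a" "sl b \<in> super_span (standard_above u) b"
    using assms by (auto intro!: super_letter_super_span simp: standard_above_def)
  have "sl b * sl a \<in> super_span (standard_above u) (a @ b)"
    using super_span_mult[OF *(2,1)] super_span_cong[OF gr_mset[of "b @ a" "a @ b"]] by simp
  then show ?thesis
    unfolding skew_bracket_def using super_span_mult[OF *]
    by (intro super_span_diff super_span_scale)
qed

lemma super_letter_degree:
  "standard_word u \<Longrightarrow> sl u \<in> lin_span (basis_vec ` {z. word_deg D z = word_deg D u})"
  using monic_at_ge[OF monic_at_super_letter]
  by (rule subsetD[OF V.span_mono, rotated]) (auto simp: words_ge_def word_deg_mset)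

lemma lower_degree_mult:
  assumes "P \<in> lin_span (basis_vec ` A)" "Q \<in> lin_span (basis_vec ` B)"
    "\<And>a b. a \<in> A \<Longrightarrow> b \<in> B \<Longrightarrow> word_deg D a + word_deg D b < word_deg D u"
  shows "P * Q \<in> nonhard_span u"
  by (rule lower_degree_nonhard, rule span_mult[OF assms(1,2)])
    (auto simp: basis_vec_mult word_deg_append intro!: V.span_base imageI assms(3))

lemma letter_degree_le: "z \<in> set us \<Longrightarrow> word_deg D z \<le> word_deg D (concat us)"
  by (induction us) (auto simp: word_deg_append intro: add_increasing add_increasing2 word_deg_nonneg)

text \<open>The rewriting of [u] is substituted into the bracket. A factor z above u has degree at
  most that of u, so it differs from u at a letter, and both z and \<open>z @ v\<close> lie above
  \<open>u @ v\<close>. Equal grade preserves the coefficient, and the Leibniz rule reduces to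
  single factors.\<close>

lemma bracket_left_nonhard:
  assumes u: "standard_word u" "standard_word v" "u \<prec> v" and nh: "sl u \<in> nonhard_span u"
  shows "br u v (sl u) (sl v) \<in> nonhard_span (u @ v)"
  using klinear_skew_bracket_left nh[unfolded nonhard_span_def] unfolding nonhard_span_def[of "u @ v"]
proof (rule klinear_span)
  fix g
  assume "g \<in> nonhard_gens u \<union> ideal_gen {star \<chi> \<gamma> f}"
  then consider us where "g = super_product \<chi> \<gamma> us" "set us \<subseteq> standard_above u"
      "grade \<chi> \<gamma> (concat us) = grade \<chi> \<gamma> u"
    | z where "g = basis_vec z" "word_deg D z < word_deg D u"
    | "g \<in> ideal_gen {star \<chi> \<gamma> f}"
    by (auto simp: nonhard_gens_def)
  then have "br u v g (sl v) \<in> nonhard_span (u @ v)"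
  proof cases
    case 1
    let ?L = "standard_above (u @ v)"
    have "u @ v \<prec> v"
      using u by (rule standard_word_append_less)
    have "z \<in> ?L \<and> br z v (sl z) (sl v) \<in> super_span ?L (z @ v)" if "z \<in> set us" for z
    proof -
      have z: "standard_word z" "u \<prec> z"
        using that 1 by (auto simp: standard_above_def)
      have "word_deg D z \<le> word_deg D u"
        using letter_degree_le[OF that] 1(3) by (simp add: grade_def)
      then have "strictly_before u z"
        using z lexless_strict_deg by blast
      then have "u @ v \<prec> z" "u @ v \<prec> z @ v"
        using strictly_before_append[of u z v "[]"] strictly_before_append[of u z v v] by simp_all
      then show ?thesis
        using z u \<open>u @ v \<prec> v\<close> super_letter_bracket_above' by (auto simp: standard_above_def)
    qed
    then have "br (concat us) v g (sl v) \<in> super_span ?L (concat us @ v)"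
      unfolding 1 by (rule skew_bracket_product_left)
    moreover have "br (concat us) v = br u v"
      using 1(3) by (intro skew_bracket_cong) (auto simp: grade_def)
    moreover have "super_span ?L (concat us @ v) = super_span ?L (u @ v)"
      using 1(3) by (intro super_span_cong gr_append) simp_all
    ultimately show ?thesis
      using super_span_nonhard by simp
  next
    case 2
    have g: "g \<in> lin_span (basis_vec ` {z})"
      using 2 by (simp add: V.span_base)
    show ?thesis
      unfolding skew_bracket_def
      by (intro nonhard_span_diff nonhard_span_scale lower_degree_mult[OF g super_letter_degree[OF u(2)]]
          lower_degree_mult[OF super_letter_degree[OF u(2)] g])
        (use 2 in \<open>auto simp: word_deg_append add.commute\<close>)
  next
    case 3
    then show ?thesis
      unfolding skew_bracket_def
      by (intro ideal_nonhard ideal_gen_diff ideal_gen_scale ideal_gen.mult_left ideal_gen.mult_right)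
  qed
  then show "br u v g (sl v) \<in> lin_span (nonhard_gens (u @ v) \<union> ideal_gen {star \<chi> \<gamma> f})"
    by (simp add: nonhard_span_def)
qed

text \<open>For a factor z in the rewriting of [v], u \<prec> v \<prec> z, so the bracket of [u] and
  [z] is expressed by super-letters from \<open>uz\<close> upwards, and \<open>u @ v\<close> \<prec>
  \<open>u @ z\<close>.\<close>

lemma bracket_right_nonhard:
  assumes u: "standard_word u" "standard_word v" "u \<prec> v" and nh: "sl v \<in> nonhard_span v"
  shows "br u v (sl u) (sl v) \<in> nonhard_span (u @ v)"
  using klinear_skew_bracket_right nh[unfolded nonhard_span_def] unfolding nonhard_span_def[of "u @ v"]
proof (rule klinear_span)
  fix g
  assume "g \<in> nonhard_gens v \<union> ideal_gen {star \<chi> \<gamma> f}"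
  then consider us where "g = super_product \<chi> \<gamma> us" "set us \<subseteq> standard_above v"
      "grade \<chi> \<gamma> (concat us) = grade \<chi> \<gamma> v"
    | z where "g = basis_vec z" "word_deg D z < word_deg D v"
    | "g \<in> ideal_gen {star \<chi> \<gamma> f}"
    by (auto simp: nonhard_gens_def)
  then have "br u v (sl u) g \<in> nonhard_span (u @ v)"
  proof cases
    case 1
    let ?L = "standard_above (u @ v)"
    have "u @ v \<prec> v"
      using u by (rule standard_word_append_less)
    have "z \<in> ?L \<and> br u z (sl u) (sl z) \<in> super_span ?L (u @ z)" if "z \<in> set us" for z
    proof -
      have z: "standard_word z" "v \<prec> z"
        using that 1 by (auto simp: standard_above_def)
      then have "u \<prec> z" "u @ v \<prec> z"
        using u \<open>u @ v \<prec> v\<close> lexless_trans by blast+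
      then show ?thesis
        using z u super_letter_bracket_above[of u z "u @ v"] by (simp add: standard_above_def)
    qed
    then have "br u (concat us) (sl u) g \<in> super_span ?L (u @ concat us)"
      unfolding 1 by (rule skew_bracket_product_right)
    moreover have "br u (concat us) = br u v"
      using 1(3) by (intro skew_bracket_cong) (auto simp: grade_def)
    moreover have "super_span ?L (u @ concat us) = super_span ?L (u @ v)"
      using 1(3) by (intro super_span_cong gr_append) simp_all
    ultimately show ?thesis
      using super_span_nonhard by simp
  next
    case 2
    have g: "g \<in> lin_span (basis_vec ` {z})"
      using 2 by (simp add: V.span_base)
    show ?thesis
      unfolding skew_bracket_def
      by (intro nonhard_span_diff nonhard_span_scale lower_degree_mult[OF g super_letter_degree[OF u(1)]]
          lower_degree_mult[OF super_letter_degree[OF u(1)] g])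
        (use 2 in \<open>auto simp: word_deg_append add.commute\<close>)
  next
    case 3
    then show ?thesis
      unfolding skew_bracket_def
      by (intro ideal_nonhard ideal_gen_diff ideal_gen_scale ideal_gen.mult_left ideal_gen.mult_right)
  qed
  then show "br u v (sl u) g \<in> lin_span (nonhard_gens (u @ v) \<union> ideal_gen {star \<chi> \<gamma> f})"
    by (simp add: nonhard_span_def)
qed

text \<open>The relation is solved for [w]. Each other super-letter has lower degree, or lies above
  w and shares its grade by \<open>homogeneous_relation\<close>.\<close>

lemma leading_nonhard:
  assumes w: "leading_standard_word f w"
  shows "sl w \<in> nonhard_span w"
proof -
  let ?S = "{u. standard_word u \<and> std_nword u \<in> Poly_Mapping.keys f}"
  let ?t = "\<lambda>u. scale (Poly_Mapping.lookup f (std_nword u)) (sl u)"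
  define c where "c = Poly_Mapping.lookup f (std_nword w)"
  have wS: "w \<in> ?S"
    using w by (simp add: leading_standard_word_def)
  have "c \<noteq> 0"
    using wS by (simp add: c_def in_keys_iff)
  have "sl v \<in> nonhard_span w" if "v \<in> ?S - {w}" for v
  proof -
    have v: "standard_word v" "std_nword v \<in> Poly_Mapping.keys f" "lower_word D v w"
      using that w by (auto simp: leading_standard_word_def)
    show ?thesis
    proof (cases "word_deg D v < word_deg D w")
      case True
      have "sl v \<in> lin_span (basis_vec ` {z. word_deg D z < word_deg D w})"
        by (rule subsetD[OF V.span_mono super_letter_degree[OF v(1)]])
          (use True in auto)
      then show ?thesis
        by (rule lower_degree_nonhard)
    next
      case False
      then have "word_deg D v = word_deg D w" "w \<prec> v"
        using v by (auto simp: lower_word_def)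
      then have "grade \<chi> \<gamma> v = grade \<chi> \<gamma> w" "v \<in> standard_above w"
        using homogeneous_relation[OF f hom, of v w] v wS by (auto simp: grade_def standard_above_def)
      then have "sl v \<in> super_span (standard_above w) w"
        using super_letter_super_span[of v] super_span_cong by blast
      then show ?thesis
        by (rule super_span_nonhard)
    qed
  qed
  then have "sum ?t (?S - {w}) \<in> nonhard_span w"
    unfolding nonhard_span_def by (intro V.span_sum V.span_scale)
  moreover have "star \<chi> \<gamma> f \<in> nonhard_span w"
    by (intro ideal_nonhard ideal_gen.gen) simp
  ultimately have "scale (inverse c) (star \<chi> \<gamma> f - sum ?t (?S - {w})) \<in> nonhard_span w"
    by (intro nonhard_span_scale nonhard_span_diff)
  moreover have "star \<chi> \<gamma> f = scale c (sl w) + sum ?t (?S - {w})"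
    unfolding super_letters_of_relation(1)[OF f] sum.remove[OF super_letters_of_relation(2)[OF f] wS]
    by (simp add: c_def)
  ultimately show ?thesis
    using \<open>c \<noteq> 0\<close> by simp
qed

lemma reducible_nonhard:
  assumes "standard_word u" "leading_standard_word f w" "subword w u"
  shows "sl u \<in> nonhard_span u"
  using assms(1,3)
proof (induction "length u" arbitrary: u rule: less_induct)
  case less
  show ?case
  proof (cases "w = u")
    case True
    then show ?thesis
      using leading_nonhard assms(2) by simp
  next
    case False
    then obtain a b where u: "u = a @ b" and ab: "standard_word a" "standard_word b" "a \<prec> b"
      and w: "subword w a \<or> subword w b"
      using standard_word_subword_split[of u w] less.prems assms(2)
      by (auto simp: leading_standard_word_def)
    have "a \<noteq> []" "b \<noteq> []"
      using ab standard_word_nonempty by auto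
    then have "br a b (sl a) (sl b) \<in> nonhard_span u"
      using w bracket_left_nonhard[OF ab] bracket_right_nonhard[OF ab] less.hyps[of a]
        less.hyps[of b] ab unfolding u by auto
    then show ?thesis
      using nonhard_span_diff[OF _ super_letter_bracket_nonhard[OF ab]] u by fastforce
  qed
qed

lemma poly_emb_ideal: "P \<in> ideal_gen {star \<chi> \<gamma> f} \<Longrightarrow> poly_emb P \<in> UP_ideal \<chi> \<gamma> f"
  by (induction rule: ideal_gen.induct)
    (auto simp: UP_ideal_def klinear_zero[OF klinear_poly_emb] klinear_add[OF klinear_poly_emb]
      poly_emb_mult intro: ideal_gen.intros)

lemma not_UP_hard_if_reducible:
  assumes u: "standard_word u" "reducible f u"
  shows "\<not> UP_hard \<chi> \<gamma> D f u"
proof -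
  let ?S = "{super_word \<chi> \<gamma> us | us. (\<forall>v\<in>set us. standard_word v \<and> word_less v u) \<and>
               word_deg D (concat us) = word_deg D u} \<union>
            {grp_gen g * super_word \<chi> \<gamma> us | g us. (\<forall>v\<in>set us. standard_word v) \<and>
               word_deg D (concat us) < word_deg D u}"
  have "sl u \<in> lin_span (nonhard_gens u \<union> ideal_gen {star \<chi> \<gamma> f})"
    using reducible_nonhard u by (auto simp: reducible_def nonhard_span_def)
  then have "poly_emb (sl u) \<in> lin_span (?S \<union> UP_ideal \<chi> \<gamma> f)"
  proof (rule klinear_span[OF klinear_poly_emb])
    fix g
    assume "g \<in> nonhard_gens u \<union> ideal_gen {star \<chi> \<gamma> f}"
    then consider us where "g = super_product \<chi> \<gamma> us" "set us \<subseteq> standard_above u"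
        "grade \<chi> \<gamma> (concat us) = grade \<chi> \<gamma> u"
      | z where "g = basis_vec z" "word_deg D z < word_deg D u"
      | "g \<in> ideal_gen {star \<chi> \<gamma> f}"
      by (auto simp: nonhard_gens_def)
    then show "poly_emb g \<in> lin_span (?S \<union> UP_ideal \<chi> \<gamma> f)"
    proof cases
      case 1
      then have "poly_emb g \<in> ?S"
        by (intro UnI1 CollectI exI[of _ us])
          (auto simp: super_word_eq standard_above_def word_less_def grade_def)
      then show ?thesis
        by (rule V.span_base[OF UnI1])
    next
      case 2
      \<comment> \<open>Cutting z into single letters presents any word as a super-word.\<close>
      let ?us = "map (\<lambda>x. [x]) z"
      have "basis_vec z = super_product \<chi> \<gamma> ?us"
      proof (induction z)
        case (Cons x z)
        have "basis_vec (x # z) = (basis_vec [x] * basis_vec z :: 'x list \<Rightarrow>\<^sub>0 'k)"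
          by (simp add: basis_vec_mult)
        then show ?case
          by (simp add: Cons.IH super_letter_def)
      qed (simp add: one_eq_basis_vec)
      then have g: "poly_emb g = super_word \<chi> \<gamma> ?us"
        by (simp add: super_word_eq 2)
      \<comment> \<open>In lower degree only G-super-words are offered, and \<open>grp_gen 0\<close>
        equals 1 only modulo the ideal; the relation \<open>grp_gen 0 - 1\<close> makes up the
        difference.\<close>
      have "grp_gen 0 * poly_emb g \<in> ?S"
        using 2 unfolding g by (intro UnI2 CollectI exI[of _ 0] exI[of _ ?us]) auto
      moreover have "(grp_gen 0 - 1) * poly_emb g \<in> UP_ideal \<chi> \<gamma> f"
        unfolding UP_ideal_def by (intro ideal_gen.mult_right ideal_gen.gen) blast
      ultimately have "grp_gen 0 * poly_emb g - (grp_gen 0 - 1) * poly_emb g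
          \<in> lin_span (?S \<union> UP_ideal \<chi> \<gamma> f)"
        by (rule V.span_diff[OF V.span_base[OF UnI1] V.span_base[OF UnI2]])
      then show ?thesis
        by (simp add: algebra_simps)
    next
      case 3
      then show ?thesis
        by (rule V.span_base[OF UnI2[OF poly_emb_ideal]])
    qed
  qed
  then obtain c i where "poly_emb (sl u) = c + i" "c \<in> lin_span ?S" "i \<in> lin_span (UP_ideal \<chi> \<gamma> f)"
    unfolding V.span_Un by blast
  moreover have "lin_span (UP_ideal \<chi> \<gamma> f) = UP_ideal \<chi> \<gamma> f"
    unfolding UP_ideal_def by (rule span_ideal_gen)
  ultimately have "c \<in> lin_span ?S" "poly_emb (sl u) - c \<in> UP_ideal \<chi> \<gamma> f"
    by simp_all
  then show ?thesis
    unfolding UP_hard_def by blast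
qed

lemma UP_hard_iff: "standard_word u \<Longrightarrow> UP_hard \<chi> \<gamma> D f u \<longleftrightarrow> \<not> reducible f u"
  using UP_hard_if_irreducible[OF char hom f] not_UP_hard_if_reducible by blast

end

subsection \<open>The Hall--Shirshov basis\<close>

lemma nbr_basis_vec: "nbr (basis_vec s) (basis_vec t) = basis_vec (NBr s t)"
  by (simp add: nbr_def bilin_ext_def)

lemma klinear_nbr_right: "klinear (\<lambda>b. nbr a b)"
  unfolding nbr_def bilin_ext_def by (rule klinear_lin_ext_param) (rule klinear_lin_ext)

lemma klinear_nbr_left: "klinear (\<lambda>a. nbr a b)"
  unfolding nbr_def bilin_ext_def by (rule klinear_lin_ext)

lemma lie_ideal_zero: "0 \<in> lie_ideal f"
  using lie_ideal.scale[OF lie_ideal.relation, of 0] by simp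

lemma lie_ideal_neg: "a \<in> lie_ideal f \<Longrightarrow> - a \<in> lie_ideal f"
  using lie_ideal.scale[of a f "- 1"] by simp

lemma span_lie_ideal: "lin_span (lie_ideal f) = lie_ideal f"
  by (subst V.span_eq_iff)
    (auto simp: V.subspace_def intro: lie_ideal_zero lie_ideal.add lie_ideal.scale)

lemma nbr_anticommute: "nbr a b + nbr b a \<in> lie_ideal f"
proof -
  have "nbr (a + b) (a + b) + (- nbr a a + - nbr b b) \<in> lie_ideal f"
    by (intro lie_ideal.add lie_ideal_neg lie_ideal.alternating)
  then show ?thesis
    by (simp add: klinear_add[OF klinear_nbr_left] klinear_add[OF klinear_nbr_right] algebra_simps)
qed

lemma nbr_leibniz: "nbr (nbr a b) c - (nbr a (nbr b c) + nbr (nbr a c) b) \<in> lie_ideal f"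
proof -
  have "nbr (nbr c a + nbr a c) b \<in> lie_ideal f"
    by (intro lie_ideal.bracket_right nbr_anticommute)
  moreover have "nbr (nbr b c) a + nbr a (nbr b c) \<in> lie_ideal f"
    by (rule nbr_anticommute)
  ultimately have "(nbr (nbr a b) c + nbr (nbr b c) a + nbr (nbr c a) b)
      + (- nbr (nbr c a + nbr a c) b + - (nbr (nbr b c) a + nbr a (nbr b c))) \<in> lie_ideal f"
    by (rule lie_ideal.add[OF lie_ideal.jacobi
          lie_ideal.add[OF lie_ideal_neg lie_ideal_neg]])
  then show ?thesis
    by (simp add: klinear_add[OF klinear_nbr_left] algebra_simps)
qed

abbreviation std_vec :: "'x::linorder list \<Rightarrow> ('x nword \<Rightarrow>\<^sub>0 'k::field)" where
  "std_vec u \<equiv> basis_vec (std_nword u)"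

text \<open>No products are available here, in contrast to \<open>super_span\<close>: everything has
  to become a linear combination of standard nonassociative words modulo the ideal.\<close>

definition lie_span :: "('x::linorder nword \<Rightarrow>\<^sub>0 'k::field) \<Rightarrow> 'x list set \<Rightarrow> ('x nword \<Rightarrow>\<^sub>0 'k) set" where
  "lie_span f A = lin_span (std_vec ` {z \<in> A. standard_word z} \<union> lie_ideal f)"

lemma lie_span_mono: "A \<subseteq> B \<Longrightarrow> lie_span f A \<subseteq> lie_span f B"
  unfolding lie_span_def by (intro V.span_mono) auto

lemma lie_span_add: "a \<in> lie_span f A \<Longrightarrow> b \<in> lie_span f A \<Longrightarrow> a + b \<in> lie_span f A"
  and lie_span_diff: "a \<in> lie_span f A \<Longrightarrow> b \<in> lie_span f A \<Longrightarrow> a - b \<in> lie_span f A"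
  and lie_span_scale: "a \<in> lie_span f A \<Longrightarrow> scale c a \<in> lie_span f A"
  unfolding lie_span_def by (fact V.span_add V.span_diff V.span_scale)+

lemma lie_span_base: "standard_word z \<Longrightarrow> z \<in> A \<Longrightarrow> std_vec z \<in> lie_span f A"
  unfolding lie_span_def by (rule V.span_base) simp

lemma lie_span_ideal: "a \<in> lie_ideal f \<Longrightarrow> a \<in> lie_span f A"
  unfolding lie_span_def by (rule V.span_base) simp

lemma lie_span_nbr_left:
  assumes a: "a \<in> lie_span f A"
    and "\<And>z. z \<in> A \<Longrightarrow> standard_word z \<Longrightarrow> nbr (std_vec z) b \<in> lie_span f B"
  shows "nbr a b \<in> lie_span f B"
  using klinear_nbr_left a[unfolded lie_span_def] unfolding lie_span_def[of f B]
  by (rule klinear_span)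
    (use assms(2) in \<open>auto simp flip: lie_span_def intro: lie_span_ideal lie_ideal.bracket_right\<close>)

lemma lie_span_nbr_right:
  assumes a: "a \<in> lie_span f A"
    and "\<And>z. z \<in> A \<Longrightarrow> standard_word z \<Longrightarrow> nbr b (std_vec z) \<in> lie_span f B"
  shows "nbr b a \<in> lie_span f B"
  using klinear_nbr_right a[unfolded lie_span_def] unfolding lie_span_def[of f B]
  by (rule klinear_span)
    (use assms(2) in \<open>auto simp flip: lie_span_def intro: lie_span_ideal lie_ideal.bracket_left\<close>)

lemma lie_span_nbr_swap:
  assumes "nbr b a \<in> lie_span f A"
  shows "nbr a b \<in> lie_span f A"
  using lie_span_diff[OF lie_span_ideal[OF nbr_anticommute] assms, of a b] by simp

lemma words_gt_trans: "v \<in> words_gt u \<Longrightarrow> words_ge v \<subseteq> words_gt u"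
  unfolding words_ge_def words_gt_def using lexless_trans by fastforce

lemma finite_longer_words: "finite {z :: 'x::{finite,linorder} list. length z = n \<and> u \<prec> z}"
  by (rule finite_subset[OF _ finite_lists_length_eq[of UNIV n]]) auto

text \<open>
  In the Leibniz expansion of \<open>[[u\<^sub>1, u\<^sub>2], v]\<close> the term \<open>[[u\<^sub>1, v], u\<^sub>2]\<close> is no shorter than the
  original bracket; the second component of the measure decreases there because the brackets of
  standard words it produces have a concatenation \<open>\<succ> u v\<close>.
\<close>

lemma std_vec_bracket:
  fixes u v :: "'x::{finite,linorder} list" and f :: "'x nword \<Rightarrow>\<^sub>0 'k::field"
  assumes "standard_word u" "standard_word v" "u \<prec> v"
  shows "nbr (std_vec u) (std_vec v) - std_vec (u @ v) \<in> lie_span f (words_gt (u @ v))"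
  using assms
proof (induction "(u, v)" arbitrary: u v
    rule: wf_induct_rule[OF wf_measures[of "[\<lambda>(u, v). length (u @ v),
      \<lambda>(u, v). card {z. length z = length (u @ v) \<and> u @ v \<prec> z}, \<lambda>(u, v). length u]"]])
  case (1 u v)
  have IH: "nbr (std_vec a) (std_vec b) - std_vec (a @ b) \<in> lie_span f (words_gt (a @ b))"
    if "standard_word a" "standard_word b" "a \<prec> b"
      "length (a @ b) < length (u @ v) \<or> length (a @ b) = length (u @ v) \<and> u @ v \<prec> a @ b \<or>
        a @ b = u @ v \<and> length a < length u" for a b
  proof (rule 1(1))
    have "card {z. length z = length (a @ b) \<and> a @ b \<prec> z} < card {z. length z = length (u @ v) \<and> u @ v \<prec> z}"
      if "length (a @ b) = length (u @ v)" "u @ v \<prec> a @ b"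
    proof (rule psubset_card_mono[OF finite_longer_words])
      have "a @ b \<in> {z. length z = length (u @ v) \<and> u @ v \<prec> z}"
          "a @ b \<notin> {z. length z = length (a @ b) \<and> a @ b \<prec> z}"
        using that by auto
      moreover have "{z. length z = length (a @ b) \<and> a @ b \<prec> z}
          \<subseteq> {z. length z = length (u @ v) \<and> u @ v \<prec> z}"
        using that lexless_trans[OF that(2)] by auto
      ultimately show "{z. length z = length (a @ b) \<and> a @ b \<prec> z}
          \<subset> {z. length z = length (u @ v) \<and> u @ v \<prec> z}"
        by blast
    qed
    moreover have "length (a @ b) = length (u @ v)" if "a @ b = u @ v"
      using that by simp
    moreover have "card {z. length z = length (a @ b) \<and> a @ b \<prec> z} = card {z. length z = length (u @ v) \<and> u @ v \<prec> z}"
      if "a @ b = u @ v"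
      unfolding that ..
    ultimately show "((a, b), (u, v)) \<in> measures [\<lambda>(u, v). length (u @ v),
        \<lambda>(u, v). card {z. length z = length (u @ v) \<and> u @ v \<prec> z}, \<lambda>(u, v). length u]"
      using that(4) by (auto simp del: length_append)
  qed (use that in auto)
  have ge: "nbr (std_vec a) (std_vec b) \<in> lie_span f (words_ge (a @ b))"
    if "standard_word a" "standard_word b" "a \<prec> b"
      "length (a @ b) < length (u @ v) \<or> length (a @ b) = length (u @ v) \<and> u @ v \<prec> a @ b" for a b
  proof -
    have "nbr (std_vec a) (std_vec b) - std_vec (a @ b) \<in> lie_span f (words_ge (a @ b))"
      using IH[OF that(1-3)] that(4) lie_span_mono[of "words_gt (a @ b)" "words_ge (a @ b)" f]
      by (auto simp: words_ge_gt)
    moreover have "std_vec (a @ b) \<in> lie_span f (words_ge (a @ b))"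
      using that by (intro lie_span_base standard_word_append) (auto simp: words_ge_def)
    ultimately show ?thesis
      using lie_span_add by fastforce
  qed
  have gt: "nbr (std_vec a) (std_vec b) \<in> lie_span f (words_gt (u @ v))"
    if "standard_word a" "standard_word b" "a \<prec> b" "mset (a @ b) = mset (u @ v)" "u @ v \<prec> a @ b" for a b
    using ge[OF that(1-3)] that(4,5) mset_eq_length[OF that(4)]
      lie_span_mono[OF words_gt_trans, of "a @ b" "u @ v" f] by (auto simp: words_gt_def)
  show ?case
    using 1(2-4)
  proof (cases rule: std_nword_append_cases)
    case standard
    then show ?thesis
      by (simp add: nbr_basis_vec lie_span_ideal lie_ideal_zero)
  next
    case (split u1 u2)
    have ne: "u1 \<noteq> []" "u2 \<noteq> []" "v \<noteq> []"
      using split 1 standard_word_nonempty by auto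
    have std: "standard_word (u2 @ v)"
      using split 1 by (intro standard_word_append)
    have "u1 \<prec> u2 @ v"
      using split(4) lexless_append[OF ne(3), of u2] lexless_trans by blast
    have "u2 @ v \<prec> v"
      using split 1 by (intro standard_word_append_less)
    have "u1 \<prec> v"
      using split lexless_trans by blast
    have "strictly_before u u2"
      using standard_word_suffix[OF 1(2) split(1)] ne split(1) by (simp add: lexless_strict_length)
    let ?A = "std_vec u1" and ?B = "std_vec u2" and ?C = "std_vec v"
    let ?X = "nbr ?B ?C - std_vec (u2 @ v)"
    have "?X \<in> lie_span f (words_gt (u2 @ v))"
      using IH[of u2 v] split 1(3) ne by simp
    then have X: "nbr ?A ?X \<in> lie_span f (words_gt (u @ v))"
    proof (rule lie_span_nbr_right)
      fix z
      assume z: "z \<in> words_gt (u2 @ v)" "standard_word z"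
      then have "u1 \<prec> z"
        using \<open>u1 \<prec> u2 @ v\<close> lexless_trans by (auto simp: words_gt_def)
      then show "nbr ?A (std_vec z) \<in> lie_span f (words_gt (u @ v))"
        using gt[of u1 z] split(1,2) z by (simp add: words_gt_def)
    qed
    have Z: "nbr ?A (std_vec (u2 @ v)) - std_vec (u @ v) \<in> lie_span f (words_gt (u @ v))"
      using IH[of u1 "u2 @ v"] split(1,2) ne std \<open>u1 \<prec> u2 @ v\<close> by simp
    have "nbr ?A ?C \<in> lie_span f (words_ge (u1 @ v))"
      using ge[of u1 v] split(1,2) 1(3) ne \<open>u1 \<prec> v\<close> by simp
    then have Y: "nbr (nbr ?A ?C) ?B \<in> lie_span f (words_gt (u @ v))"
    proof (rule lie_span_nbr_left)
      fix z
      assume z: "z \<in> words_ge (u1 @ v)" "standard_word z"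
      have ms: "mset (z @ u2) = mset (u @ v)" "mset (u2 @ z) = mset (u @ v)"
        using z split(1) by (auto simp: words_ge_def)
      \<comment> \<open>The bracket is turned so that the smaller word comes first. For z \<prec>
        u2, the rotation inequality of \<open>u2 @ v\<close> gives \<open>u @ v\<close> \<prec>
        \<open>u1 @ v @ u2\<close> \<preceq> \<open>z @ u2\<close>. For u2 \<prec> z, the difference
        between u and u2 at a letter gives \<open>u @ v\<close> \<prec>
        \<open>u2 @ z\<close>.\<close>
      consider "z = u2" | "z \<prec> u2" | "u2 \<prec> z"
        using lexless_linear by blast
      then show "nbr (std_vec z) ?B \<in> lie_span f (words_gt (u @ v))"
      proof cases
        case 1
        then show ?thesis
          using lie_span_ideal lie_ideal.alternating by blast
      next
        case 2
        have "u @ v \<prec> (u1 @ v) @ u2"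
          using standard_word_rotation[OF std refl] ne split(1) by simp
        moreover have "(u1 @ v) @ u2 \<preceq> z @ u2"
          using z(1) mset_eq_length[of z "u1 @ v"]
            strictly_before_append[OF lexless_strict_length, of "u1 @ v" z u2 u2]
          by (auto simp: words_ge_def)
        ultimately have "u @ v \<prec> z @ u2"
          using lexless_trans by metis
        then show ?thesis
          by (rule gt[OF z(2) split(3) 2 ms(1)])
      next
        case 3
        have "u @ v \<prec> u2 @ z"
          using strictly_before_append[OF \<open>strictly_before u u2\<close>] .
        then show ?thesis
          by (rule lie_span_nbr_swap[OF gt[OF split(3) z(2) 3 ms(2)]])
      qed
    qed
    have "nbr (nbr ?A ?B) ?C - (nbr ?A (nbr ?B ?C) + nbr (nbr ?A ?C) ?B)
        + (nbr ?A ?X + (nbr ?A (std_vec (u2 @ v)) - std_vec (u @ v)) + nbr (nbr ?A ?C) ?B)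
        \<in> lie_span f (words_gt (u @ v))"
      by (rule lie_span_add[OF lie_span_ideal[OF nbr_leibniz] lie_span_add[OF lie_span_add[OF X Z] Y]])
    moreover have "nbr ?A ?B = (std_vec u :: 'x nword \<Rightarrow>\<^sub>0 'k)"
      using split by (simp add: nbr_basis_vec)
    ultimately show ?thesis
      by (simp add: klinear_diff[OF klinear_nbr_right] algebra_simps)
  qed
qed

lemma std_vec_bracket_ge:
  fixes u v :: "'x::{finite,linorder} list"
  assumes "standard_word u" "standard_word v" "u \<prec> v"
  shows "nbr (std_vec u) (std_vec v) \<in> lie_span f (words_ge (u @ v))"
proof -
  have "nbr (std_vec u) (std_vec v) - std_vec (u @ v) \<in> lie_span f (words_ge (u @ v))"
    using std_vec_bracket[OF assms, of f] lie_span_mono[of "words_gt (u @ v)" "words_ge (u @ v)" f]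
    by (auto simp: words_ge_gt)
  moreover have "std_vec (u @ v) \<in> lie_span f (words_ge (u @ v))"
    using assms by (intro lie_span_base standard_word_append) (auto simp: words_ge_def)
  ultimately show ?thesis
    using lie_span_add by fastforce
qed

section \<open>From Lie brackets to commutators\<close>

lemma star_nbr:
  "star \<chi> \<gamma> (nbr a b) = star \<chi> \<gamma> a * star \<chi> \<gamma> b - star \<chi> \<gamma> b * star \<chi> \<gamma> a"
  if "\<And>u v. pp \<chi> \<gamma> u v = 1"
proof -
  have lin: "klinear (star \<chi> \<gamma>)"
    unfolding star_def by (rule klinear_lin_ext)
  have basis: "star \<chi> \<gamma> (basis_vec s) = skew_value \<chi> \<gamma> s" for s
    by (simp add: star_def)
  have "star \<chi> \<gamma> (nbr (basis_vec s) b) = star \<chi> \<gamma> (basis_vec s) * star \<chi> \<gamma> b - star \<chi> \<gamma> b * star \<chi> \<gamma> (basis_vec s)" for s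
    by (rule klinear_eqI[of "\<lambda>b. star \<chi> \<gamma> (nbr (basis_vec s) b)" _ b])
      (auto intro!: klinear_comp[OF lin klinear_nbr_right] klinear_intros lin
        simp: nbr_basis_vec basis that)
  then show ?thesis
    by (intro klinear_eqI[of "\<lambda>a. star \<chi> \<gamma> (nbr a b)" _ a])
      (auto intro!: klinear_comp[OF lin klinear_nbr_left] klinear_intros lin)
qed

text \<open>Commutators satisfy the Lie identities, whose instances thus go to 0; f goes to f*, and
  a commutator with an element of the ideal stays in the ideal.\<close>

lemma star_lie_ideal:
  assumes pp: "\<And>u v. pp \<chi> \<gamma> u v = 1" and a: "a \<in> lie_ideal f"
  shows "star \<chi> \<gamma> a \<in> ideal_gen {star \<chi> \<gamma> f}"
proof -
  have lin: "klinear (star \<chi> \<gamma>)"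
    unfolding star_def by (rule klinear_lin_ext)
  show ?thesis
    using a
  proof induction
    case (jacobi a b c)
    have "star \<chi> \<gamma> (nbr (nbr a b) c + nbr (nbr b c) a + nbr (nbr c a) b) = 0"
      by (simp add: klinear_add[OF lin] star_nbr[OF pp] algebra_simps)
    then show ?case by (simp add: ideal_gen.zero)
  qed (auto simp: klinear_add[OF lin] klinear_scale[OF lin] star_nbr[OF pp]
      intro: ideal_gen.zero ideal_gen.gen ideal_gen.add ideal_gen_scale ideal_gen_diff
        ideal_gen.mult_left ideal_gen.mult_right)
qed

section \<open>Reducible words in the Lie algebra\<close>

context degrees
begin

definition lower_words :: "'x list \<Rightarrow> 'x list set" where
  "lower_words u = {v. lower_word D v u}"

text \<open>If b \<prec> a, the bracket is reversed before rewriting and leads to words from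
  \<open>b @ a\<close> upwards; this is why both concatenations must be lower than u.\<close>

lemma lie_bracket_lower:
  fixes f :: "'x nword \<Rightarrow>\<^sub>0 'k::field"
  assumes ab: "standard_word a" "standard_word b" "lower_word D (a @ b) u" "lower_word D (b @ a) u"
  shows "nbr (std_vec a) (std_vec b) \<in> lie_span f (lower_words u)"
proof -
  have sub: "words_ge x \<subseteq> lower_words u" if "lower_word D x u" for x
    using words_ge_lower_word that by (auto simp: lower_words_def)
  consider "a = b" | "a \<prec> b" | "b \<prec> a"
    using lexless_linear by blast
  then show ?thesis
  proof cases
    case 1
    then show ?thesis
      using lie_span_ideal lie_ideal.alternating by blast
  next
    case 2
    then show ?thesis
      using std_vec_bracket_ge[OF ab(1,2)] lie_span_mono[OF sub[OF ab(3)]] by blast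
  next
    case 3
    show ?thesis
      by (rule lie_span_nbr_swap[OF subsetD[OF lie_span_mono[OF sub[OF ab(4)]]
            std_vec_bracket_ge[OF ab(2,1) 3]]])
  qed
qed

lemma leading_not_basic:
  assumes f: "Poly_Mapping.keys f \<subseteq> standard_nwords" and w: "leading_standard_word f w"
  shows "std_vec w \<in> lie_span f (lower_words w)"
proof -
  define c where "c = Poly_Mapping.lookup f (std_nword w)"
  have wk: "std_nword w \<in> Poly_Mapping.keys f"
    using w by (simp add: leading_standard_word_def)
  then have "c \<noteq> 0"
    by (simp add: c_def in_keys_iff)
  let ?t = "\<lambda>s. scale (Poly_Mapping.lookup f s) (basis_vec s)"
  have "basis_vec s \<in> lie_span f (lower_words w)" if s: "s \<in> Poly_Mapping.keys f - {std_nword w}" for s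
  proof -
    obtain v where v: "s = std_nword v" "standard_word v"
      using s f unfolding standard_nwords_def by blast
    then have "lower_word D v w"
      using w s by (auto simp: leading_standard_word_def)
    then show ?thesis
      using v by (auto intro!: lie_span_base simp: lower_words_def)
  qed
  then have "sum ?t (Poly_Mapping.keys f - {std_nword w}) \<in> lie_span f (lower_words w)"
    unfolding lie_span_def by (intro V.span_sum V.span_scale)
  then have "scale (inverse c) (f - sum ?t (Poly_Mapping.keys f - {std_nword w})) \<in> lie_span f (lower_words w)"
    by (rule lie_span_scale[OF lie_span_diff[OF lie_span_ideal[OF lie_ideal.relation]]])
  moreover have "f = scale c (std_vec w) + sum ?t (Poly_Mapping.keys f - {std_nword w})"
    using poly_eq_sum[of f] sum.remove[OF finite_keys wk, of ?t] by (simp add: c_def)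
  then have "f - sum ?t (Poly_Mapping.keys f - {std_nword w}) = scale c (std_vec w)"
    by (simp add: algebra_simps)
  ultimately show ?thesis
    using \<open>c \<noteq> 0\<close> by simp
qed

text \<open>The factor containing w is replaced, by induction, by lower words z. The concatenation
  in the given order is lower than u by monotonicity; the reversed one is so because u \<prec>
  b.\<close>

lemma reducible_not_basic:
  assumes f: "Poly_Mapping.keys f \<subseteq> standard_nwords"
    and "standard_word u" "leading_standard_word f w" "subword w u"
  shows "std_vec u \<in> lie_span f (lower_words u)"
  using assms(2,4)
proof (induction "length u" arbitrary: u rule: less_induct)
  case less
  show ?case
  proof (cases "w = u")
    case True
    then show ?thesis
      using leading_not_basic f assms(3) by simp
  next
    case False
    then obtain a b where u: "u = a @ b" and ab: "standard_word a" "standard_word b" "a \<prec> b"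
      and w: "subword w a \<or> subword w b"
      using standard_word_subword_split[of u w] less.prems assms(3)
      by (auto simp: leading_standard_word_def)
    have ne: "a \<noteq> []" "b \<noteq> []"
      using ab standard_word_nonempty by auto
    have "u \<prec> b"
      unfolding u using ab by (rule standard_word_append_less)
    have "u \<prec> b @ z" for z
      using \<open>u \<prec> b\<close> lexless_append[of z b] lexless_trans by (cases "z = []") auto
    from w have "nbr (std_vec a) (std_vec b) \<in> lie_span f (lower_words u)"
    proof
      assume "subword w a"
      then have "std_vec a \<in> lie_span f (lower_words a)"
        using less.hyps[of a] u ab ne by simp
      then show ?thesis
      proof (rule lie_span_nbr_left)
        fix z
        assume z: "z \<in> lower_words a" "standard_word z"
        have "lower_word D (z @ b) u"
          using z lower_word_append[of z a "[]" b] u by (simp add: lower_words_def)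
        moreover have "lower_word D (b @ z) u"
          using z \<open>u \<prec> b @ z\<close> u
          by (auto simp: lower_words_def lower_word_def word_deg_append add.commute)
        ultimately show "nbr (std_vec z) (std_vec b) \<in> lie_span f (lower_words u)"
          using z ab by (intro lie_bracket_lower)
      qed
    next
      assume "subword w b"
      then have "std_vec b \<in> lie_span f (lower_words b)"
        using less.hyps[of b] u ab ne by simp
      then show ?thesis
      proof (rule lie_span_nbr_right)
        fix z
        assume z: "z \<in> lower_words b" "standard_word z"
        have "lower_word D (a @ z) u"
          using z lower_word_append[of z b a "[]"] u by (simp add: lower_words_def)
        moreover have "u \<prec> z @ a" if "b \<prec> z"
          using that \<open>u \<prec> b\<close> lexless_append[of a z] ne lexless_trans by blast
        then have "lower_word D (z @ a) u"
          using z u by (auto simp: lower_words_def lower_word_def word_deg_append add.commute)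
        ultimately show "nbr (std_vec a) (std_vec z) \<in> lie_span f (lower_words u)"
          using z ab by (intro lie_bracket_lower)
      qed
    qed
    moreover have "nbr (std_vec a) (std_vec b) - std_vec u \<in> lie_span f (lower_words u)"
      using std_vec_bracket[OF ab, of f] lie_span_mono[of "words_gt u" "lower_words u" f] u
        words_gt_lower_word by (auto simp: lower_words_def)
    ultimately show ?thesis
      using lie_span_diff by fastforce
  qed
qed

lemma basic_if_irreducible:
  fixes f :: "'x nword \<Rightarrow>\<^sub>0 'k::field"
  assumes f: "Poly_Mapping.keys f \<subseteq> standard_nwords" and u: "standard_word u" "\<not> reducible f u"
    and c: "c \<in> lin_span (std_vec ` {v \<in> lower_words u. standard_word v})" "std_vec u - c \<in> lie_ideal f"
  shows False
proof -
  \<comment> \<open>With trivial characters all p are 1 and skew commutators become ordinary ones,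
    so \<open>star\<close> respects the Lie identities; the leading words of super-letters are the
    same for all characters.\<close>
  define \<chi> where "\<chi> = (\<lambda>(_ :: 'x) (_ :: int). 1 :: 'k)"
  define \<gamma> where "\<gamma> = (\<lambda>_ :: 'x. 0 :: int)"
  have pp: "pp \<chi> \<gamma> u v = 1" for u v
    by (induction u) (simp_all add: pp_def word_char_def \<chi>_def)
  have lin: "klinear (star \<chi> \<gamma>)"
    unfolding star_def by (rule klinear_lin_ext)
  have basis: "star \<chi> \<gamma> (std_vec v) = super_letter \<chi> \<gamma> v" for v
    by (simp add: star_def super_letter_def)
  have "star \<chi> \<gamma> c \<in> lin_span (lower_polys u)"
    using lin c(1)
    by (rule klinear_span)
      (auto simp: basis lower_words_def intro!: V.span_base monic_at_lower monic_at_super_letter)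
  then have "star \<chi> \<gamma> c \<in> lower_polys u"
    using span_lower_polys by blast
  then have "(super_letter \<chi> \<gamma> u - basis_vec u) - star \<chi> \<gamma> c \<in> lower_polys u"
    using monic_at_super_letter[OF u(1)] by (intro lower_polys_diff monic_at_lower_polys)
  then have "leading_word (super_letter \<chi> \<gamma> u - star \<chi> \<gamma> c) u"
    by (intro leading_wordI[of _ 1]) (simp_all add: algebra_simps)
  moreover have "star \<chi> \<gamma> (std_vec u - c) \<in> ideal_gen {star \<chi> \<gamma> f}"
    using star_lie_ideal[OF pp c(2)] .
  ultimately show False
    using leading_word_star_ideal[OF f, of _ \<chi> \<gamma> u] u(2) by (simp add: klinear_diff[OF lin] basis)
qed

lemma hall_shirshov_iff:
  assumes f: "Poly_Mapping.keys f \<subseteq> standard_nwords" and u: "standard_word u"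
  shows "std_nword u \<in> hall_shirshov_basis D f \<longleftrightarrow> \<not> reducible f u"
proof -
  let ?A = "\<lambda>u. {basis_vec (std_nword v) | v. standard_word v \<and>
      (word_deg D v < word_deg D u \<or> word_deg D v = word_deg D u \<and> word_less v u)}"
  have A: "?A u = std_vec ` {v \<in> lower_words u. standard_word v}" for u
    by (auto simp: lower_words_def lower_word_def word_less_def)
  \<comment> \<open>\<open>foliage\<close> recovers a standard word from its nonassociative word, so
    membership in the basis can be tested at u alone.\<close>
  have "u = v" if "std_nword u = std_nword v" "standard_word v" for v
    using that u foliage_std_nword by metis
  then have "std_nword u \<in> hall_shirshov_basis D f \<longleftrightarrow>
      \<not> (\<exists>c\<in>lin_span (?A u). std_vec u - c \<in> lie_ideal f)"
    using u unfolding hall_shirshov_basis_def by blast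
  also have "\<dots> \<longleftrightarrow> \<not> reducible f u"
  proof
    assume none: "\<not> (\<exists>c\<in>lin_span (?A u). std_vec u - c \<in> lie_ideal f)"
    show "\<not> reducible f u"
    proof
      assume "reducible f u"
      then have "std_vec u \<in> lie_span f (lower_words u)"
        using reducible_not_basic[OF f u] by (auto simp: reducible_def)
      then obtain c i where "std_vec u = c + i" "c \<in> lin_span (?A u)" "i \<in> lie_ideal f"
        unfolding lie_span_def V.span_Un A span_lie_ideal by blast
      then have "std_vec u - c \<in> lie_ideal f" "c \<in> lin_span (?A u)"
        by simp_all
      then show False
        using none by blast
    qed
  next
    assume "\<not> reducible f u"
    then show "\<not> (\<exists>c\<in>lin_span (?A u). std_vec u - c \<in> lie_ideal f)"
      unfolding A using basic_if_irreducible[OF f u] by blast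
  qed
  finally show ?thesis .
qed

end

theorem corollary8p1:
  fixes \<chi> :: "'x::{finite,linorder} \<Rightarrow> 'g::ab_group_add \<Rightarrow> 'k::field"
    and \<gamma> :: "'x \<Rightarrow> 'g"
    and D :: "'x \<Rightarrow> 'd::linordered_ab_group_add"
    and f :: "'x nword \<Rightarrow>\<^sub>0 'k"
  assumes characters: "\<And>i. character (\<chi> i)"
    and positive_degrees: "\<And>i. 0 < D i"
    and relation: "Poly_Mapping.keys f \<subseteq> standard_nwords"
    and homogeneous: "gg_homogeneous \<chi> \<gamma> (star \<chi> \<gamma> f)"
    and UP_defined: "quantum_operation \<chi> \<gamma> (star \<chi> \<gamma> f)"
  shows "{super_letter \<chi> \<gamma> u | u. standard_word u \<and> UP_hard \<chi> \<gamma> D f u}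
           = skew_value \<chi> \<gamma> ` hall_shirshov_basis D f
         \<and> (\<forall>u. standard_word u \<longrightarrow>
              (UP_hard \<chi> \<gamma> D f u \<longleftrightarrow> std_nword u \<in> hall_shirshov_basis D f))"
proof -
  interpret quantum_relation D \<chi> \<gamma> f
    using characters positive_degrees relation homogeneous by unfold_locales
  have iff: "UP_hard \<chi> \<gamma> D f u \<longleftrightarrow> std_nword u \<in> hall_shirshov_basis D f" if "standard_word u" for u
    using UP_hard_iff hall_shirshov_iff[OF relation] that by blast
  have "hall_shirshov_basis D f =
      std_nword ` {u. standard_word u \<and> std_nword u \<in> hall_shirshov_basis D f}"
    unfolding hall_shirshov_basis_def by blast
  also have "\<dots> = std_nword ` {u. standard_word u \<and> UP_hard \<chi> \<gamma> D f u}"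
    using iff by (intro arg_cong[of _ _ "\<lambda>S. std_nword ` S"] Collect_cong) blast
  finally have "skew_value \<chi> \<gamma> ` hall_shirshov_basis D f =
      super_letter \<chi> \<gamma> ` {u. standard_word u \<and> UP_hard \<chi> \<gamma> D f u}"
    by (simp add: image_image super_letter_def)
  then show ?thesis
    using iff by blast
qed

end
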